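(* Let $G$ be a Cohen–Macaulay chordal graph with matching number at least $2$. Then $$\mathrm{reg}(I(G)^{[2]})=\mathrm{aim}(G,2)+2.$$
   Context: All graphs are finite and simple. For $W\subseteq V(G)$, $G[W]$ is the induced subgraph on $W$. A graph is chordal if it has no induced cycle of length $\ge4$. A vertex $x$ is a free vertex of $G$ if the induced subgraph on its open neighborhood $N_G(x)$ is complete. A graph $G$ is a Cohen–Macaulay chordal graph if $G$ is chordal and $V(G)$ can be partitioned into $W_1,\dots,W_m$ such that each $G[W_i]$ is a maximal clique of $G$ containing a free vertex of $G$. A matching of $G$ is a set $M$ of pairwise disjoint edges; $V(M)$ is the set of vertices covered by $M$; the matching number is the maximum size of a matching. Identifying $V(G)$ with the variables of a polynomial ring $R$ over a field $\mathbb{K}$, $I(G)=\langle xy:\{x,y\}\in E(G)\rangle$, and $I(G)^{[2]}$ is the ideal generated by the square-free monomials in $I(G)^2$ (equivalently by the products $x_ax_bx_cx_d$ with $\{x_a,x_b\},\{x_c,x_d\}$ disjoint edges of $G$). For a graded ideal $I$, $\mathrm{reg}(I)=\max\{j-i:\beta_{i,j}(I)\neq0\}$. A matching $M$ of $G$ is $2$-admissible if there is a partition $M=M_1\sqcup\cdots\sqcup M_r$ into nonempty parts such that every edge of $G[V(M)]$ is an edge of $G[V(M_i)]$ for some $i$, and $|M|\le r+1$. $\mathrm{aim}(G,2)$ is the maximum size of a $2$-admissible matching of $G$. *)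

theory Defs
  imports "HOL-Library.Poly_Mapping" "HOL-Library.Disjoint_Sets"
begin

section \<open>Finite simple graphs\<close>

definition simple_graph :: "'v set \<Rightarrow> 'v set set \<Rightarrow> bool" where
  "simple_graph V E \<longleftrightarrow> finite V \<and> (\<forall>e\<in>E. e \<subseteq> V \<and> card e = 2)"

definition induced_edges :: "'v set set \<Rightarrow> 'v set \<Rightarrow> 'v set set" where
  "induced_edges E W = {e\<in>E. e \<subseteq> W}"

text \<open>The vertices of an induced cycle of length \<open>n\<close> are listed as \<open>c 0, \<dots>, c (n - 1)\<close>.\<close>

definition induced_cycle :: "'v set \<Rightarrow> 'v set set \<Rightarrow> nat \<Rightarrow> (nat \<Rightarrow> 'v) \<Rightarrow> bool" where
  "induced_cycle V E n c \<longleftrightarrow> n \<ge> 3 \<and> inj_on c {..<n} \<and> c ` {..<n} \<subseteq> V \<and>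
     (\<forall>i<n. \<forall>j<n. {c i, c j} \<in> E \<longleftrightarrow> j = Suc i mod n \<or> i = Suc j mod n)"

definition chordal :: "'v set \<Rightarrow> 'v set set \<Rightarrow> bool" where
  "chordal V E \<longleftrightarrow> \<not> (\<exists>n\<ge>4. \<exists>c. induced_cycle V E n c)"

definition neighborhood :: "'v set \<Rightarrow> 'v set set \<Rightarrow> 'v \<Rightarrow> 'v set" where
  "neighborhood V E x = {y\<in>V. {x, y} \<in> E}"

definition clique :: "'v set \<Rightarrow> 'v set set \<Rightarrow> 'v set \<Rightarrow> bool" where
  "clique V E W \<longleftrightarrow> W \<subseteq> V \<and> (\<forall>x\<in>W. \<forall>y\<in>W. x \<noteq> y \<longrightarrow> {x, y} \<in> E)"

definition maximal_clique :: "'v set \<Rightarrow> 'v set set \<Rightarrow> 'v set \<Rightarrow> bool" where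
  "maximal_clique V E W \<longleftrightarrow> clique V E W \<and> (\<forall>W'. clique V E W' \<and> W \<subseteq> W' \<longrightarrow> W' = W)"

definition free_vertex :: "'v set \<Rightarrow> 'v set set \<Rightarrow> 'v \<Rightarrow> bool" where
  "free_vertex V E x \<longleftrightarrow> x \<in> V \<and> clique V E (neighborhood V E x)"

definition cm_chordal :: "'v set \<Rightarrow> 'v set set \<Rightarrow> bool" where
  "cm_chordal V E \<longleftrightarrow> chordal V E \<and>
     (\<exists>P. partition_on V P \<and> (\<forall>W\<in>P. maximal_clique V E W \<and> (\<exists>x\<in>W. free_vertex V E x)))"

definition matching :: "'v set set \<Rightarrow> 'v set set \<Rightarrow> bool" where
  "matching E M \<longleftrightarrow> M \<subseteq> E \<and> disjoint M"

definition matching_number :: "'v set set \<Rightarrow> nat" where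
  "matching_number E = Max {card M |M. matching E M}"

text \<open>The covered vertex set of a matching \<open>M\<close> is \<open>\<Union>M\<close>.\<close>

definition two_admissible :: "'v set set \<Rightarrow> 'v set set \<Rightarrow> bool" where
  "two_admissible E M \<longleftrightarrow> matching E M \<and>
     (\<exists>P. partition_on M P \<and>
          (\<forall>e \<in> induced_edges E (\<Union>M). \<exists>N\<in>P. e \<in> induced_edges E (\<Union>N)) \<and>
          card M \<le> card P + 1)"

definition aim2 :: "'v set set \<Rightarrow> nat" where
  "aim2 E = Max {card M |M. two_admissible E M}"


section \<open>The polynomial ring on a set of variables and its ideals\<close>

type_synonym ('v, 'k) mpoly = "('v \<Rightarrow>\<^sub>0 nat) \<Rightarrow>\<^sub>0 'k"

definition poly_ring :: "'v set \<Rightarrow> ('v, 'k::field) mpoly set" where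
  "poly_ring V = {p. \<forall>m \<in> Poly_Mapping.keys p. Poly_Mapping.keys m \<subseteq> V}"

definition var :: "'v \<Rightarrow> ('v, 'k::field) mpoly" where
  "var v = Poly_Mapping.single (Poly_Mapping.single v 1) 1"

definition mon_deg :: "('v \<Rightarrow>\<^sub>0 nat) \<Rightarrow> nat" where
  "mon_deg m = (\<Sum>v \<in> Poly_Mapping.keys m. Poly_Mapping.lookup m v)"

definition squarefree_monomial :: "('v, 'k::field) mpoly \<Rightarrow> bool" where
  "squarefree_monomial f \<longleftrightarrow>
     (\<exists>m. f = Poly_Mapping.single m 1 \<and> (\<forall>v. Poly_Mapping.lookup m v \<le> 1))"

text \<open>The ideal of \<open>poly_ring V\<close> generated by a set \<open>S \<subseteq> poly_ring V\<close>.\<close>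

definition ideal_gen :: "'v set \<Rightarrow> ('v, 'k::field) mpoly set \<Rightarrow> ('v, 'k) mpoly set" where
  "ideal_gen V S = {\<Sum>f\<in>T. q f * f |T q. finite T \<and> T \<subseteq> S \<and> q ` T \<subseteq> poly_ring V}"

definition ideal_mult ::
  "'v set \<Rightarrow> ('v, 'k::field) mpoly set \<Rightarrow> ('v, 'k) mpoly set \<Rightarrow> ('v, 'k) mpoly set" where
  "ideal_mult V I J = ideal_gen V {f * g |f g. f \<in> I \<and> g \<in> J}"

definition edge_ideal :: "'v set \<Rightarrow> 'v set set \<Rightarrow> ('v, 'k::field) mpoly set" where
  "edge_ideal V E = ideal_gen V {var x * var y |x y. {x, y} \<in> E}"

definition squarefree_square :: "'v set \<Rightarrow> ('v, 'k::field) mpoly set \<Rightarrow> ('v, 'k) mpoly set" where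
  "squarefree_square V I = ideal_gen V {f \<in> ideal_mult V I I. squarefree_monomial f}"


section \<open>Graded Betti numbers and regularity\<close>

text \<open>
  Data of a complex \<open>\<dots> \<rightarrow> F\<^sub>2 \<rightarrow> F\<^sub>1 \<rightarrow> F\<^sub>0 \<rightarrow> I\<close> of graded free modules of finite rank over
  \<open>R = poly_ring V\<close>: \<open>F\<^sub>i\<close> has the basis \<open>e\<^sub>0, \<dots>, e\<^sub>n\<^sub>-\<^sub>1\<close> with \<open>n = res_rank F i\<close>, where the
  basis element with index \<open>c\<close> has degree \<open>res_deg F i c\<close>.  The augmentation sends the basis element
  \<open>c\<close> of \<open>F\<^sub>0\<close> to \<open>res_aug F c\<close>, and \<open>res_mat F i\<close> is the matrix of \<open>F\<^sub>i\<^sub>+\<^sub>1 \<rightarrow> F\<^sub>i\<close>, the first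
  argument after \<open>i\<close> being the row.
\<close>

record (overloaded) ('v, 'k) resolution =
  res_rank :: "nat \<Rightarrow> nat"
  res_deg :: "nat \<Rightarrow> nat \<Rightarrow> nat"
  res_aug :: "nat \<Rightarrow> ('v, 'k) mpoly"
  res_mat :: "nat \<Rightarrow> nat \<Rightarrow> nat \<Rightarrow> ('v, 'k) mpoly"

definition free_mod :: "'v set \<Rightarrow> nat \<Rightarrow> (nat \<Rightarrow> ('v, 'k::field) mpoly) set" where
  "free_mod V n = {w. (\<forall>c<n. w c \<in> poly_ring V) \<and> (\<forall>c\<ge>n. w c = 0)}"

definition aug_map ::
  "('v, 'k::field) resolution \<Rightarrow> (nat \<Rightarrow> ('v, 'k) mpoly) \<Rightarrow> ('v, 'k) mpoly" where
  "aug_map F w = (\<Sum>c<res_rank F 0. res_aug F c * w c)"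

definition diff_map ::
  "('v, 'k::field) resolution \<Rightarrow> nat \<Rightarrow> (nat \<Rightarrow> ('v, 'k) mpoly) \<Rightarrow> (nat \<Rightarrow> ('v, 'k) mpoly)" where
  "diff_map F i w =
     (\<lambda>r. if r < res_rank F i then \<Sum>c<res_rank F (Suc i). res_mat F i r c * w c else 0)"

text \<open>
  The augmentation and all differentials preserve degrees: the \<open>(r, c)\<close> entry of a differential is
  homogeneous of degree \<open>res_deg F (Suc i) c - res_deg F i r\<close> (and zero if this is negative).
\<close>

definition graded_maps :: "'v set \<Rightarrow> ('v, 'k::field) resolution \<Rightarrow> bool" where
  "graded_maps V F \<longleftrightarrow>
     (\<forall>c<res_rank F 0. res_aug F c \<in> poly_ring V \<and>
        (\<forall>m \<in> Poly_Mapping.keys (res_aug F c). mon_deg m = res_deg F 0 c)) \<and>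
     (\<forall>i. \<forall>r<res_rank F i. \<forall>c<res_rank F (Suc i). res_mat F i r c \<in> poly_ring V \<and>
        (\<forall>m \<in> Poly_Mapping.keys (res_mat F i r c). mon_deg m + res_deg F i r = res_deg F (Suc i) c))"

definition graded_free_resolution ::
  "'v set \<Rightarrow> ('v, 'k::field) mpoly set \<Rightarrow> ('v, 'k) resolution \<Rightarrow> bool" where
  "graded_free_resolution V I F \<longleftrightarrow> graded_maps V F \<and>
     aug_map F ` free_mod V (res_rank F 0) = I \<and>
     {w \<in> free_mod V (res_rank F 0). aug_map F w = 0}
       = diff_map F 0 ` free_mod V (res_rank F 1) \<and>
     (\<forall>i. {w \<in> free_mod V (res_rank F (Suc i)). diff_map F i w = (\<lambda>_. 0)}
       = diff_map F (Suc i) ` free_mod V (res_rank F (Suc (Suc i))))"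

text \<open>
  Minimality: \<open>F\<^sub>i\<^sub>+\<^sub>1\<close> is mapped into \<open>\<mm> F\<^sub>i\<close>, where \<open>\<mm>\<close> is the ideal generated by the variables,
  i.e. no matrix entry has a constant term.
\<close>

definition minimal_graded_free_resolution ::
  "'v set \<Rightarrow> ('v, 'k::field) mpoly set \<Rightarrow> ('v, 'k) resolution \<Rightarrow> bool" where
  "minimal_graded_free_resolution V I F \<longleftrightarrow> graded_free_resolution V I F \<and>
     (\<forall>i. \<forall>r<res_rank F i. \<forall>c<res_rank F (Suc i). Poly_Mapping.lookup (res_mat F i r c) 0 = 0)"

text \<open>
  For finite \<open>V\<close>, a graded ideal of \<open>poly_ring V\<close> has a minimal graded free resolution, unique up to
  isomorphism, so the Betti numbers do not depend on the choice.
\<close>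

definition graded_betti :: "'v set \<Rightarrow> ('v, 'k::field) mpoly set \<Rightarrow> nat \<Rightarrow> nat \<Rightarrow> nat" where
  "graded_betti V I i j =
     (let F = SOME F. minimal_graded_free_resolution V I F
      in card {c. c < res_rank F i \<and> res_deg F i c = j})"

definition regularity :: "'v set \<Rightarrow> ('v, 'k::field) mpoly set \<Rightarrow> int" where
  "regularity V I = Max {int j - int i |i j. graded_betti V I i j \<noteq> 0}"

end

(*
  Koszul homology detects the graded Betti numbers of a minimal resolution of a squarefree monomial ideal,
  and in multidegree W it is the homology of the complex of all sets whose complement in W supports the ideal.

  Upper bound: let D consist of one free vertex from each clique of the partition.  Remove a vertex y outside D
  and split its colon ideal along the neighbours w of y.  The colon by the edge yw is an edge ideal, whose
  regularity is at most 1 plus the size of an independent set avoiding D.  Matching each vertex of such a set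
  with the free vertex of its block gives an induced matching, which two further disjoint edges complete to a
  2-admissible matching.

  Lower bound: in the multidegree of a maximum 2-admissible matching the boundary of a simplex is a cycle
  which is not a boundary.
*)
theory Submission
  imports Defs Complex_Main "HOL-Library.Function_Algebras"
begin

section \<open>Koszul complexes\<close>


text \<open>The constant: a maximum 2-admissible matching consists of two edges \<open>e\<close>,
  \<open>f\<close> and \<open>aim2 E - 2\<close> further edges, and every graph edge on its vertices
  lies in \<open>e \<union> f\<close> or is one of the further edges. Multidegree
  \<open>2 * aim2 E\<close> minus homological degree \<open>aim2 E - 2\<close> gives
  \<open>aim2 E + 2\<close>. The obstacle above: the colon by an edge \<open>yw\<close> also joins
  every neighbour of \<open>y\<close> to every neighbour of \<open>w\<close>. The neighbours of
  \<open>y\<close> are therefore treated in a fixed order: outside the block of \<open>y\<close>,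
  inside it, and its free vertex last. In this order the new edges either disappear when the closed
  neighbourhood of a well chosen vertex is removed or are old edges. Free vertices enter because
  every neighbour of \<open>z t\<close> other than \<open>t\<close> is a neighbour of
  \<open>t\<close>: the edge from \<open>t\<close> to \<open>z t\<close> conflicts with nothing that
  \<open>t\<close> does not already meet. Betti numbers are read off an arbitrarily chosen minimal
  resolution, so one has to be shown to exist. Its finite generation comes from the vanishing of
  Koszul homology in total degrees above the number of variables.\<close>

definition sgn_act :: "bool \<Rightarrow> 'a::ab_group_add \<Rightarrow> 'a" where
  "sgn_act b a = (if b then a else - a)"

lemma sgn_act_0 [simp]: "sgn_act b 0 = 0"
  by (simp add: sgn_act_def)

text \<open>Signs are Booleans with \<open>True\<close> as plus one, so the product of two signs is
  Boolean equality.\<close>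

lemma sgn_act_sgn_act: "sgn_act b (sgn_act b' a) = sgn_act (b = b') a"
  by (auto simp: sgn_act_def)

lemma sgn_act_add: "sgn_act b (a + a') = sgn_act b a + sgn_act b a'"
  by (simp add: sgn_act_def)

lemma sgn_act_diff: "sgn_act b (a - a') = sgn_act b a - sgn_act b a'"
  by (simp add: sgn_act_def)

lemma sgn_act_sum: "sgn_act b (sum f A) = (\<Sum>x\<in>A. sgn_act b (f x))"
  by (simp add: sgn_act_def sum_negf)

lemma sgn_act_eq_0_iff [simp]: "sgn_act b a = 0 \<longleftrightarrow> a = 0"
  by (simp add: sgn_act_def)

text \<open>Two instances matter: multiplication by the variables on polynomials or vectors of
  polynomials, and the identity on scalars, which is what multiplication becomes inside a single
  multidegree.\<close>

definition operators :: "('v \<Rightarrow> 'a::ab_group_add \<Rightarrow> 'a) \<Rightarrow> bool" where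
  "operators X \<longleftrightarrow> (\<forall>v a b. X v (a + b) = X v a + X v b) \<and> (\<forall>u v a. X u (X v a) = X v (X u a))"

lemma operators_add: "operators X \<Longrightarrow> X v (a + b) = X v a + X v b"
  by (simp add: operators_def)

lemma operators_commute: "operators X \<Longrightarrow> X u (X v a) = X v (X u a)"
  unfolding operators_def by blast

lemma operators_0: "operators X \<Longrightarrow> X v 0 = 0"
  using operators_add[of X v 0 0] by simp

lemma operators_minus: "operators X \<Longrightarrow> X v (- a) = - X v a"
  using operators_add[of X v a "- a"] by (simp add: operators_0 eq_neg_iff_add_eq_0 add.commute)

lemma operators_diff: "operators X \<Longrightarrow> X v (a - b) = X v a - X v b"
  using operators_add[of X v a "- b"] by (simp add: operators_minus)

lemma operators_sum: "operators X \<Longrightarrow> X v (sum f A) = (\<Sum>x\<in>A. X v (f x))"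
  by (induction A rule: infinite_finite_induct) (simp_all add: operators_0 operators_add)

lemma operators_sgn_act: "operators X \<Longrightarrow> X v (sgn_act b a) = sgn_act b (X v a)"
  by (simp add: sgn_act_def operators_minus)

lemma operators_id: "operators (\<lambda>_ a. a)"
  by (simp add: operators_def)

text \<open>Exchanging \<open>u\<close> and \<open>v\<close> would only show that the sum equals its
  own negative, which is inconclusive in characteristic 2. The induction cancels each pair
  directly.\<close>

lemma sum_antisymmetric_zero:
  fixes t :: "'v \<Rightarrow> 'v \<Rightarrow> 'a::ab_group_add"
  assumes "finite A" "\<And>u v. u \<in> A \<Longrightarrow> v \<in> A \<Longrightarrow> u \<noteq> v \<Longrightarrow> t u v + t v u = 0"
  shows "(\<Sum>v\<in>A. \<Sum>u\<in>A - {v}. t v u) = 0"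
  using assms
proof (induction A rule: finite_induct)
  case (insert a A)
  have "(\<Sum>v\<in>insert a A. \<Sum>u\<in>insert a A - {v}. t v u)
      = (\<Sum>u\<in>A. t a u) + (\<Sum>v\<in>A. \<Sum>u\<in>insert a (A - {v}). t v u)"
    using insert.hyps by (simp add: insert_Diff_if) (rule sum.cong; auto simp: insert_Diff_if)
  also have "(\<Sum>v\<in>A. \<Sum>u\<in>insert a (A - {v}). t v u) = (\<Sum>v\<in>A. t v a + (\<Sum>u\<in>A - {v}. t v u))"
    using insert.hyps by (intro sum.cong refl) (subst sum.insert, auto)
  also have "\<dots> = (\<Sum>v\<in>A. t v a)"
    using insert by (simp add: sum.distrib)
  also have "(\<Sum>u\<in>A. t a u) + (\<Sum>v\<in>A. t v a) = (\<Sum>u\<in>A. t a u + t u a)"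
    by (simp add: sum.distrib)
  also have "\<dots> = 0"
    using insert by (intro sum.neutral) auto
  finally show ?case .
qed simp

section \<open>Koszul chains and their boundary\<close>

definition koszul_chains :: "'v set \<Rightarrow> nat \<Rightarrow> ('v set \<Rightarrow> 'a::ab_group_add set) \<Rightarrow> ('v set \<Rightarrow> 'a) set" where
  "koszul_chains W i M = {c. \<forall>\<tau>. if \<tau> \<subseteq> W \<and> card \<tau> = i then c \<tau> \<in> M \<tau> else c \<tau> = 0}"

lemma chains_in: "c \<in> koszul_chains W i M \<Longrightarrow> \<tau> \<subseteq> W \<Longrightarrow> card \<tau> = i \<Longrightarrow> c \<tau> \<in> M \<tau>"
  by (auto simp: koszul_chains_def dest: spec[of _ \<tau>])

lemma chains_out: "c \<in> koszul_chains W i M \<Longrightarrow> \<not> (\<tau> \<subseteq> W \<and> card \<tau> = i) \<Longrightarrow> c \<tau> = 0"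
  unfolding koszul_chains_def by (auto dest: spec[of _ \<tau>] split: if_splits)

lemma chainsI:
  assumes "\<And>\<tau>. \<tau> \<subseteq> W \<Longrightarrow> card \<tau> = i \<Longrightarrow> c \<tau> \<in> M \<tau>"
    and "\<And>\<tau>. \<not> (\<tau> \<subseteq> W \<and> card \<tau> = i) \<Longrightarrow> c \<tau> = 0"
  shows "c \<in> koszul_chains W i M"
  using assms by (auto simp: koszul_chains_def)

text \<open>The sign axiom is what makes the two orders of removing \<open>u\<close> and
  \<open>v\<close> from a set cancel. Signs stay abstract because the lower bound needs an ordering
  of the vertices adapted to the matching.\<close>

locale koszul_signs =
  fixes V :: "'v set" and s :: "'v \<Rightarrow> 'v set \<Rightarrow> bool"
  assumes finite_V: "finite V"
    and sign: "\<And>u v \<tau>. u \<in> V \<Longrightarrow> v \<in> V \<Longrightarrow> \<tau> \<subseteq> V \<Longrightarrow> u \<noteq> v \<Longrightarrow> u \<notin> \<tau> \<Longrightarrow> v \<notin> \<tau> \<Longrightarrow>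
      (s u (insert v \<tau>) = s v \<tau>) \<longleftrightarrow> (s v (insert u \<tau>) \<noteq> s u \<tau>)"
begin

definition bd :: "('v \<Rightarrow> 'a \<Rightarrow> 'a) \<Rightarrow> 'v set \<Rightarrow> ('v set \<Rightarrow> 'a) \<Rightarrow> 'v set \<Rightarrow> 'a::ab_group_add" where
  "bd X W c \<rho> = (if \<rho> \<subseteq> W then \<Sum>v\<in>W - \<rho>. sgn_act (s v \<rho>) (X v (c (insert v \<rho>))) else 0)"

lemma bd_bd:
  assumes X: "operators X" and W: "W \<subseteq> V"
  shows "bd X W (bd X W c) = (\<lambda>_. 0)"
proof
  fix \<rho>
  show "bd X W (bd X W c) \<rho> = 0"
  proof (cases "\<rho> \<subseteq> W")
    case True
    define t where "t v u = sgn_act (s v \<rho> = s u (insert v \<rho>)) (X v (X u (c (insert u (insert v \<rho>)))))" for v u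
    have "bd X W (bd X W c) \<rho> = (\<Sum>v\<in>W - \<rho>. sgn_act (s v \<rho>) (X v (\<Sum>u\<in>W - insert v \<rho>.
        sgn_act (s u (insert v \<rho>)) (X u (c (insert u (insert v \<rho>)))))))"
      using True by (simp add: bd_def)
    also have "\<dots> = (\<Sum>v\<in>W - \<rho>. \<Sum>u\<in>(W - \<rho>) - {v}. t v u)"
      by (intro sum.cong refl)
        (auto simp: operators_sum[OF X] sgn_act_sum operators_sgn_act[OF X] sgn_act_sgn_act t_def
          intro!: sum.cong)
    also have "\<dots> = 0"
    proof (rule sum_antisymmetric_zero)
      show "finite (W - \<rho>)" using W finite_V by (meson finite_Diff finite_subset)
      fix u v assume uv: "u \<in> W - \<rho>" "v \<in> W - \<rho>" "u \<noteq> v"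
      have "(s u \<rho> = s v (insert u \<rho>)) = (\<not> (s v \<rho> = s u (insert v \<rho>)))"
        using sign[of u v \<rho>] uv W True by blast
      then show "t u v + t v u = 0"
        by (auto simp: t_def insert_commute sgn_act_def operators_commute[OF X, of u v])
    qed
    finally show ?thesis .
  qed (simp add: bd_def)
qed

lemma bd_zero: "operators X \<Longrightarrow> bd X W (\<lambda>_. 0) = (\<lambda>_. 0)"
  by (rule ext) (simp add: bd_def operators_0)

lemma bd_add: "operators X \<Longrightarrow> bd X W (\<lambda>\<tau>. c \<tau> + c' \<tau>) = (\<lambda>\<rho>. bd X W c \<rho> + bd X W c' \<rho>)"
  by (rule ext) (simp add: bd_def operators_add sgn_act_add sum.distrib)

lemma bd_diff: "operators X \<Longrightarrow> bd X W (\<lambda>\<tau>. c \<tau> - c' \<tau>) = (\<lambda>\<rho>. bd X W c \<rho> - bd X W c' \<rho>)"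
  by (rule ext) (simp add: bd_def operators_diff sgn_act_diff sum_subtractf)

definition exact_at ::
  "('v \<Rightarrow> 'a \<Rightarrow> 'a) \<Rightarrow> 'v set \<Rightarrow> nat \<Rightarrow> ('v set \<Rightarrow> 'a::ab_group_add set) \<Rightarrow> ('v set \<Rightarrow> 'a set) \<Rightarrow> bool" where
  "exact_at X W i M M' \<longleftrightarrow>
     (\<forall>c\<in>koszul_chains W i M. bd X W c = (\<lambda>_. 0) \<longrightarrow> (\<exists>b\<in>koszul_chains W (Suc i) M'. bd X W b = c))"


lemma bd_outside: "\<not> \<rho> \<subseteq> W \<Longrightarrow> bd X W c \<rho> = 0"
  by (simp add: bd_def)

text \<open>Coning with apex \<open>v\<close> anticommutes with the boundary on faces through
  \<open>v\<close>. This serves both the contraction of a cone and, in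
  \<open>exact_sets_split\<close>, the correction term that clears the faces through
  \<open>v\<close>.\<close>

lemma bd_cone:
  assumes X: "operators X" and W: "W \<subseteq> V" and v: "v \<in> W" and \<rho>: "\<rho> \<subseteq> W - {v}"
  shows "bd X W (\<lambda>\<tau>. if v \<in> \<tau> then sgn_act (s v (\<tau> - {v})) (c (\<tau> - {v})) else 0) (insert v \<rho>)
     = - sgn_act (s v \<rho>) (bd X (W - {v}) c \<rho>)"
proof -
  have W_eq: "W - insert v \<rho> = W - {v} - \<rho>" by blast
  have "bd X W (\<lambda>\<tau>. if v \<in> \<tau> then sgn_act (s v (\<tau> - {v})) (c (\<tau> - {v})) else 0) (insert v \<rho>)
     = (\<Sum>u\<in>W - {v} - \<rho>. sgn_act (s u (insert v \<rho>)) (X u (sgn_act (s v (insert u \<rho>)) (c (insert u \<rho>)))))"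
  proof -
    have "insert u (insert v \<rho>) - {v} = insert u \<rho>" if "u \<in> W - {v} - \<rho>" for u
      using that \<rho> by blast
    then show ?thesis
      using \<rho> v unfolding bd_def W_eq by (auto intro!: sum.cong)
  qed
  also have "\<dots> = (\<Sum>u\<in>W - {v} - \<rho>. - sgn_act (s v \<rho>) (sgn_act (s u \<rho>) (X u (c (insert u \<rho>)))))"
  proof (intro sum.cong refl)
    fix u assume "u \<in> W - {v} - \<rho>"
    then have "(s u (insert v \<rho>) = s v \<rho>) \<longleftrightarrow> (s v (insert u \<rho>) \<noteq> s u \<rho>)"
      using sign[of u v \<rho>] W v \<rho> by blast
    then show "sgn_act (s u (insert v \<rho>)) (X u (sgn_act (s v (insert u \<rho>)) (c (insert u \<rho>))))
       = - sgn_act (s v \<rho>) (sgn_act (s u \<rho>) (X u (c (insert u \<rho>))))"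
      by (auto simp: sgn_act_def operators_minus[OF X])
  qed
  also have "\<dots> = - sgn_act (s v \<rho>) (bd X (W - {v}) c \<rho>)"
    using \<rho> by (simp add: bd_def sgn_act_sum sum_negf)
  finally show ?thesis .
qed

definition complex :: "'v set \<Rightarrow> nat \<Rightarrow> ('v set \<Rightarrow> bool) \<Rightarrow> ('v set \<Rightarrow> 'k::ab_group_add) set" where
  "complex W i G = koszul_chains W i (\<lambda>\<tau>. {a. a \<noteq> 0 \<longrightarrow> G \<tau>})"

lemma complex_iff: "c \<in> complex W i G \<longleftrightarrow> (\<forall>\<tau>. c \<tau> \<noteq> 0 \<longrightarrow> \<tau> \<subseteq> W \<and> card \<tau> = i \<and> G \<tau>)"
  unfolding complex_def koszul_chains_def by (auto split: if_splits)

lemma cone_exact: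
  fixes c :: "'v set \<Rightarrow> 'k::ab_group_add"
  assumes W: "W \<subseteq> V" and u: "u \<in> W" and G: "\<And>\<tau>. \<tau> \<subseteq> W \<Longrightarrow> G \<tau> \<Longrightarrow> G (insert u \<tau>)"
    and c: "c \<in> complex W i G" and cycle: "bd (\<lambda>_ a. a) W c = (\<lambda>_. 0)"
  shows "\<exists>b\<in>complex W (Suc i) G. bd (\<lambda>_ a. a) W b = c"
proof
  \<comment> \<open>The cone over \<open>c\<close> with apex \<open>u\<close>. The hypothesis on
    \<open>G\<close> keeps it inside the complex.\<close>
  define b where "b \<tau> = (if u \<in> \<tau> then sgn_act (s u (\<tau> - {u})) (c (\<tau> - {u})) else 0)" for \<tau>
  have finW: "finite W" using W finite_V finite_subset by blast
  show "b \<in> complex W (Suc i) G"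
  proof (unfold complex_iff, intro allI impI)
    fix \<tau> assume "b \<tau> \<noteq> 0"
    then have "u \<in> \<tau>" "c (\<tau> - {u}) \<noteq> 0" by (auto simp: b_def split: if_splits)
    then have *: "\<tau> - {u} \<subseteq> W" "card (\<tau> - {u}) = i" "G (\<tau> - {u})" using c by (auto simp: complex_iff)
    moreover have "finite (\<tau> - {u})" using *(1) finW finite_subset by blast
    ultimately show "\<tau> \<subseteq> W \<and> card \<tau> = Suc i \<and> G \<tau>"
      using \<open>u \<in> \<tau>\<close> u G[OF *(1,3)] card_Suc_Diff1[of \<tau> u] by (auto simp: insert_absorb)
  qed
  show "bd (\<lambda>_ a. a) W b = c"
  proof
    fix \<rho>
    consider "\<not> \<rho> \<subseteq> W" | "\<rho> \<subseteq> W" "u \<notin> \<rho>" | "\<rho> \<subseteq> W" "u \<in> \<rho>" by blast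
    then show "bd (\<lambda>_ a. a) W b \<rho> = c \<rho>"
    proof cases
      case 1
      then show ?thesis using c by (auto simp: bd_def complex_iff)
    next
      case 2
      \<comment> \<open>The chain \<open>b\<close> lives on sets containing \<open>u\<close>, so
        only the summand that adds \<open>u\<close> survives.\<close>
      have "bd (\<lambda>_ a. a) W b \<rho> = (\<Sum>v\<in>W - \<rho>. if v = u then c \<rho> else 0)"
        using 2 by (auto simp: bd_def b_def sgn_act_sgn_act intro!: sum.cong) (auto simp: sgn_act_def)
      also have "\<dots> = c \<rho>" using 2 u finW by simp
      finally show ?thesis .
    next
      case 3
      define \<rho>' where "\<rho>' = \<rho> - {u}"
      have \<rho>: "\<rho> = insert u \<rho>'" "u \<notin> \<rho>'" "\<rho>' \<subseteq> W - {u}" using 3 by (auto simp: \<rho>'_def)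
      have eq: "W - \<rho>' = insert u (W - {u} - \<rho>')" using \<rho> u by blast
      \<comment> \<open>The cycle condition on the face without \<open>u\<close> expresses the
        boundary of \<open>c\<close> inside \<open>W - {u}\<close> through the coefficient at
        \<open>\<rho>\<close>.\<close>
      have "0 = bd (\<lambda>_ a. a) W c \<rho>'" by (simp add: cycle)
      also have "\<dots> = sgn_act (s u \<rho>') (c \<rho>) + bd (\<lambda>_ a. a) (W - {u}) c \<rho>'"
        using \<rho> finW unfolding bd_def eq by auto
      finally have bd': "bd (\<lambda>_ a. a) (W - {u}) c \<rho>' = - sgn_act (s u \<rho>') (c \<rho>)"
        by (simp add: eq_neg_iff_add_eq_0 add.commute)
      have "bd (\<lambda>_ a. a) W b \<rho> = - sgn_act (s u \<rho>') (bd (\<lambda>_ a. a) (W - {u}) c \<rho>')"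
        unfolding \<rho>(1) b_def by (rule bd_cone[OF operators_id W u \<rho>(3)])
      then show ?thesis by (simp add: bd' sgn_act_def)
    qed
  qed
qed

text \<open>\<open>F\<close> tells which vertex sets are supports of monomials in the ideal. Faces
  of size \<open>i\<close> sit in homological degree \<open>i\<close> of the ideal itself, not of
  the quotient ring.\<close>

definition exact_sets :: "'k::ab_group_add itself \<Rightarrow> ('v set \<Rightarrow> bool) \<Rightarrow> 'v set \<Rightarrow> nat \<Rightarrow> bool" where
  "exact_sets TYPE('k) F W i \<longleftrightarrow>
     (\<forall>c::'v set \<Rightarrow> 'k. c \<in> complex W i (\<lambda>\<tau>. F (W - \<tau>)) \<and> bd (\<lambda>_ a. a) W c = (\<lambda>_. 0) \<longrightarrow>
       (\<exists>b\<in>complex W (Suc i) (\<lambda>\<tau>. F (W - \<tau>)). bd (\<lambda>_ a. a) W b = c))"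

lemma exact_setsD:
  fixes c :: "'v set \<Rightarrow> 'k::ab_group_add"
  assumes "exact_sets TYPE('k) F W i" "c \<in> complex W i (\<lambda>\<tau>. F (W - \<tau>))" "bd (\<lambda>_ a. a) W c = (\<lambda>_. 0)"
  obtains b where "b \<in> complex W (Suc i) (\<lambda>\<tau>. F (W - \<tau>))" "bd (\<lambda>_ a. a) W b = c"
  using assms unfolding exact_sets_def by blast

text \<open>The long exact sequence of a pair, done by hand. Faces avoiding \<open>v\<close> form
  the complex of the colon family on \<open>W - {v}\<close> in the same degree; faces through
  \<open>v\<close>, with \<open>v\<close> dropped, form the complex of \<open>F\<close> on
  \<open>W - {v}\<close> one degree lower.\<close>

lemma exact_sets_split:
  assumes W: "W \<subseteq> V" and v: "v \<in> W"
    and mono: "\<And>A B. A \<subseteq> B \<Longrightarrow> F A \<Longrightarrow> F B"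
    and link: "exact_sets TYPE('k::ab_group_add) (\<lambda>A. F (insert v A)) (W - {v}) i"
    and del: "\<And>j. i = Suc j \<Longrightarrow> exact_sets TYPE('k) F (W - {v}) j"
  shows "exact_sets TYPE('k) F W i"
  unfolding exact_sets_def
proof (intro allI impI, elim conjE)
  fix c :: "'v set \<Rightarrow> 'k"
  assume c: "c \<in> complex W i (\<lambda>\<tau>. F (W - \<tau>))" and cycle: "bd (\<lambda>_ a. a) W c = (\<lambda>_. 0)"
  let ?X = "\<lambda>(_::'v) (a::'k). a" and ?W = "W - {v}"
  have finW: "finite W" using W finite_V finite_subset by blast
  have fin: "finite \<tau>" if "\<tau> \<subseteq> W" for \<tau> using that finW finite_subset by blast
  \<comment> \<open>The part of \<open>c\<close> on faces through \<open>v\<close>, with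
    \<open>v\<close> dropped: a cycle of the deletion, one degree lower.\<close>
  define c1 where "c1 \<rho> = (if v \<notin> \<rho> then sgn_act (s v \<rho>) (c (insert v \<rho>)) else 0)" for \<rho>
  have c1_out: "c1 \<rho> = 0" if "\<not> \<rho> \<subseteq> ?W" for \<rho>
    using that c by (auto simp: c1_def complex_iff)
  have c_c1: "c (insert v \<rho>) = sgn_act (s v \<rho>) (c1 \<rho>)" if "v \<notin> \<rho>" for \<rho>
    using that by (simp add: c1_def sgn_act_def)
  have bd_c1: "bd ?X ?W c1 \<rho> = 0" if \<rho>: "\<rho> \<subseteq> ?W" for \<rho>
  proof -
    have "bd ?X W (\<lambda>\<tau>. if v \<in> \<tau> then sgn_act (s v (\<tau> - {v})) (c1 (\<tau> - {v})) else 0) (insert v \<rho>)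
        = bd ?X W c (insert v \<rho>)"
    proof -
      have "(if v \<in> \<tau> then sgn_act (s v (\<tau> - {v})) (c1 (\<tau> - {v})) else 0) = c \<tau>" if "v \<in> \<tau>" for \<tau>
        using that c_c1[of "\<tau> - {v}"] by (simp add: insert_absorb)
      then show ?thesis
        unfolding bd_def by (auto intro!: sum.cong)
    qed
    then show ?thesis
      using bd_cone[OF operators_id W v \<rho>, of c1] by (simp add: cycle)
  qed
  \<comment> \<open>In degree 0 no face contains \<open>v\<close>, so \<open>c1\<close> is zero and
    exactness of the deletion is not called upon.\<close>
  obtain b1 where b1: "b1 \<in> complex ?W i (\<lambda>\<tau>. F (?W - \<tau>))" "bd ?X ?W b1 = c1"
  proof (cases i)
    case 0
    have "c1 = (\<lambda>_. 0)"
    proof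
      fix \<rho>
      have "c (insert v \<rho>) = 0"
      proof (rule ccontr)
        assume "c (insert v \<rho>) \<noteq> 0"
        then have "insert v \<rho> \<subseteq> W" "card (insert v \<rho>) = 0" using c 0 by (auto simp: complex_iff)
        then show False using fin by (metis card_0_eq insert_not_empty)
      qed
      then show "c1 \<rho> = 0" by (simp add: c1_def)
    qed
    then show thesis
      using that[of "\<lambda>_. 0"] bd_zero[OF operators_id, of ?W] by (simp add: complex_iff)
  next
    case (Suc j)
    have "c1 \<in> complex ?W j (\<lambda>\<tau>. F (?W - \<tau>))"
    proof (unfold complex_iff, intro allI impI)
      fix \<rho> assume nz: "c1 \<rho> \<noteq> 0"
      then have \<rho>: "v \<notin> \<rho>" "c (insert v \<rho>) \<noteq> 0" by (auto simp: c1_def split: if_splits)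
      then have *: "insert v \<rho> \<subseteq> W" "card (insert v \<rho>) = i" "F (W - insert v \<rho>)"
        using c by (auto simp: complex_iff)
      moreover have "W - insert v \<rho> = ?W - \<rho>" by blast
      ultimately show "\<rho> \<subseteq> ?W \<and> card \<rho> = j \<and> F (?W - \<rho>)"
        using \<rho> fin[of \<rho>] Suc by auto
    qed
    moreover have "bd ?X ?W c1 = (\<lambda>_. 0)"
    proof
      fix \<rho> show "bd ?X ?W c1 \<rho> = 0"
        by (cases "\<rho> \<subseteq> ?W") (simp_all add: bd_c1 bd_outside)
    qed
    ultimately show thesis
      using exact_setsD[OF del[OF Suc]] that Suc by blast
  qed
  define b' where "b' \<tau> = (if v \<in> \<tau> then sgn_act (s v (\<tau> - {v})) (b1 (\<tau> - {v})) else 0)" for \<tau>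
  have bd_b': "bd ?X W b' (insert v \<rho>) = - c (insert v \<rho>)" if "\<rho> \<subseteq> ?W" for \<rho>
    using bd_cone[OF operators_id W v that, of b1] c_c1[of \<rho>] that b1(2)
    unfolding b'_def by (subst c_c1) auto
  have b1_F: "F (?W - \<tau>)" "\<tau> \<subseteq> ?W" "card \<tau> = i" if "b1 \<tau> \<noteq> 0" for \<tau>
    using b1(1) that by (auto simp: complex_iff)
  have b': "b' \<in> complex W (Suc i) (\<lambda>\<tau>. F (W - \<tau>))"
  proof (unfold complex_iff, intro allI impI)
    fix \<tau> assume "b' \<tau> \<noteq> 0"
    then have \<tau>: "v \<in> \<tau>" "b1 (\<tau> - {v}) \<noteq> 0" by (auto simp: b'_def split: if_splits)
    have "?W - (\<tau> - {v}) = W - \<tau>" using \<tau> by blast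
    then show "\<tau> \<subseteq> W \<and> card \<tau> = Suc i \<and> F (W - \<tau>)"
    proof -
      have "\<tau> \<subseteq> W" using b1_F(2)[OF \<tau>(2)] v by blast
      moreover have "card \<tau> = Suc i"
        using card_Suc_Diff1[OF fin[OF \<open>\<tau> \<subseteq> W\<close>] \<tau>(1)] b1_F(3)[OF \<tau>(2)] by simp
      ultimately show ?thesis
        using b1_F(1)[OF \<tau>(2)] \<open>?W - (\<tau> - {v}) = W - \<tau>\<close> by simp
    qed
  qed
  \<comment> \<open>By the sign in \<open>bd_cone\<close> the boundary of \<open>b'\<close> is
    \<open>- c\<close> on faces through \<open>v\<close>, so the sum is supported on faces avoiding
    \<open>v\<close> and is a cycle of the colon complex.\<close>
  define c0 where "c0 \<tau> = c \<tau> + bd ?X W b' \<tau>" for \<tau>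
  have c0_v: "c0 \<tau> = 0" if "v \<in> \<tau>" for \<tau>
  proof (cases "\<tau> \<subseteq> W")
    case True
    have "insert v (\<tau> - {v}) = \<tau>" using that by blast
    then have "bd ?X W b' \<tau> = - c \<tau>" using bd_b'[of "\<tau> - {v}"] True by (simp only:) blast
    then show ?thesis by (simp add: c0_def)
  next
    case False
    then show ?thesis using c by (auto simp: c0_def bd_def complex_iff)
  qed
  have c0: "c0 \<in> complex ?W i (\<lambda>\<tau>. F (insert v (?W - \<tau>)))"
  proof (unfold complex_iff, intro allI impI)
    fix \<tau> assume nz: "c0 \<tau> \<noteq> 0"
    have v\<tau>: "v \<notin> \<tau>" using nz c0_v by blast
    have eq: "insert v (?W - \<tau>) = W - \<tau>" using v v\<tau> by blast
    show "\<tau> \<subseteq> ?W \<and> card \<tau> = i \<and> F (insert v (?W - \<tau>))"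
    proof (cases "c \<tau> = 0")
      case False
      then show ?thesis using c eq v\<tau> by (auto simp: complex_iff)
    next
      case True
      then have nz: "bd ?X W b' \<tau> \<noteq> 0" using nz by (simp add: c0_def)
      then have "\<tau> \<subseteq> W" using bd_outside by blast
      have "bd ?X W b' \<tau> = (\<Sum>u\<in>W - \<tau>. if u = v then b1 \<tau> else 0)"
        using \<open>\<tau> \<subseteq> W\<close> v\<tau> by (auto simp: bd_def b'_def sgn_act_sgn_act intro!: sum.cong) (auto simp: sgn_act_def)
      also have "\<dots> = b1 \<tau>" using v v\<tau> finW by simp
      finally have "b1 \<tau> \<noteq> 0" using nz by simp
      \<comment> \<open>Monotonicity of \<open>F\<close> turns a face of the deletion complex into a
        face of the colon complex.\<close>
      from b1_F[OF this] show ?thesis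
        using mono[of "?W - \<tau>" "insert v (?W - \<tau>)"] by auto
    qed
  qed
  have bd_W: "bd ?X ?W d = bd ?X W d" if "\<And>\<tau>. v \<in> \<tau> \<Longrightarrow> d \<tau> = 0" for d :: "'v set \<Rightarrow> 'k"
  proof
    fix \<rho>
    consider "\<rho> \<subseteq> ?W" | "\<rho> \<subseteq> W" "v \<in> \<rho>" | "\<not> \<rho> \<subseteq> W" by blast
    then show "bd ?X ?W d \<rho> = bd ?X W d \<rho>"
    proof cases
      case 1
      then have "W - \<rho> = insert v (?W - \<rho>)" using v by blast
      then show ?thesis using 1 that finW by (auto simp: bd_def)
    qed (auto simp: bd_def that)
  qed
  have "bd ?X W c0 = (\<lambda>_. 0)"
    unfolding c0_def using bd_add[OF operators_id, of W c "bd ?X W b'"] bd_bd[OF operators_id W, of b'] cycle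
    by simp
  then obtain b0 where b0: "b0 \<in> complex ?W (Suc i) (\<lambda>\<tau>. F (insert v (?W - \<tau>)))" "bd ?X ?W b0 = c0"
    using exact_setsD[OF link c0] bd_W[OF c0_v] by auto
  have b0_v: "b0 \<tau> = 0" if "v \<in> \<tau>" for \<tau> using b0(1) that by (auto simp: complex_iff)
  show "\<exists>b\<in>complex W (Suc i) (\<lambda>\<tau>. F (W - \<tau>)). bd ?X W b = c"
  proof
    show "bd ?X W (\<lambda>\<tau>. b0 \<tau> - b' \<tau>) = c"
      using bd_W[OF b0_v] b0(2) by (simp add: bd_diff[OF operators_id] c0_def)
    have eq: "insert v (?W - \<tau>) = W - \<tau>" if "v \<notin> \<tau>" for \<tau> using that v by blast
    have "b0 \<in> complex W (Suc i) (\<lambda>\<tau>. F (W - \<tau>))"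
    proof (unfold complex_iff, intro allI impI)
      fix \<tau> assume "b0 \<tau> \<noteq> 0"
      then have "v \<notin> \<tau>" "\<tau> \<subseteq> ?W" "card \<tau> = Suc i" "F (insert v (?W - \<tau>))"
        using b0(1) b0_v by (auto simp: complex_iff)
      then show "\<tau> \<subseteq> W \<and> card \<tau> = Suc i \<and> F (W - \<tau>)"
        by (metis eq Diff_subset subset_trans)
    qed
    then show "(\<lambda>\<tau>. b0 \<tau> - b' \<tau>) \<in> complex W (Suc i) (\<lambda>\<tau>. F (W - \<tau>))"
      using b' unfolding complex_iff by (metis diff_self)
  qed
qed

end

section \<open>Dimension shifting\<close>


context koszul_signs begin

text \<open>\<open>N e\<close> is the piece of degree \<open>e\<close>. Integer degrees allow shifts
  in both directions without side conditions.\<close>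

definition submodule_by :: "('v \<Rightarrow> 'a::ab_group_add \<Rightarrow> 'a) \<Rightarrow> (int \<Rightarrow> 'a set) \<Rightarrow> bool" where
  "submodule_by X N \<longleftrightarrow> (\<forall>e. 0 \<in> N e \<and> (\<forall>a\<in>N e. \<forall>b\<in>N e. a - b \<in> N e) \<and>
     (\<forall>v\<in>V. \<forall>a\<in>N (e - 1). X v a \<in> N e))"

lemma submodule_byD:
  assumes "submodule_by X N"
  shows "0 \<in> N e" "a \<in> N e \<Longrightarrow> b \<in> N e \<Longrightarrow> a - b \<in> N e" "a \<in> N e \<Longrightarrow> - a \<in> N e"
    "a \<in> N e \<Longrightarrow> b \<in> N e \<Longrightarrow> a + b \<in> N e" "v \<in> V \<Longrightarrow> a \<in> N (e - 1) \<Longrightarrow> X v a \<in> N e"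
    "a \<in> N e \<Longrightarrow> sgn_act t a \<in> N e"
proof -
  show z: "0 \<in> N e" and d: "a \<in> N e \<Longrightarrow> b \<in> N e \<Longrightarrow> a - b \<in> N e" for a b
    using assms by (auto simp: submodule_by_def)
  show "v \<in> V \<Longrightarrow> a \<in> N (e - 1) \<Longrightarrow> X v a \<in> N e" using assms by (auto simp: submodule_by_def)
  show m: "a \<in> N e \<Longrightarrow> - a \<in> N e" for a using d[OF z, of a] by simp
  show "a \<in> N e \<Longrightarrow> b \<in> N e \<Longrightarrow> a + b \<in> N e" using d[OF _ m, of a b] by simp
  show "a \<in> N e \<Longrightarrow> sgn_act t a \<in> N e" using m by (simp add: sgn_act_def)
qed

lemma submodule_by_sum:
  assumes "submodule_by X N" "\<And>x. x \<in> A \<Longrightarrow> f x \<in> N e"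
  shows "sum f A \<in> N e"
  using assms(2) by (induction A rule: infinite_finite_induct)
    (auto intro: submodule_byD(1,4)[OF assms(1)])

text \<open>The coefficients have degree \<open>e\<close>, so chains in homological degree
  \<open>i\<close> have total degree \<open>e + i\<close>, which the boundary preserves. The
  condition is the vanishing of the \<open>i\<close>-th Tor with the residue field in degree
  \<open>e + i\<close>.\<close>

definition koszul_exact :: "('v \<Rightarrow> 'a::ab_group_add \<Rightarrow> 'a) \<Rightarrow> (int \<Rightarrow> 'a set) \<Rightarrow> nat \<Rightarrow> int \<Rightarrow> bool" where
  "koszul_exact X N i e \<longleftrightarrow> (\<forall>c\<in>koszul_chains V i (\<lambda>_. N e). bd X V c = (\<lambda>_. 0) \<longrightarrow>
     (\<exists>b\<in>koszul_chains V (Suc i) (\<lambda>_. N (e - 1)). bd X V b = c))"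

lemma koszul_exactD:
  assumes "koszul_exact X N i e" "c \<in> koszul_chains V i (\<lambda>_. N e)" "bd X V c = (\<lambda>_. 0)"
  obtains b where "b \<in> koszul_chains V (Suc i) (\<lambda>_. N (e - 1))" "bd X V b = c"
  using assms unfolding koszul_exact_def by blast

lemma bd_chains:
  assumes N: "submodule_by X N" and X: "operators X" and c: "c \<in> koszul_chains V (Suc i) (\<lambda>_. N (e - 1))"
  shows "bd X V c \<in> koszul_chains V i (\<lambda>_. N e)"
proof (rule chainsI)
  fix \<tau> assume \<tau>: "\<tau> \<subseteq> V" "card \<tau> = i"
  have "finite \<tau>" using \<tau> finite_V finite_subset by blast
  then have "c (insert v \<tau>) \<in> N (e - 1)" if "v \<in> V - \<tau>" for v
    using that \<tau> by (intro chains_in[OF c]) auto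
  then show "bd X V c \<tau> \<in> N e"
    using \<tau> unfolding bd_def by (auto intro!: submodule_by_sum[OF N] submodule_byD(5,6)[OF N])
next
  fix \<tau> assume *: "\<not> (\<tau> \<subseteq> V \<and> card \<tau> = i)"
  show "bd X V c \<tau> = 0"
  proof (cases "\<tau> \<subseteq> V")
    case True
    then have "finite \<tau>" using finite_V finite_subset by blast
    then have "c (insert v \<tau>) = 0" if "v \<in> V - \<tau>" for v
      using that * True by (intro chains_out[OF c]) auto
    then show ?thesis by (simp add: bd_def operators_0[OF X])
  qed (simp add: bd_def)
qed

lemma chains_diff:
  assumes "submodule_by X N" "c \<in> koszul_chains W i (\<lambda>_. N e)" "c' \<in> koszul_chains W i (\<lambda>_. N e)"
  shows "(\<lambda>\<tau>. c \<tau> - c' \<tau>) \<in> koszul_chains W i (\<lambda>_. N e)"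
  using assms(2,3) by (auto simp: koszul_chains_def submodule_byD[OF assms(1)])

lemma bd_hom:
  assumes "\<And>a b. \<phi> (a + b) = \<phi> a + \<phi> b" "\<And>v a. \<phi> (X v a) = Y v (\<phi> a)"
  shows "bd Y W (\<lambda>\<tau>. \<phi> (c \<tau>)) \<rho> = \<phi> (bd X W c \<rho>)"
proof -
  have 0: "\<phi> 0 = 0" using assms(1)[of 0 0] by simp
  have m: "\<phi> (- a) = - \<phi> a" for a using assms(1)[of a "- a"] 0 by (simp add: eq_neg_iff_add_eq_0 add.commute)
  have sg: "\<phi> (sgn_act b a) = sgn_act b (\<phi> a)" for a b by (simp add: sgn_act_def m)
  have sm: "\<phi> (sum f A) = (\<Sum>x\<in>A. \<phi> (f x))" for f and A :: "'v set"
    by (induction A rule: infinite_finite_induct) (auto simp: 0 assms(1))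
  show ?thesis by (simp add: bd_def 0 sm sg assms(2))
qed

text \<open>Dimension shifting along \<open>0 \<rightarrow> Z \<rightarrow> F \<rightarrow> N \<rightarrow> 0\<close>, where \<open>F\<close> has no higher Koszul homology.\<close>

context
  fixes X :: "'v \<Rightarrow> 'a::ab_group_add \<Rightarrow> 'a" and Y :: "'v \<Rightarrow> 'b::ab_group_add \<Rightarrow> 'b"
    and F Z :: "int \<Rightarrow> 'a set" and N :: "int \<Rightarrow> 'b set" and \<phi> :: "'a \<Rightarrow> 'b"
  assumes X: "operators X" and Y: "operators Y" and F: "submodule_by X F"
    and add: "\<And>a b. \<phi> (a + b) = \<phi> a + \<phi> b" and comm: "\<And>v a. \<phi> (X v a) = Y v (\<phi> a)"
    and surj: "\<And>e. \<phi> ` F e = N e" and Z: "\<And>e. Z e = {a \<in> F e. \<phi> a = 0}"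
    and acyclic: "\<And>i e. koszul_exact X F (Suc i) e"
begin

lemma hom_0: "\<phi> 0 = 0" and hom_diff: "\<phi> (a - b) = \<phi> a - \<phi> b"
proof -
  show 0: "\<phi> 0 = 0" using add[of 0 0] by simp
  show "\<phi> (a - b) = \<phi> a - \<phi> b" using add[of "a - b" b] by (simp add: algebra_simps)
qed

lemma lift_chain:
  assumes "c \<in> koszul_chains V i (\<lambda>_. N e)"
  obtains f where "f \<in> koszul_chains V i (\<lambda>_. F e)" "c = (\<lambda>\<tau>. \<phi> (f \<tau>))"
proof -
  have "\<forall>\<tau>. \<exists>a. if \<tau> \<subseteq> V \<and> card \<tau> = i then a \<in> F e \<and> \<phi> a = c \<tau> else a = 0"
    using chains_in[OF assms] surj[of e] by (auto simp: image_iff) (metis imageE)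
  then obtain f where f: "\<And>\<tau>. if \<tau> \<subseteq> V \<and> card \<tau> = i then f \<tau> \<in> F e \<and> \<phi> (f \<tau>) = c \<tau> else f \<tau> = 0"
    by metis
  show thesis
  proof
    show "f \<in> koszul_chains V i (\<lambda>_. F e)" by (rule chainsI) (use f in \<open>metis\<close>)+
    show "c = (\<lambda>\<tau>. \<phi> (f \<tau>))"
      using f chains_out[OF assms] hom_0 by (metis (full_types))
  qed
qed

lemma map_chain: "f \<in> koszul_chains V i (\<lambda>_. F e) \<Longrightarrow> (\<lambda>\<tau>. \<phi> (f \<tau>)) \<in> koszul_chains V i (\<lambda>_. N e)"
proof (rule chainsI)
  fix \<tau> assume "f \<in> koszul_chains V i (\<lambda>_. F e)" "\<tau> \<subseteq> V" "card \<tau> = i"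
  then have "f \<tau> \<in> F e" by (rule chains_in)
  then show "\<phi> (f \<tau>) \<in> N e" using surj by blast
qed (simp add: chains_out hom_0)

lemma kernel_chain:
  "f \<in> koszul_chains V i (\<lambda>_. Z e) \<longleftrightarrow> f \<in> koszul_chains V i (\<lambda>_. F e) \<and> (\<lambda>\<tau>. \<phi> (f \<tau>)) = (\<lambda>_. 0)"
proof (intro iffI conjI)
  assume f: "f \<in> koszul_chains V i (\<lambda>_. Z e)"
  show "f \<in> koszul_chains V i (\<lambda>_. F e)"
    by (rule chainsI) (use chains_in[OF f] chains_out[OF f] in \<open>auto simp: Z\<close>)
  show "(\<lambda>\<tau>. \<phi> (f \<tau>)) = (\<lambda>_. 0)"
  proof
    fix \<tau> show "\<phi> (f \<tau>) = 0"
      using chains_in[OF f, of \<tau>] chains_out[OF f, of \<tau>] hom_0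
      by (cases "\<tau> \<subseteq> V \<and> card \<tau> = i") (auto simp: Z)
  qed
next
  assume *: "f \<in> koszul_chains V i (\<lambda>_. F e) \<and> (\<lambda>\<tau>. \<phi> (f \<tau>)) = (\<lambda>_. 0)"
  then have "\<phi> (f \<tau>) = 0" for \<tau> by meson
  then show "f \<in> koszul_chains V i (\<lambda>_. Z e)"
    by (intro chainsI) (use * in \<open>auto simp: Z dest: chains_in chains_out\<close>)
qed

lemma bd_map: "bd Y V (\<lambda>\<tau>. \<phi> (f \<tau>)) = (\<lambda>\<rho>. \<phi> (bd X V f \<rho>))"
  by (rule ext) (rule bd_hom[of \<phi> X Y, OF add comm])

text \<open>The connecting map goes from homology of \<open>N\<close> in degree \<open>Suc i\<close>
  to homology of \<open>Z\<close> in degree \<open>i\<close>. It is onto if cycles of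
  \<open>Z\<close> bound in \<open>F\<close>: for positive \<open>i\<close> by acyclicity, for
  \<open>i = 0\<close> by the extra hypothesis, which minimality of a resolution will
  supply.\<close>

lemma exact_kernel_of_exact:
  assumes N: "koszul_exact Y N (Suc i) e"
    and 0: "i = 0 \<Longrightarrow> (\<And>c. c \<in> koszul_chains V 0 (\<lambda>_. Z (e + 1)) \<Longrightarrow> \<exists>f\<in>koszul_chains V 1 (\<lambda>_. F e). bd X V f = c)"
  shows "koszul_exact X Z i (e + 1)"
  unfolding koszul_exact_def
proof (intro ballI impI)
  fix c assume c: "c \<in> koszul_chains V i (\<lambda>_. Z (e + 1))" and cycle: "bd X V c = (\<lambda>_. 0)"
  have "\<exists>f\<in>koszul_chains V (Suc i) (\<lambda>_. F e). bd X V f = c"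
  proof (cases i)
    case 0
    then show ?thesis using assms(2) c by auto
  next
    case (Suc j)
    have "c \<in> koszul_chains V (Suc j) (\<lambda>_. F (e + 1))" using c Suc kernel_chain by blast
    then show ?thesis using acyclic[of j "e + 1"] cycle Suc unfolding koszul_exact_def by auto
  qed
  then obtain f where f: "f \<in> koszul_chains V (Suc i) (\<lambda>_. F e)" "bd X V f = c" by blast
  have "bd Y V (\<lambda>\<tau>. \<phi> (f \<tau>)) = (\<lambda>_. 0)"
    using bd_map f(2) c kernel_chain by auto
  then obtain g where g: "g \<in> koszul_chains V (Suc (Suc i)) (\<lambda>_. N (e - 1))" "bd Y V g = (\<lambda>\<tau>. \<phi> (f \<tau>))"
    using koszul_exactD[OF N map_chain[OF f(1)]] by blast
  \<comment> \<open>The image of \<open>f\<close> bounds in \<open>N\<close>. Subtracting the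
    boundary of a lift of the bounding chain moves \<open>f\<close> into the kernel without changing
    its own boundary.\<close>
  obtain h where h: "h \<in> koszul_chains V (Suc (Suc i)) (\<lambda>_. F (e - 1))" "g = (\<lambda>\<tau>. \<phi> (h \<tau>))"
    using lift_chain[OF g(1)] .
  show "\<exists>b\<in>koszul_chains V (Suc i) (\<lambda>_. Z (e + 1 - 1)). bd X V b = c"
  proof
    have "(\<lambda>\<tau>. f \<tau> - bd X V h \<tau>) \<in> koszul_chains V (Suc i) (\<lambda>_. F e)"
      by (rule chains_diff[OF F f(1) bd_chains[OF F X h(1)]])
    moreover have "(\<lambda>\<tau>. \<phi> (f \<tau> - bd X V h \<tau>)) = (\<lambda>_. 0)"
      using g(2) bd_map[of h] unfolding h(2) by (auto simp: hom_diff fun_eq_iff)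
    ultimately show "(\<lambda>\<tau>. f \<tau> - bd X V h \<tau>) \<in> koszul_chains V (Suc i) (\<lambda>_. Z (e + 1 - 1))"
      by (simp add: kernel_chain)
    show "bd X V (\<lambda>\<tau>. f \<tau> - bd X V h \<tau>) = c"
      by (simp add: bd_diff[OF X] f(2) bd_bd[OF X])
  qed
qed

text \<open>Here the connecting map has to be injective, for which acyclicity of \<open>F\<close> in
  positive degrees is enough.\<close>

lemma exact_of_exact_kernel:
  assumes Z': "koszul_exact X Z i (e + 1)"
  shows "koszul_exact Y N (Suc i) e"
  unfolding koszul_exact_def
proof (intro ballI impI)
  fix c assume c: "c \<in> koszul_chains V (Suc i) (\<lambda>_. N e)" and cycle: "bd Y V c = (\<lambda>_. 0)"
  obtain f where f: "f \<in> koszul_chains V (Suc i) (\<lambda>_. F e)" "c = (\<lambda>\<tau>. \<phi> (f \<tau>))"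
    using lift_chain[OF c] .
  have "bd X V f \<in> koszul_chains V i (\<lambda>_. F (e + 1))"
    using bd_chains[OF F X, of f i "e + 1"] f(1) by simp
  moreover have "(\<lambda>\<tau>. \<phi> (bd X V f \<tau>)) = (\<lambda>_. 0)"
    using cycle bd_map[of f] f(2) by simp
  ultimately have "bd X V f \<in> koszul_chains V i (\<lambda>_. Z (e + 1))"
    by (simp add: kernel_chain)
  then obtain g where g: "g \<in> koszul_chains V (Suc i) (\<lambda>_. Z (e + 1 - 1))" "bd X V g = bd X V f"
    using koszul_exactD[OF Z'] bd_bd[OF X subset_refl] by blast
  then have g': "g \<in> koszul_chains V (Suc i) (\<lambda>_. F e)" "(\<lambda>\<tau>. \<phi> (g \<tau>)) = (\<lambda>_. 0)"
    by (simp_all add: kernel_chain)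
  have "bd X V (\<lambda>\<tau>. f \<tau> - g \<tau>) = (\<lambda>_. 0)"
    using g(2) by (simp add: bd_diff[OF X])
  then obtain h where h: "h \<in> koszul_chains V (Suc (Suc i)) (\<lambda>_. F (e - 1))" "bd X V h = (\<lambda>\<tau>. f \<tau> - g \<tau>)"
    using koszul_exactD[OF acyclic chains_diff[OF F f(1) g'(1)]] by blast
  show "\<exists>b\<in>koszul_chains V (Suc (Suc i)) (\<lambda>_. N (e - 1)). bd Y V b = c"
  proof
    show "bd Y V (\<lambda>\<tau>. \<phi> (h \<tau>)) = c"
      using g'(2) by (auto simp: bd_map h(2) hom_diff f(2) fun_eq_iff)
  qed (rule map_chain[OF h(1)])
qed

end

end

section \<open>Strands of monomial ideals\<close>


lemma lookup_var_mult:
  "Poly_Mapping.lookup (var v * p) m =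
     (if Poly_Mapping.lookup m v > 0 then Poly_Mapping.lookup p (m - Poly_Mapping.single v 1) else 0)"
proof -
  have "Poly_Mapping.lookup (var v * p) m
      = (\<Sum>q. Poly_Mapping.lookup p q when m = Poly_Mapping.single v 1 + q)"
    by (simp add: var_def lookup_mult lookup_single when_mult)
  also have "\<dots> = (\<Sum>q. if Poly_Mapping.lookup m v > 0
      then Poly_Mapping.lookup p q when q = m - Poly_Mapping.single v 1 else 0)"
  proof (intro Sum_any.cong)
    fix q
    have "m = Poly_Mapping.single v 1 + q \<longleftrightarrow> Poly_Mapping.lookup m v > 0 \<and> q = m - Poly_Mapping.single v 1"
    proof
      assume "Poly_Mapping.lookup m v > 0 \<and> q = m - Poly_Mapping.single v 1"
      then show "m = Poly_Mapping.single v 1 + q"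
        by (intro poly_mapping_eqI) (auto simp: lookup_add lookup_minus lookup_single when_def)
    qed (auto simp: lookup_add)
    then show "(Poly_Mapping.lookup p q when m = Poly_Mapping.single v 1 + q)
        = (if Poly_Mapping.lookup m v > 0 then Poly_Mapping.lookup p q when q = m - Poly_Mapping.single v 1 else 0)"
      by (simp add: when_def)
  qed
  also have "\<dots> = (if Poly_Mapping.lookup m v > 0 then Poly_Mapping.lookup p (m - Poly_Mapping.single v 1) else 0)"
    by simp
  finally show ?thesis .
qed

section \<open>Exponent vectors and degrees\<close>

definition ind :: "'v set \<Rightarrow> 'v \<Rightarrow>\<^sub>0 nat" where
  "ind A = (\<Sum>v\<in>A. Poly_Mapping.single v 1)"

lemma lookup_ind: "finite A \<Longrightarrow> Poly_Mapping.lookup (ind A) v = (if v \<in> A then 1 else 0)"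
  by (simp add: ind_def lookup_sum lookup_single when_def)

lemma keys_ind: "finite A \<Longrightarrow> Poly_Mapping.keys (ind A) = A"
  by (auto simp: in_keys_iff lookup_ind split: if_splits)

lemma ind_insert: "finite A \<Longrightarrow> v \<notin> A \<Longrightarrow> ind (insert v A) = Poly_Mapping.single v 1 + ind A"
  by (simp add: ind_def)

lemma mon_deg_eq_sum:
  "finite A \<Longrightarrow> Poly_Mapping.keys m \<subseteq> A \<Longrightarrow> mon_deg m = (\<Sum>v\<in>A. Poly_Mapping.lookup m v)"
  unfolding mon_deg_def by (rule sum.mono_neutral_left) (auto simp: in_keys_iff)

lemma mon_deg_add: "mon_deg (m + m') = mon_deg m + mon_deg m'"
proof -
  let ?A = "Poly_Mapping.keys m \<union> Poly_Mapping.keys m'"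
  have "Poly_Mapping.keys (m + m') \<subseteq> ?A" by (rule keys_add)
  then show ?thesis
    by (simp add: mon_deg_eq_sum[of ?A] lookup_add sum.distrib)
qed

lemma mon_deg_ind: "finite A \<Longrightarrow> mon_deg (ind A) = card A"
  by (simp add: mon_deg_def keys_ind lookup_ind)

lemma mon_deg_single [simp]: "mon_deg (Poly_Mapping.single v n) = n"
  by (simp add: mon_deg_def)

lemma mon_deg_zero [simp]: "mon_deg 0 = 0"
  by (simp add: mon_deg_def)

lemma mon_deg_eq_0_iff [simp]: "mon_deg m = 0 \<longleftrightarrow> m = 0"
  by (auto simp: mon_deg_def in_keys_iff intro!: poly_mapping_eqI)

definition monomials_of_degree :: "'v set \<Rightarrow> int \<Rightarrow> ('v \<Rightarrow>\<^sub>0 nat) set" where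
  "monomials_of_degree V e = {m. Poly_Mapping.keys m \<subseteq> V \<and> int (mon_deg m) = e}"

lemma finite_monomials_of_degree:
  assumes "finite V" shows "finite (monomials_of_degree V e)"
proof (rule finite_imageD)
  have "Poly_Mapping.lookup m v \<le> nat e" if "m \<in> monomials_of_degree V e" for m v
  proof (cases "v \<in> Poly_Mapping.keys m")
    case True
    then have "Poly_Mapping.lookup m v \<le> mon_deg m"
      unfolding mon_deg_def by (intro member_le_sum) auto
    then show ?thesis using that by (auto simp: monomials_of_degree_def)
  qed (simp add: in_keys_iff)
  then have "Poly_Mapping.lookup ` monomials_of_degree V e
      \<subseteq> {f. \<forall>x. (x \<in> V \<longrightarrow> f x \<in> {..nat e}) \<and> (x \<notin> V \<longrightarrow> f x = 0)}"
    by (auto simp: monomials_of_degree_def in_keys_iff)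
  then show "finite (Poly_Mapping.lookup ` monomials_of_degree V e)"
    by (rule finite_subset) (intro finite_set_of_finite_funs assms finite_atMost)
  show "inj_on Poly_Mapping.lookup (monomials_of_degree V e)"
    by (auto intro!: inj_onI poly_mapping_eqI)
qed

text \<open>Membership of a monomial depends only on its support, so for monotone \<open>F\<close>
  this is the degree \<open>e\<close> piece of a squarefree monomial ideal. The constant predicate
  \<open>True\<close> gives the whole ring.\<close>

definition monomial_ideal :: "'v set \<Rightarrow> ('v set \<Rightarrow> bool) \<Rightarrow> int \<Rightarrow> ('v, 'k::field) mpoly set" where
  "monomial_ideal V F e = {p. \<forall>m\<in>Poly_Mapping.keys p. m \<in> monomials_of_degree V e \<and> F (Poly_Mapping.keys m)}"

lemma monomial_idealD:
  "p \<in> monomial_ideal V F e \<Longrightarrow> Poly_Mapping.lookup p m \<noteq> 0 \<Longrightarrow>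
     Poly_Mapping.keys m \<subseteq> V \<and> int (mon_deg m) = e \<and> F (Poly_Mapping.keys m)"
  by (auto simp: monomial_ideal_def monomials_of_degree_def in_keys_iff)

lemma monomial_idealI:
  "(\<And>m. Poly_Mapping.lookup p m \<noteq> 0 \<Longrightarrow>
     Poly_Mapping.keys m \<subseteq> V \<and> int (mon_deg m) = e \<and> F (Poly_Mapping.keys m)) \<Longrightarrow> p \<in> monomial_ideal V F e"
  by (auto simp: monomial_ideal_def monomials_of_degree_def in_keys_iff)

lemma keys_add_nat: "Poly_Mapping.keys (m + m' :: 'v \<Rightarrow>\<^sub>0 nat) = Poly_Mapping.keys m \<union> Poly_Mapping.keys m'"
  by (auto simp: in_keys_iff lookup_add)

lemma minus_ind_add:
  assumes "finite A" "A \<subseteq> Poly_Mapping.keys \<mu>"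
  shows "\<mu> - ind A + ind A = \<mu>"
  using assms by (intro poly_mapping_eqI) (auto simp: lookup_add lookup_minus lookup_ind in_keys_iff)

lemma operators_var: "operators (\<lambda>v (p::('v, 'k::field) mpoly). var v * p)"
  by (auto simp: operators_def algebra_simps)

lemma lookup_sgn_act:
  "Poly_Mapping.lookup (sgn_act b p) m = sgn_act b (Poly_Mapping.lookup (p::('v, 'k::field) mpoly) m)"
  by (simp add: sgn_act_def)

section \<open>Multigraded strands of the Koszul complex\<close>

context koszul_signs begin

lemma submodule_monomial_ideal:
  assumes mono: "\<And>A B. A \<subseteq> B \<Longrightarrow> F A \<Longrightarrow> F B"
  shows "submodule_by (\<lambda>v (p::('v, 'k::field) mpoly). var v * p) (monomial_ideal V F)"
  unfolding submodule_by_def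
proof (intro allI conjI ballI)
  fix e :: int
  show "(0::('v, 'k) mpoly) \<in> monomial_ideal V F e" by (simp add: monomial_ideal_def)
  fix p q :: "('v, 'k) mpoly"
  assume pq: "p \<in> monomial_ideal V F e" "q \<in> monomial_ideal V F e"
  show "p - q \<in> monomial_ideal V F e"
  proof (rule monomial_idealI)
    fix m assume "Poly_Mapping.lookup (p - q) m \<noteq> 0"
    then have "Poly_Mapping.lookup p m \<noteq> 0 \<or> Poly_Mapping.lookup q m \<noteq> 0" by (auto simp: lookup_minus)
    then show "Poly_Mapping.keys m \<subseteq> V \<and> int (mon_deg m) = e \<and> F (Poly_Mapping.keys m)"
      using monomial_idealD[OF pq(1)] monomial_idealD[OF pq(2)] by blast
  qed
next
  fix e :: int and v and p :: "('v, 'k) mpoly"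
  assume v: "v \<in> V" and p: "p \<in> monomial_ideal V F (e - 1)"
  show "var v * p \<in> monomial_ideal V F e"
  proof (rule monomial_idealI)
    fix m assume "Poly_Mapping.lookup (var v * p) m \<noteq> 0"
    then have m: "Poly_Mapping.lookup m v > 0" "Poly_Mapping.lookup p (m - Poly_Mapping.single v 1) \<noteq> 0"
      by (auto simp: lookup_var_mult split: if_splits)
    define m' where "m' = m - Poly_Mapping.single v 1"
    have eq: "m = m' + Poly_Mapping.single v 1"
      using m(1) unfolding m'_def
      by (intro poly_mapping_eqI) (auto simp: lookup_add lookup_minus lookup_single when_def)
    have "Poly_Mapping.keys m' \<subseteq> V" "int (mon_deg m') = e - 1" "F (Poly_Mapping.keys m')"
      using monomial_idealD[OF p m(2)] by (simp_all add: m'_def)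
    then show "Poly_Mapping.keys m \<subseteq> V \<and> int (mon_deg m) = e \<and> F (Poly_Mapping.keys m)"
      using v mono[of "Poly_Mapping.keys m'" "insert v (Poly_Mapping.keys m')"]
      by (simp add: eq keys_add_nat mon_deg_add subset_insertI)
  qed
qed

text \<open>The component of multidegree \<open>\<mu>\<close>: the basis element
  \<open>\<tau>\<close> carries the multidegree \<open>ind \<tau>\<close>. The guard is needed
  because subtraction of exponents truncates at zero.\<close>

definition strand :: "('v \<Rightarrow>\<^sub>0 nat) \<Rightarrow> ('v set \<Rightarrow> ('v, 'k::field) mpoly) \<Rightarrow> 'v set \<Rightarrow> 'k" where
  "strand \<mu> c \<tau> = (if \<tau> \<subseteq> Poly_Mapping.keys \<mu> then Poly_Mapping.lookup (c \<tau>) (\<mu> - ind \<tau>) else 0)"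

text \<open>Inside a fixed multidegree multiplication by a variable moves a coefficient without
  changing it, and variables outside the support of \<open>\<mu>\<close> cannot contribute.\<close>

lemma strand_bd:
  assumes \<mu>: "Poly_Mapping.keys \<mu> \<subseteq> V"
  shows "strand \<mu> (bd (\<lambda>v p. var v * p) V c) = bd (\<lambda>_ a. a) (Poly_Mapping.keys \<mu>) (strand \<mu> c)"
proof
  fix \<rho>
  show "strand \<mu> (bd (\<lambda>v p. var v * p) V c) \<rho> = bd (\<lambda>_ a. a) (Poly_Mapping.keys \<mu>) (strand \<mu> c) \<rho>"
  proof (cases "\<rho> \<subseteq> Poly_Mapping.keys \<mu>")
    case True
    then have fin: "finite \<rho>" using finite_subset finite_keys by blast
    have term_eq: "Poly_Mapping.lookup (var v * c (insert v \<rho>)) (\<mu> - ind \<rho>)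
        = (if v \<in> Poly_Mapping.keys \<mu> then strand \<mu> c (insert v \<rho>) else 0)" if "v \<in> V - \<rho>" for v
    proof -
      have "\<mu> - ind \<rho> - Poly_Mapping.single v 1 = \<mu> - ind (insert v \<rho>)"
        using that fin by (intro poly_mapping_eqI) (auto simp: lookup_minus lookup_ind lookup_single when_def)
      moreover have "Poly_Mapping.lookup (\<mu> - ind \<rho>) v = Poly_Mapping.lookup \<mu> v"
        using that fin by (simp add: lookup_minus lookup_ind)
      ultimately show ?thesis
        using True by (auto simp: lookup_var_mult strand_def in_keys_iff)
    qed
    have "strand \<mu> (bd (\<lambda>v p. var v * p) V c) \<rho>
        = (\<Sum>v\<in>V - \<rho>. sgn_act (s v \<rho>) (Poly_Mapping.lookup (var v * c (insert v \<rho>)) (\<mu> - ind \<rho>)))"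
      using True \<mu> by (auto simp: strand_def bd_def lookup_sum lookup_sgn_act)
    also have "\<dots> = (\<Sum>v\<in>V - \<rho>. sgn_act (s v \<rho>) (if v \<in> Poly_Mapping.keys \<mu> then strand \<mu> c (insert v \<rho>) else 0))"
      using term_eq by (intro sum.cong) auto
    also have "\<dots> = (\<Sum>v\<in>Poly_Mapping.keys \<mu> - \<rho>. sgn_act (s v \<rho>) (strand \<mu> c (insert v \<rho>)))"
      using \<mu> finite_V by (intro sum.mono_neutral_cong_right) auto
    finally show ?thesis using True by (simp add: bd_def)
  qed (simp add: strand_def bd_def)
qed

text \<open>The Koszul complex is the direct sum of its strands, and only finitely many multidegrees
  have a given total degree. Bounding chains found separately in the strands can thus be
  assembled.\<close>

lemma boundary_from_strands:
  fixes c :: "'v set \<Rightarrow> ('v, 'k::field) mpoly"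
  assumes mono: "\<And>A B. A \<subseteq> B \<Longrightarrow> F A \<Longrightarrow> F B"
    and c: "c \<in> koszul_chains V i (\<lambda>_. monomial_ideal V F e)"
    and strands: "\<And>\<mu>. Poly_Mapping.keys \<mu> \<subseteq> V \<Longrightarrow> int (mon_deg \<mu>) = int i + e \<Longrightarrow>
      \<exists>b\<in>complex (Poly_Mapping.keys \<mu>) (Suc i) (\<lambda>\<tau>. F (Poly_Mapping.keys (\<mu> - ind \<tau>))).
        bd (\<lambda>_ a. a) (Poly_Mapping.keys \<mu>) b = strand \<mu> c"
  shows "\<exists>b\<in>koszul_chains V (Suc i) (\<lambda>_. monomial_ideal V F (e - 1)). bd (\<lambda>v p. var v * p) V b = c"
proof -
  let ?X = "\<lambda>v (p::('v, 'k) mpoly). var v * p"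
  let ?M = "monomials_of_degree V (e - 1)"
  have "\<forall>\<mu>. \<exists>b. Poly_Mapping.keys \<mu> \<subseteq> V \<and> int (mon_deg \<mu>) = int i + e \<longrightarrow>
      b \<in> complex (Poly_Mapping.keys \<mu>) (Suc i) (\<lambda>\<tau>. F (Poly_Mapping.keys (\<mu> - ind \<tau>))) \<and>
      bd (\<lambda>_ a. a) (Poly_Mapping.keys \<mu>) b = strand \<mu> c"
    using strands by blast
  then obtain B where B: "\<And>\<mu>. Poly_Mapping.keys \<mu> \<subseteq> V \<Longrightarrow> int (mon_deg \<mu>) = int i + e \<Longrightarrow>
      B \<mu> \<in> complex (Poly_Mapping.keys \<mu>) (Suc i) (\<lambda>\<tau>. F (Poly_Mapping.keys (\<mu> - ind \<tau>))) \<and>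
      bd (\<lambda>_ a. a) (Poly_Mapping.keys \<mu>) (B \<mu>) = strand \<mu> c"
    by metis
  have fin: "finite \<tau>" if "\<tau> \<subseteq> V" for \<tau> using that finite_V finite_subset by blast
  \<comment> \<open>The coefficient of the monomial \<open>m\<close> at \<open>\<tau>\<close>
    belongs to the multidegree \<open>m + ind \<tau>\<close>, so it is read from the chain chosen
    there.\<close>
  define b where "b \<tau> = (if \<tau> \<subseteq> V \<and> card \<tau> = Suc i
      then \<Sum>m\<in>?M. Poly_Mapping.single m (B (m + ind \<tau>) \<tau>) else 0)" for \<tau>
  have lookup_b: "Poly_Mapping.lookup (b \<tau>) m = (if m \<in> ?M then B (m + ind \<tau>) \<tau> else 0)"
    if "\<tau> \<subseteq> V" "card \<tau> = Suc i" for \<tau> m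
  proof -
    have "(\<Sum>x\<in>?M. Poly_Mapping.lookup (Poly_Mapping.single x (B (x + ind \<tau>) \<tau>)) m)
        = (\<Sum>x\<in>?M. if x = m then B (m + ind \<tau>) \<tau> else 0)"
      by (intro sum.cong refl) (auto simp: lookup_single when_def)
    then show ?thesis
      using that finite_monomials_of_degree[OF finite_V] by (simp add: b_def lookup_sum)
  qed
  have deg: "int (mon_deg (m + ind \<tau>)) = int i + e" "Poly_Mapping.keys (m + ind \<tau>) \<subseteq> V"
    if "\<tau> \<subseteq> V" "card \<tau> = Suc i" "m \<in> ?M" for m \<tau>
    using that fin[OF that(1)] by (auto simp: mon_deg_add mon_deg_ind keys_add_nat keys_ind monomials_of_degree_def)
  have b: "b \<in> koszul_chains V (Suc i) (\<lambda>_. monomial_ideal V F (e - 1))"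
  proof (rule chainsI)
    fix \<tau> assume \<tau>: "\<tau> \<subseteq> V" "card \<tau> = Suc i"
    show "b \<tau> \<in> monomial_ideal V F (e - 1)"
    proof (rule monomial_idealI)
      fix m assume "Poly_Mapping.lookup (b \<tau>) m \<noteq> 0"
      then have m: "m \<in> ?M" "B (m + ind \<tau>) \<tau> \<noteq> 0" using lookup_b[OF \<tau>, of m] by (auto split: if_splits)
      then have "F (Poly_Mapping.keys (m + ind \<tau> - ind \<tau>))"
        using B[OF deg(2,1)[OF \<tau> m(1)]] by (auto simp: complex_iff)
      then show "Poly_Mapping.keys m \<subseteq> V \<and> int (mon_deg m) = e - 1 \<and> F (Poly_Mapping.keys m)"
        using m(1) by (simp add: monomials_of_degree_def)
    qed
  qed (auto simp: b_def)
  have bd_b: "bd ?X V b \<in> koszul_chains V i (\<lambda>_. monomial_ideal V F e)"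
    by (rule bd_chains[OF submodule_monomial_ideal[OF mono] operators_var b])
  have "bd ?X V b = c"
  proof
    fix \<rho>
    show "bd ?X V b \<rho> = c \<rho>"
    proof (cases "\<rho> \<subseteq> V \<and> card \<rho> = i")
      case False
      then show ?thesis using chains_out[OF bd_b] chains_out[OF c] by simp
    next
      case \<rho>: True
      show ?thesis
      proof (rule poly_mapping_eqI)
        fix m
        show "Poly_Mapping.lookup (bd ?X V b \<rho>) m = Poly_Mapping.lookup (c \<rho>) m"
        proof (cases "Poly_Mapping.keys m \<subseteq> V \<and> int (mon_deg m) = e")
          case False
          then show ?thesis
            using monomial_idealD[OF chains_in[OF bd_b, of \<rho>], of m] monomial_idealD[OF chains_in[OF c, of \<rho>], of m] \<rho>
            by fastforce
        next
          case m: True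
          define \<mu> where "\<mu> = m + ind \<rho>"
          have \<mu>: "Poly_Mapping.keys \<mu> \<subseteq> V" "int (mon_deg \<mu>) = int i + e" "\<rho> \<subseteq> Poly_Mapping.keys \<mu>"
            using m \<rho> fin[of \<rho>] by (auto simp: \<mu>_def mon_deg_add mon_deg_ind keys_add_nat keys_ind)
          have "strand \<mu> b = B \<mu>"
          proof
            fix \<tau>
            show "strand \<mu> b \<tau> = B \<mu> \<tau>"
            proof (cases "\<tau> \<subseteq> Poly_Mapping.keys \<mu> \<and> card \<tau> = Suc i")
              case True
              then have \<tau>: "\<tau> \<subseteq> V" using \<mu>(1) by blast
              have eq: "\<mu> - ind \<tau> + ind \<tau> = \<mu>" using True fin[OF \<tau>] by (intro minus_ind_add) auto
              then have "int (mon_deg (\<mu> - ind \<tau>)) = e - 1"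
                using mon_deg_add[of "\<mu> - ind \<tau>" "ind \<tau>"] \<mu>(2) True fin[OF \<tau>] by (simp add: mon_deg_ind)
              moreover have "Poly_Mapping.keys (\<mu> - ind \<tau>) \<subseteq> V"
                using \<mu>(1) keys_add_nat[of "\<mu> - ind \<tau>" "ind \<tau>"] eq by auto
              ultimately show ?thesis
                using True lookup_b[OF \<tau>] eq by (simp add: strand_def monomials_of_degree_def)
            next
              case False
              moreover have "b \<tau> = 0" if "card \<tau> \<noteq> Suc i" using that by (simp add: b_def)
              ultimately show ?thesis
                using B[OF \<mu>(1,2)] by (auto simp: complex_iff strand_def)
            qed
          qed
          then have "strand \<mu> (bd ?X V b) \<rho> = strand \<mu> c \<rho>"
            using strand_bd[OF \<mu>(1), of b] B[OF \<mu>(1,2)] by simp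
          then show ?thesis
            using \<mu>(3) by (simp add: strand_def \<mu>_def)
        qed
      qed
    qed
  qed
  with b show ?thesis by blast
qed

lemma strand_complex:
  fixes c :: "'v set \<Rightarrow> ('v, 'k::field) mpoly"
  assumes c: "c \<in> koszul_chains V i (\<lambda>_. monomial_ideal V F e)" and \<mu>: "Poly_Mapping.keys \<mu> \<subseteq> V"
  shows "strand \<mu> c \<in> complex (Poly_Mapping.keys \<mu>) i (\<lambda>\<tau>. F (Poly_Mapping.keys (\<mu> - ind \<tau>)))"
proof (unfold complex_iff, intro allI impI)
  fix \<tau> assume "strand \<mu> c \<tau> \<noteq> 0"
  then have \<tau>: "\<tau> \<subseteq> Poly_Mapping.keys \<mu>" "Poly_Mapping.lookup (c \<tau>) (\<mu> - ind \<tau>) \<noteq> 0"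
    by (auto simp: strand_def split: if_splits)
  then have card: "card \<tau> = i" using chains_out[OF c, of \<tau>] by (metis lookup_zero)
  have "c \<tau> \<in> monomial_ideal V F e" by (rule chains_in[OF c]) (use \<tau> \<mu> card in auto)
  then show "\<tau> \<subseteq> Poly_Mapping.keys \<mu> \<and> card \<tau> = i \<and> F (Poly_Mapping.keys (\<mu> - ind \<tau>))"
    using monomial_idealD[OF _ \<tau>(2)] \<tau>(1) card by blast
qed

lemma keys_minus_ind:
  assumes "finite A"
  shows "Poly_Mapping.keys (\<mu> - ind A) = {v \<in> Poly_Mapping.keys \<mu>. v \<in> A \<longrightarrow> Poly_Mapping.lookup \<mu> v \<ge> 2}"
  using assms by (auto simp: in_keys_iff lookup_minus lookup_ind)

text \<open>In a multidegree which is not squarefree the strand of the Koszul complex is a cone.\<close>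

lemma koszul_exact_monomial_ideal:
  assumes mono: "\<And>A B. A \<subseteq> B \<Longrightarrow> F A \<Longrightarrow> F B"
    and exact: "\<And>W. W \<subseteq> V \<Longrightarrow> int (card W) = int i + e \<Longrightarrow> exact_sets TYPE('k::field) F W i"
  shows "koszul_exact (\<lambda>v (p::('v, 'k) mpoly). var v * p) (monomial_ideal V F) i e"
  unfolding koszul_exact_def
proof (intro ballI impI)
  fix c :: "'v set \<Rightarrow> ('v, 'k) mpoly"
  assume c: "c \<in> koszul_chains V i (\<lambda>_. monomial_ideal V F e)" and cycle: "bd (\<lambda>v p. var v * p) V c = (\<lambda>_. 0)"
  show "\<exists>b\<in>koszul_chains V (Suc i) (\<lambda>_. monomial_ideal V F (e - 1)). bd (\<lambda>v p. var v * p) V b = c"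
  proof (rule boundary_from_strands[OF mono c])
    fix \<mu> :: "'v \<Rightarrow>\<^sub>0 nat" assume \<mu>: "Poly_Mapping.keys \<mu> \<subseteq> V" "int (mon_deg \<mu>) = int i + e"
    let ?W = "Poly_Mapping.keys \<mu>" and ?G = "\<lambda>\<tau>. F (Poly_Mapping.keys (\<mu> - ind \<tau>))"
    have fin: "finite \<tau>" if "\<tau> \<subseteq> ?W" for \<tau> using that finite_keys finite_subset by blast
    have cyc: "bd (\<lambda>_ a. a) ?W (strand \<mu> c) = (\<lambda>_. 0)"
      unfolding strand_bd[OF \<mu>(1), of c, symmetric] cycle by (simp add: strand_def fun_eq_iff)
    have sc: "strand \<mu> c \<in> complex ?W i ?G" by (rule strand_complex[OF c \<mu>(1)])
    show "\<exists>b\<in>complex ?W (Suc i) ?G. bd (\<lambda>_ a. a) ?W b = strand \<mu> c"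
    proof (cases "\<exists>u\<in>?W. Poly_Mapping.lookup \<mu> u \<ge> 2")
      case True
      then obtain u where u: "u \<in> ?W" "Poly_Mapping.lookup \<mu> u \<ge> 2" by blast
      show ?thesis
      proof (rule cone_exact[OF \<mu>(1) u(1) _ sc cyc])
        fix \<tau> assume "\<tau> \<subseteq> ?W" and G: "?G \<tau>"
        then have "Poly_Mapping.keys (\<mu> - ind (insert u \<tau>)) = Poly_Mapping.keys (\<mu> - ind \<tau>)"
          using u fin[of \<tau>] by (auto simp: keys_minus_ind)
        then show "?G (insert u \<tau>)" using G by simp
      qed
    next
      case False
      then have one: "Poly_Mapping.lookup \<mu> v = 1" if "v \<in> ?W" for v
      proof -
        have "Poly_Mapping.lookup \<mu> v \<noteq> 0" "\<not> Poly_Mapping.lookup \<mu> v \<ge> 2"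
          using that False by (auto simp: in_keys_iff)
        then show ?thesis by linarith
      qed
      have eq: "Poly_Mapping.keys (\<mu> - ind \<tau>) = ?W - \<tau>" if "\<tau> \<subseteq> ?W" for \<tau>
        using one fin[OF that] by (auto simp: keys_minus_ind)
      have G: "complex ?W j ?G = complex ?W j (\<lambda>\<tau>. F (?W - \<tau>))" for j
        unfolding complex_iff set_eq_iff using eq by metis
      have "int (card ?W) = int i + e"
        using \<mu>(2) one by (simp add: mon_deg_def)
      then show ?thesis
        using exact_setsD[OF exact[OF \<mu>(1)] _ cyc] sc unfolding G by auto
    qed
  qed
qed

text \<open>The squarefree strand of multidegree \<open>W\<close> is a direct summand of the Koszul
  complex. A scalar cycle is placed there, bounded among polynomials, and the strand of the bounding
  chain is taken.\<close>

lemma exact_sets_of_koszul_exact: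
  assumes exact: "koszul_exact (\<lambda>v (p::('v, 'k::field) mpoly). var v * p) (monomial_ideal V F) i e"
    and W: "W \<subseteq> V" "int (card W) = int i + e"
  shows "exact_sets TYPE('k) F W i"
  unfolding exact_sets_def
proof (intro allI impI, elim conjE)
  fix c :: "'v set \<Rightarrow> 'k"
  assume c: "c \<in> complex W i (\<lambda>\<tau>. F (W - \<tau>))" and cycle: "bd (\<lambda>_ a. a) W c = (\<lambda>_. 0)"
  let ?X = "\<lambda>v (p::('v, 'k) mpoly). var v * p"
  have finW: "finite W" using W finite_V finite_subset by blast
  have fin: "finite \<tau>" if "\<tau> \<subseteq> W" for \<tau> using that finW finite_subset by blast
  define C where "C \<tau> = Poly_Mapping.single (ind (W - \<tau>)) (c \<tau>)" for \<tau>
  have minus: "ind W - ind \<tau> = ind (W - \<tau>)" if "\<tau> \<subseteq> W" for \<tau>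
    using that finW fin[OF that] by (intro poly_mapping_eqI) (auto simp: lookup_minus lookup_ind)
  have keysW: "Poly_Mapping.keys (ind W) = W" using finW by (rule keys_ind)
  have c_nz: "\<tau> \<subseteq> W" "card \<tau> = i" "F (W - \<tau>)" if "c \<tau> \<noteq> 0" for \<tau>
    using c that by (auto simp: complex_iff)
  have C: "C \<in> koszul_chains V i (\<lambda>_. monomial_ideal V F e)"
  proof (rule chainsI)
    fix \<tau>
    show "C \<tau> \<in> monomial_ideal V F e"
    proof (rule monomial_idealI)
      fix m assume "Poly_Mapping.lookup (C \<tau>) m \<noteq> 0"
      then have m: "m = ind (W - \<tau>)" "c \<tau> \<noteq> 0" by (auto simp: C_def lookup_single when_def split: if_splits)
      then show "Poly_Mapping.keys m \<subseteq> V \<and> int (mon_deg m) = e \<and> F (Poly_Mapping.keys m)"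
        using c_nz[OF m(2)] W finW fin[of \<tau>] card_mono[of W \<tau>]
        by (auto simp: keys_ind mon_deg_ind card_Diff_subset)
    qed
  next
    fix \<tau> assume "\<not> (\<tau> \<subseteq> V \<and> card \<tau> = i)"
    then have "c \<tau> = 0" using c_nz[of \<tau>] W by blast
    then show "C \<tau> = 0" by (simp add: C_def)
  qed
  have lookup_C: "Poly_Mapping.lookup (C \<tau>) m = (if m = ind (W - \<tau>) then c \<tau> else 0)" for \<tau> m
    by (simp add: C_def lookup_single when_def)
  have strand_C: "strand (ind W) C = c"
  proof
    fix \<tau> show "strand (ind W) C \<tau> = c \<tau>"
      using c_nz(1)[of \<tau>] by (cases "\<tau> \<subseteq> W") (auto simp: strand_def keysW lookup_C minus)
  qed
  have "bd ?X V C = (\<lambda>_. 0)"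
  proof
    fix \<rho>
    have term_eq: "var v * C (insert v \<rho>) = Poly_Mapping.single (ind (W - \<rho>)) (c (insert v \<rho>))" if "v \<notin> \<rho>" for v
    proof (cases "c (insert v \<rho>) = 0")
      case False
      then have "W - \<rho> = insert v (W - insert v \<rho>)" using c_nz[of "insert v \<rho>"] that by blast
      moreover have "ind (insert v (W - insert v \<rho>)) = Poly_Mapping.single v 1 + ind (W - insert v \<rho>)"
        by (rule ind_insert) (use finW in auto)
      ultimately have "ind (W - \<rho>) = Poly_Mapping.single v 1 + ind (W - insert v \<rho>)"
        by metis
      then show ?thesis by (simp add: C_def var_def mult_single)
    qed (simp add: C_def)
    have sg: "sgn_act t (Poly_Mapping.single m a) = Poly_Mapping.single m (sgn_act t a)"
      for t m and a :: 'k by (simp add: sgn_act_def single_uminus)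
    have sm: "(\<Sum>v\<in>A. Poly_Mapping.single m (f v)) = Poly_Mapping.single m (\<Sum>v\<in>A. f v)"
      for A :: "'v set" and m :: "'v \<Rightarrow>\<^sub>0 nat" and f :: "'v \<Rightarrow> 'k"
      by (induction A rule: infinite_finite_induct) (simp_all add: single_add)
    show "bd ?X V C \<rho> = 0"
    proof (cases "\<rho> \<subseteq> W")
      case True
      have "bd ?X V C \<rho> = (\<Sum>v\<in>V - \<rho>. sgn_act (s v \<rho>) (Poly_Mapping.single (ind (W - \<rho>)) (c (insert v \<rho>))))"
        using True W by (auto simp: bd_def term_eq intro!: sum.cong)
      also have "\<dots> = Poly_Mapping.single (ind (W - \<rho>)) (\<Sum>v\<in>V - \<rho>. sgn_act (s v \<rho>) (c (insert v \<rho>)))"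
        by (simp add: sg sm)
      also have "(\<Sum>v\<in>V - \<rho>. sgn_act (s v \<rho>) (c (insert v \<rho>))) = (\<Sum>v\<in>W - \<rho>. sgn_act (s v \<rho>) (c (insert v \<rho>)))"
      proof (rule sum.mono_neutral_right)
        show "\<forall>v\<in>V - \<rho> - (W - \<rho>). sgn_act (s v \<rho>) (c (insert v \<rho>)) = 0"
          using c_nz(1) by (metis Diff_iff insert_subset sgn_act_eq_0_iff)
      qed (use W finite_V in auto)
      also have "\<dots> = bd (\<lambda>_ a. a) W c \<rho>" using True by (simp add: bd_def)
      finally show ?thesis by (simp add: cycle)
    next
      case False
      then have "c (insert v \<rho>) = 0" for v using c_nz(1)[of "insert v \<rho>"] by blast
      then have "C (insert v \<rho>) = 0" for v by (simp add: C_def)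
      then show ?thesis by (simp add: bd_def)
    qed
  qed
  then obtain b where b: "b \<in> koszul_chains V (Suc i) (\<lambda>_. monomial_ideal V F (e - 1))" "bd ?X V b = C"
    using koszul_exactD[OF exact C] by blast
  show "\<exists>b\<in>complex W (Suc i) (\<lambda>\<tau>. F (W - \<tau>)). bd (\<lambda>_ a. a) W b = c"
  proof
    show "bd (\<lambda>_ a. a) W (strand (ind W) b) = c"
      using strand_bd[of "ind W" b] b(2) W(1) by (simp add: keysW strand_C)
    have "strand (ind W) b \<in> complex W (Suc i) (\<lambda>\<tau>. F (Poly_Mapping.keys (ind W - ind \<tau>)))"
      using strand_complex[OF b(1), of "ind W"] W(1) by (simp add: keysW)
    then show "strand (ind W) b \<in> complex W (Suc i) (\<lambda>\<tau>. F (W - \<tau>))"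
      unfolding complex_iff by (metis minus finW finite_Diff keys_ind)
  qed
qed

text \<open>If \<open>u\<close> never matters for \<open>F\<close>, it can be added to every face,
  and the complex is a cone with apex \<open>u\<close>.\<close>

lemma exact_sets_cone:
  assumes "W \<subseteq> V" "u \<in> W" and irrelevant: "\<And>A. A \<subseteq> W \<Longrightarrow> F A \<Longrightarrow> F (A - {u})"
  shows "exact_sets TYPE('k::ab_group_add) F W i"
  unfolding exact_sets_def
proof (intro allI impI, elim conjE)
  fix c :: "'v set \<Rightarrow> 'k"
  assume c: "c \<in> complex W i (\<lambda>\<tau>. F (W - \<tau>))" "bd (\<lambda>_ a. a) W c = (\<lambda>_. 0)"
  have "F (W - insert u \<tau>)" if "F (W - \<tau>)" for \<tau>
    using irrelevant[of "W - \<tau>"] that by (metis Diff_insert Diff_subset)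
  then show "\<exists>b\<in>complex W (Suc i) (\<lambda>\<tau>. F (W - \<tau>)). bd (\<lambda>_ a. a) W b = c"
    using cone_exact[OF assms(1,2) _ c] by blast
qed

lemma exact_sets_empty:
  assumes "i > 0"
  shows "exact_sets TYPE('k::ab_group_add) F {} i"
  unfolding exact_sets_def
proof (intro allI impI, elim conjE)
  fix c :: "'v set \<Rightarrow> 'k"
  assume "c \<in> complex {} i (\<lambda>\<tau>. F ({} - \<tau>))"
  then have "c = (\<lambda>_. 0)" using assms by (auto simp: complex_iff fun_eq_iff)
  then show "\<exists>b\<in>complex {} (Suc i) (\<lambda>\<tau>. F ({} - \<tau>)). bd (\<lambda>_ a. a) {} b = c"
    using bd_zero[OF operators_id] by (intro bexI[of _ "\<lambda>_. 0"]) (auto simp: complex_iff)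
qed

lemma koszul_exact_poly_ring:
  "koszul_exact (\<lambda>v (p::('v, 'k::field) mpoly). var v * p) (monomial_ideal V (\<lambda>_. True)) (Suc i) e"
proof (rule koszul_exact_monomial_ideal)
  fix W assume "W \<subseteq> V"
  then show "exact_sets TYPE('k) (\<lambda>_. True) W (Suc i)"
    by (cases "W = {}") (auto intro: exact_sets_cone exact_sets_empty)
qed auto

text \<open>In homological degree 0 the homology of the polynomial ring is the field, detected by
  the constant term. Every other multidegree is a cone over one of its variables.\<close>

lemma poly_without_constant_boundary:
  fixes c :: "'v set \<Rightarrow> ('v, 'k::field) mpoly"
  assumes c: "c \<in> koszul_chains V 0 (\<lambda>_. monomial_ideal V (\<lambda>_. True) e)"
    and const: "Poly_Mapping.lookup (c {}) 0 = 0"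
  shows "\<exists>b\<in>koszul_chains V 1 (\<lambda>_. monomial_ideal V (\<lambda>_. True) (e - 1)). bd (\<lambda>v p. var v * p) V b = c"
  unfolding One_nat_def
proof (rule boundary_from_strands[OF _ c])
  fix \<mu> :: "'v \<Rightarrow>\<^sub>0 nat" assume \<mu>: "Poly_Mapping.keys \<mu> \<subseteq> V"
  let ?W = "Poly_Mapping.keys \<mu>"
  have sc: "strand \<mu> c \<in> complex ?W 0 (\<lambda>\<tau>. True)"
    using strand_complex[OF c \<mu>] by simp
  show "\<exists>b\<in>complex ?W (Suc 0) (\<lambda>_. True). bd (\<lambda>_ a. a) ?W b = strand \<mu> c"
  proof (cases "\<mu> = 0")
    case True
    then have "strand \<mu> c = (\<lambda>_. 0)"
      using const by (auto simp: strand_def fun_eq_iff ind_def)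
    then show ?thesis
      using bd_zero[OF operators_id] by (intro bexI[of _ "\<lambda>_. 0"]) (auto simp: complex_iff)
  next
    case False
    then obtain u where u: "u \<in> ?W"
      by (metis in_keys_iff lookup_zero poly_mapping_eqI)
    have "bd (\<lambda>_ a. a) ?W (strand \<mu> c) = (\<lambda>_. 0)"
    proof
      fix \<rho>
      have "strand \<mu> c (insert v \<rho>) = 0" if "\<rho> \<subseteq> ?W" for v
      proof (rule ccontr)
        assume "strand \<mu> c (insert v \<rho>) \<noteq> 0"
        then have "insert v \<rho> \<subseteq> ?W" "card (insert v \<rho>) = 0" using sc by (auto simp: complex_iff)
        then show False by (metis card_0_eq finite_keys finite_subset insert_not_empty)
      qed
      then show "bd (\<lambda>_ a. a) ?W (strand \<mu> c) \<rho> = 0" by (simp add: bd_def)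
    qed
    then show ?thesis using cone_exact[OF \<mu> u _ sc] by blast
  qed
qed auto

end

section \<open>Regularity of set families\<close>


context koszul_signs begin

text \<open>Nonzero Betti numbers in multidegree \<open>W\<close> satisfy
  \<open>card W - i \<le> d\<close>. Letting \<open>W\<close> range over subsets of \<open>X\<close>
  encodes deletion of variables without changing \<open>F\<close>.\<close>

definition reg_le :: "'k::ab_group_add itself \<Rightarrow> ('v set \<Rightarrow> bool) \<Rightarrow> 'v set \<Rightarrow> nat \<Rightarrow> bool" where
  "reg_le TYPE('k) F X d \<longleftrightarrow> (\<forall>W\<subseteq>X. \<forall>i. card W > d + i \<longrightarrow> exact_sets TYPE('k) F W i)"

lemma reg_le_mono: "reg_le TYPE('k::ab_group_add) F X d \<Longrightarrow> Y \<subseteq> X \<Longrightarrow> d \<le> d' \<Longrightarrow> reg_le TYPE('k) F Y d'"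
  unfolding reg_le_def by (meson add_le_mono1 le_less_trans order_trans)

lemma reg_le_cong:
  assumes "\<And>A. A \<subseteq> X \<Longrightarrow> F A = F' A"
  shows "reg_le TYPE('k::ab_group_add) F X d \<longleftrightarrow> reg_le TYPE('k) F' X d"
proof -
  have "exact_sets TYPE('k) F W i \<longleftrightarrow> exact_sets TYPE('k) F' W i" if "W \<subseteq> X" for W i
  proof -
    have eq: "F (W - \<tau>) = F' (W - \<tau>)" for \<tau> by (rule assms) (use that in blast)
    show ?thesis unfolding exact_sets_def eq ..
  qed
  then show ?thesis unfolding reg_le_def by blast
qed

text \<open>The bound of regularity by the maximum of that of the deletion and one more than that of
  the colon. Dropping \<open>v\<close> lowers \<open>card W\<close> by one; on the deletion side the
  homological degree drops as well, hence the asymmetric bounds.\<close>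

lemma reg_le_split:
  assumes mono: "\<And>A B. A \<subseteq> B \<Longrightarrow> F A \<Longrightarrow> F B" and X: "X \<subseteq> V"
    and del: "reg_le TYPE('k::ab_group_add) F (X - {v}) (Suc d)"
    and link: "reg_le TYPE('k) (\<lambda>A. F (insert v A)) (X - {v}) d"
  shows "reg_le TYPE('k) F X (Suc d)"
  unfolding reg_le_def
proof (intro allI impI)
  fix W i assume W: "W \<subseteq> X" and card: "card W > Suc d + i"
  show "exact_sets TYPE('k) F W i"
  proof (cases "v \<in> W")
    case False
    then have "W \<subseteq> X - {v}" using W by blast
    then show ?thesis using del card unfolding reg_le_def by blast
  next
    case True
    have "finite W" by (rule finite_subset[OF subset_trans[OF W X] finite_V])
    then have card': "card (W - {v}) = card W - 1" using True by simp
    have sub: "W - {v} \<subseteq> X - {v}" using W by blast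
    show ?thesis
    proof (rule exact_sets_split[OF _ True mono])
      show "exact_sets TYPE('k) (\<lambda>A. F (insert v A)) (W - {v}) i"
        using link sub card card' unfolding reg_le_def by simp
      show "exact_sets TYPE('k) F (W - {v}) j" if "i = Suc j" for j
        using del sub card card' that unfolding reg_le_def by simp
    qed (use W X in auto)
  qed
qed

lemma reg_le_top:
  assumes "X \<subseteq> V" "\<And>A. A \<subseteq> X \<Longrightarrow> F A"
  shows "reg_le TYPE('k::ab_group_add) F X d"
  unfolding reg_le_def
proof (intro allI impI)
  fix W i assume W: "W \<subseteq> X" "card W > d + i"
  then have "W \<noteq> {}" by auto
  then obtain u where "u \<in> W" by blast
  then show "exact_sets TYPE('k) F W i"
  proof (rule exact_sets_cone[rotated])
    show "F (A - {u})" if "A \<subseteq> W" for A by (rule assms(2)) (use that W(1) in blast)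
  qed (rule subset_trans[OF W(1) assms(1)])
qed

lemma reg_le_bot:
  assumes "\<And>A. A \<subseteq> X \<Longrightarrow> \<not> F A"
  shows "reg_le TYPE('k::ab_group_add) F X d"
  unfolding reg_le_def exact_sets_def
proof (intro allI impI, elim conjE)
  fix W i and c :: "'v set \<Rightarrow> 'k"
  assume W: "W \<subseteq> X" and c: "c \<in> complex W i (\<lambda>\<tau>. F (W - \<tau>))"
  have "c = (\<lambda>_. 0)"
    using c assms W unfolding complex_iff fun_eq_iff by (metis Diff_subset order_trans)
  then show "\<exists>b\<in>complex W (Suc i) (\<lambda>\<tau>. F (W - \<tau>)). bd (\<lambda>_ a. a) W b = c"
    using bd_zero[OF operators_id] by (intro bexI[of _ "\<lambda>_. 0"]) (auto simp: complex_iff)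
qed

text \<open>Colons may be bounded on all of \<open>X - {v}\<close>, although they are used after
  earlier vertices of \<open>Z\<close> have gone, since the bound restricts to subsets.\<close>

lemma reg_le_split_set:
  assumes mono: "\<And>A B. A \<subseteq> B \<Longrightarrow> F A \<Longrightarrow> F B" and X: "X \<subseteq> V" and Z: "Z \<subseteq> X"
    and del: "reg_le TYPE('k::ab_group_add) F (X - Z) (Suc d)"
    and link: "\<And>v. v \<in> Z \<Longrightarrow> reg_le TYPE('k) (\<lambda>A. F (insert v A)) (X - {v}) d"
  shows "reg_le TYPE('k) F X (Suc d)"
proof -
  have "finite Z" by (rule finite_subset[OF subset_trans[OF Z X] finite_V])
  then show ?thesis using X Z del link
  proof (induction Z arbitrary: X rule: finite_induct)
    case (insert z Z)
    show ?case
    proof (rule reg_le_split[OF mono insert.prems(1)])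
      show "reg_le TYPE('k) F (X - {z}) (Suc d)"
      proof (rule insert.IH)
        show "reg_le TYPE('k) F (X - {z} - Z) (Suc d)"
          by (rule reg_le_mono[OF insert.prems(3)]) auto
        show "reg_le TYPE('k) (\<lambda>A. F (insert v A)) (X - {z} - {v}) d" if "v \<in> Z" for v
          by (rule reg_le_mono[OF insert.prems(4)]) (use that in auto)
      qed (use insert in auto)
      show "reg_le TYPE('k) (\<lambda>A. F (insert z A)) (X - {z}) d" using insert.prems(4) by blast
    qed
  qed simp
qed

text \<open>Generators that are variables have the unit ideal as colon, so they can be
  discarded.\<close>

lemma reg_le_variables:
  assumes mono: "\<And>A B. A \<subseteq> B \<Longrightarrow> F A \<Longrightarrow> F B" and X: "X \<subseteq> V" and Z: "Z \<subseteq> X"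
    and F: "\<And>u. u \<in> Z \<Longrightarrow> F {u}"
    and del: "reg_le TYPE('k::ab_group_add) F (X - Z) (Suc d)"
  shows "reg_le TYPE('k) F X (Suc d)"
proof (rule reg_le_split_set[OF mono X Z del])
  fix u assume "u \<in> Z"
  then show "reg_le TYPE('k) (\<lambda>A. F (insert u A)) (X - {u}) d"
    using X F mono[of "{u}"] by (intro reg_le_top) auto
qed

section \<open>Edge ideals\<close>

definition has_edge :: "('v \<Rightarrow> 'v \<Rightarrow> bool) \<Rightarrow> 'v set \<Rightarrow> bool" where
  "has_edge Q A \<longleftrightarrow> (\<exists>a\<in>A. \<exists>b\<in>A. Q a b)"

lemma has_edge_mono: "A \<subseteq> B \<Longrightarrow> has_edge Q A \<Longrightarrow> has_edge Q B"
  by (auto simp: has_edge_def)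

text \<open>The colon of an edge ideal by \<open>v\<close> has the neighbours of \<open>v\<close> as
  variables. After discarding them, what remains is the edge ideal of the graph without the closed
  neighbourhood of \<open>v\<close>.\<close>

lemma reg_le_has_edge_split:
  assumes sym: "\<And>a b. Q a b \<Longrightarrow> Q b a" and X: "X \<subseteq> V" and Z: "Z \<subseteq> X"
    and del: "reg_le TYPE('k::ab_group_add) (has_edge Q) (X - Z) (Suc (Suc d))"
    and link: "\<And>v. v \<in> Z \<Longrightarrow> \<not> Q v v \<and> reg_le TYPE('k) (has_edge Q) (X - {u. u = v \<or> Q v u}) (Suc d)"
  shows "reg_le TYPE('k) (has_edge Q) X (Suc (Suc d))"
proof (rule reg_le_split_set[OF has_edge_mono X Z del])
  fix v assume v: "v \<in> Z"
  show "reg_le TYPE('k) (\<lambda>A. has_edge Q (insert v A)) (X - {v}) (Suc d)"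
  proof (rule reg_le_variables)
    show "has_edge Q (insert v A) \<Longrightarrow> has_edge Q (insert v B)" if "A \<subseteq> B" for A B
      by (rule has_edge_mono) (use that in auto)
    show "X - {v} \<subseteq> V" "{u \<in> X - {v}. Q v u} \<subseteq> X - {v}" using X by auto
    show "has_edge Q {v, u}" if "u \<in> {u \<in> X - {v}. Q v u}" for u
      using that by (auto simp: has_edge_def)
    have "reg_le TYPE('k) (has_edge Q) (X - {v} - {u \<in> X - {v}. Q v u}) (Suc d)"
      by (rule reg_le_mono[OF conjunct2[OF link[OF v]]]) auto
    moreover have "has_edge Q (insert v A) = has_edge Q A" if "A \<subseteq> X - {v} - {u \<in> X - {v}. Q v u}" for A
      using that link[OF v] sym by (fastforce simp: has_edge_def)
    ultimately show "reg_le TYPE('k) (\<lambda>A. has_edge Q (insert v A)) (X - {v} - {u \<in> X - {v}. Q v u}) (Suc d)"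
      using reg_le_cong[of "X - {v} - {u \<in> X - {v}. Q v u}" "\<lambda>A. has_edge Q (insert v A)" "has_edge Q"] by blast
  qed
qed

end

text \<open>
  A graph with chosen simplicial vertices \<open>D\<close>, one in each block of a partition into cliques;
  \<open>z v\<close> is the chosen vertex in the block of \<open>v\<close>.
\<close>

locale simplicial_cover = koszul_signs V s for V :: "'v set" and s +
  fixes adj :: "'v \<Rightarrow> 'v \<Rightarrow> bool" and D :: "'v set" and z :: "'v \<Rightarrow> 'v"
  assumes adj_sym: "adj u v \<Longrightarrow> adj v u"
    and adj_irrefl: "\<not> adj v v"
    and D_clique: "d \<in> D \<Longrightarrow> adj d u \<Longrightarrow> adj d v \<Longrightarrow> u \<noteq> v \<Longrightarrow> adj u v"
    and D_indep: "d \<in> D \<Longrightarrow> d' \<in> D \<Longrightarrow> \<not> adj d d'"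
    and z_in_D: "v \<in> V - D \<Longrightarrow> z v \<in> D"
    and adj_z: "v \<in> V - D \<Longrightarrow> adj v (z v)"
    and z_unique: "v \<in> V - D \<Longrightarrow> d \<in> D \<Longrightarrow> adj v d \<Longrightarrow> d = z v"
begin

definition two_edges :: "'v set \<Rightarrow> bool" where
  "two_edges A \<longleftrightarrow> (\<exists>a\<in>A. \<exists>b\<in>A. \<exists>a'\<in>A. \<exists>b'\<in>A. distinct [a, b, a', b'] \<and> adj a b \<and> adj a' b')"

lemma two_edges_mono: "A \<subseteq> B \<Longrightarrow> two_edges A \<Longrightarrow> two_edges B"
  unfolding two_edges_def by (meson subsetD)

definition indep :: "'v set \<Rightarrow> bool" where
  "indep T \<longleftrightarrow> (\<forall>t\<in>T. \<forall>t'\<in>T. \<not> adj t t')"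

definition closed_nbhd :: "'v set \<Rightarrow> 'v set" where
  "closed_nbhd S = {v. v \<in> S \<or> (\<exists>u\<in>S. adj u v)}"

text \<open>A substitute for \<open>aim2\<close> suited to induction: it passes to subsets of
  \<open>U\<close>, and it improves by one when the closed neighbourhood of a vertex outside
  \<open>D\<close> is removed, because that vertex can join \<open>T\<close>.\<close>

definition admissible_bound :: "'v set \<Rightarrow> nat \<Rightarrow> bool" where
  "admissible_bound U c \<longleftrightarrow> (\<forall>a\<in>U. \<forall>b\<in>U. \<forall>a'\<in>U. \<forall>b'\<in>U. \<forall>T\<subseteq>U - D.
     distinct [a, b, a', b'] \<and> adj a b \<and> adj a' b' \<and> indep T \<and> T \<inter> closed_nbhd {a, b, a', b'} = {}
       \<longrightarrow> 2 + card T \<le> c)"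

lemma admissible_boundD:
  assumes "admissible_bound U c" "{a, b, a', b'} \<subseteq> U" "T \<subseteq> U - D" "distinct [a, b, a', b']"
    "adj a b" "adj a' b'" "indep T" "\<And>t x. t \<in> T \<Longrightarrow> x \<in> {a, b, a', b'} \<Longrightarrow> t \<noteq> x \<and> \<not> adj x t"
  shows "2 + card T \<le> c"
proof -
  have "T \<inter> closed_nbhd {a, b, a', b'} = {}" using assms(8) by (auto simp: closed_nbhd_def)
  then show ?thesis using assms(1-7) unfolding admissible_bound_def by auto
qed

text \<open>Vertices outside \<open>D\<close> are removed one at a time until only the edgeless set
  \<open>D\<close> can remain. Removing a closed neighbourhood lowers the size of independent sets
  outside \<open>D\<close>, since the removed vertex could be added.\<close>

lemma reg_le_has_edge:
  assumes "X \<subseteq> V" "\<And>T. T \<subseteq> X - D \<Longrightarrow> indep T \<Longrightarrow> card T \<le> d"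
  shows "reg_le TYPE('k::ab_group_add) (has_edge adj) X (Suc d)"
proof -
  have "finite X" using assms(1) finite_V finite_subset by blast
  then show ?thesis using assms
  proof (induction "card X" arbitrary: X d rule: less_induct)
    case less
    show ?case
    proof (cases "X \<subseteq> D")
      case True
      then show ?thesis
        by (intro reg_le_bot) (use True D_indep in \<open>unfold has_edge_def, blast\<close>)
    next
      case False
      then obtain v where v: "v \<in> X" "v \<notin> D" by blast
      \<comment> \<open>The singleton of \<open>v\<close> is itself independent and avoids
        \<open>D\<close>.\<close>
      then have "d \<ge> 1" using less.prems(3)[of "{v}"] by (simp add: indep_def adj_irrefl)
      then obtain d' where d: "d = Suc d'" by (cases d) auto
      have smaller: "card Y < card X" if "Y \<subseteq> X - {v}" for Y
        using that v less.prems(1) by (metis Diff_subset card_Diff1_less card_mono finite_Diff le_less_trans)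
      show ?thesis unfolding d
      proof (rule reg_le_has_edge_split[where Z = "{v}"])
        show "reg_le TYPE('k) (has_edge adj) (X - {v}) (Suc (Suc d'))"
          using less.prems unfolding d by (intro less.hyps smaller) auto
        fix w assume "w \<in> {v}"
        then have w: "w = v" by simp
        let ?Y = "X - {u. u = v \<or> adj v u}"
        have "reg_le TYPE('k) (has_edge adj) ?Y (Suc d')"
        proof (intro less.hyps smaller)
          fix T assume T: "T \<subseteq> ?Y - D" "indep T"
          then have "indep (insert v T)"
            using adj_irrefl adj_sym by (auto simp: indep_def)
          then have "card (insert v T) \<le> d"
            using T v by (intro less.prems(3)) auto
          moreover have "finite T" "v \<notin> T" using T less.prems(1) finite_subset by blast+
          ultimately show "card T \<le> d'" by (simp add: d)
        qed (use less.prems in auto)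
        then show "\<not> adj w w \<and> reg_le TYPE('k) (has_edge adj) (X - {u. u = w \<or> adj w u}) (Suc d')"
          using adj_irrefl w by simp
      qed (use less.prems v adj_sym in auto)
    qed
  qed
qed

lemma reg_le_has_edge_cong:
  assumes "X \<subseteq> V" "\<And>T. T \<subseteq> X - D \<Longrightarrow> indep T \<Longrightarrow> card T \<le> d"
    and "\<And>a b. a \<in> X \<Longrightarrow> b \<in> X \<Longrightarrow> Q a b \<longleftrightarrow> adj a b"
  shows "reg_le TYPE('k::ab_group_add) (has_edge Q) X (Suc d)"
proof -
  have "has_edge Q A = has_edge adj A" if "A \<subseteq> X" for A
    using that assms(3) unfolding has_edge_def by (meson subsetD)
  then show ?thesis using reg_le_has_edge[OF assms(1,2)] reg_le_cong by metis
qed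

text \<open>The colon of the square-free square by the edge \<open>{y, w}\<close> is the edge ideal of this graph.\<close>

definition colon_adj :: "'v \<Rightarrow> 'v \<Rightarrow> 'v \<Rightarrow> 'v \<Rightarrow> bool" where
  "colon_adj y w a b \<longleftrightarrow> a \<noteq> b \<and> (adj a b \<or> adj y a \<and> adj w b \<or> adj y b \<and> adj w a)"

text \<open>Two disjoint edges either include one inside \<open>A\<close>, or each uses exactly one
  of \<open>y\<close> and \<open>w\<close>; then their other ends form a new edge. Conversely
  \<open>yw\<close> itself completes an edge of \<open>A\<close>.\<close>

lemma two_edges_insert_edge:
  assumes yw: "adj y w" and A: "y \<notin> A" "w \<notin> A"
  shows "two_edges (insert y (insert w A)) \<longleftrightarrow> has_edge (colon_adj y w) A"
proof
  assume "has_edge (colon_adj y w) A"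
  then obtain a b where ab: "a \<in> A" "b \<in> A" "a \<noteq> b" "adj a b \<or> adj y a \<and> adj w b \<or> adj y b \<and> adj w a"
    by (auto simp: has_edge_def colon_adj_def)
  have ne: "y \<noteq> w" using yw adj_irrefl by auto
  from ab(4) consider "adj a b" | "adj y a" "adj w b" | "adj y b" "adj w a" by blast
  then show "two_edges (insert y (insert w A))"
  proof cases
    case 1
    then show ?thesis unfolding two_edges_def
      using ab A ne yw by (intro bexI[of _ y] bexI[of _ w] bexI[of _ a] bexI[of _ b]) auto
  next
    case 2
    then show ?thesis unfolding two_edges_def
      using ab A ne by (intro bexI[of _ y] bexI[of _ a] bexI[of _ w] bexI[of _ b]) auto
  next
    case 3
    then show ?thesis unfolding two_edges_def
      using ab A ne by (intro bexI[of _ y] bexI[of _ b] bexI[of _ w] bexI[of _ a]) auto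
  qed
next
  assume "two_edges (insert y (insert w A))"
  then obtain a b a' b' where e: "{a, b, a', b'} \<subseteq> insert y (insert w A)" "distinct [a, b, a', b']"
      "adj a b" "adj a' b'"
    unfolding two_edges_def by blast
  show "has_edge (colon_adj y w) A"
  proof (cases "(a \<in> A \<and> b \<in> A) \<or> (a' \<in> A \<and> b' \<in> A)")
    case True
    then show ?thesis using e unfolding has_edge_def colon_adj_def by auto
  next
    case False
    then obtain p q p' q' where pq: "p \<in> {y, w}" "p' \<in> {y, w}" "p \<noteq> p'" "q \<in> A" "q' \<in> A" "q \<noteq> q'" "adj p q" "adj p' q'"
      using e adj_sym by auto metis+
    then show ?thesis unfolding has_edge_def colon_adj_def by blast
  qed
qed

end

section \<open>The upper bound\<close>


context simplicial_cover begin

text \<open>Both \<open>u\<close> and \<open>v\<close> are neighbours of the simplicial vertex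
  \<open>z v\<close>.\<close>

lemma D_dominated:
  assumes "v \<in> V" "v \<notin> D" "adj (z v) u" "u \<noteq> v"
  shows "adj v u"
  using D_clique[OF z_in_D adj_sym[OF adj_z] assms(3)] assms by auto

text \<open>\<open>y\<close> is the vertex to be removed. The bound is written \<open>k + 2\<close>
  so that \<open>k\<close> is the size left for \<open>T\<close> once two disjoint edges are fixed;
  closure under \<open>z\<close> keeps the edges from \<open>v\<close> to \<open>z v\<close> inside
  \<open>U\<close>.\<close>

context
  fixes U :: "'v set" and k :: nat and y :: 'v
  assumes U: "U \<subseteq> V" and closed: "\<And>v. v \<in> U \<Longrightarrow> v \<notin> D \<Longrightarrow> z v \<in> U"
    and bound: "admissible_bound U (Suc (Suc k))" and y: "y \<in> U" "y \<notin> D"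
begin

lemma z_facts:
  assumes "v \<in> U" "v \<notin> D"
  shows "z v \<in> D" "adj v (z v)" "adj (z v) v" "z v \<in> U"
    "\<And>d. d \<in> D \<Longrightarrow> adj v d \<Longrightarrow> d = z v" "\<And>u. adj (z v) u \<Longrightarrow> u \<noteq> v \<Longrightarrow> adj v u"
proof -
  have v: "v \<in> V - D" using assms U by blast
  show "z v \<in> D" "adj v (z v)" "z v \<in> U" using z_in_D[OF v] adj_z[OF v] closed[OF assms] .
  then show "adj (z v) v" using adj_sym by blast
  show "d = z v" if "d \<in> D" "adj v d" for d using z_unique[OF v that] .
  show "adj v u" if "adj (z v) u" "u \<noteq> v" for u using D_dominated[OF _ assms(2) that] v by blast
qed

text \<open>The two edges joining \<open>p\<close> and \<open>q\<close> to the free vertices of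
  their blocks are disjoint. By domination, staying away from \<open>p\<close> and \<open>q\<close>
  already means staying away from these free vertices.\<close>

lemma two_blocks:
  assumes p: "p \<in> U" "p \<notin> D" and q: "q \<in> U" "q \<notin> D" and pq: "z p \<noteq> z q"
    and T: "T \<subseteq> U - D" "indep T" "\<And>t. t \<in> T \<Longrightarrow> t \<noteq> p \<and> t \<noteq> q \<and> \<not> adj p t \<and> \<not> adj q t"
  shows "card T \<le> k"
proof -
  have "2 + card T \<le> Suc (Suc k)"
  proof (rule admissible_boundD[OF bound])
    show "{p, z p, q, z q} \<subseteq> U" using p q z_facts by blast
    show "distinct [p, z p, q, z q]" using p q pq z_facts(1)[OF p] z_facts(1)[OF q] by auto
    show "adj p (z p)" "adj q (z q)" using z_facts p q by blast+
    fix t u assume t: "t \<in> T" and u: "u \<in> {p, z p, q, z q}"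
    have "t \<notin> D" using T(1) t by blast
    then have "t \<noteq> z p" "t \<noteq> z q" using z_facts(1) p q by metis+
    moreover have "\<not> adj (z p) t" "\<not> adj (z q) t"
      using T(3)[OF t] z_facts(6)[OF p] z_facts(6)[OF q] by blast+
    ultimately show "t \<noteq> u \<and> \<not> adj u t" using T(3)[OF t] u by blast
  qed (use T in simp_all)
  then show ?thesis by simp
qed

text \<open>An element of \<open>T\<close> provides the second block, which costs one.\<close>

lemma one_block:
  assumes T: "T \<subseteq> U - D" "indep T" "\<And>t. t \<in> T \<Longrightarrow> t \<noteq> y \<and> \<not> adj y t"
  shows "card T \<le> Suc k"
proof (cases "T = {}")
  case False
  then obtain t where t: "t \<in> T" by blast
  have tU: "t \<in> U" "t \<notin> D" using t T(1) by auto
  have "card (T - {t}) \<le> k"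
  proof (rule two_blocks[OF tU y])
    show "z t \<noteq> z y" using z_facts(3)[OF tU] z_facts(6)[OF y] T(3)[OF t] by metis
    show "indep (T - {t})" using T(2) by (auto simp: indep_def)
    show "u \<noteq> t \<and> u \<noteq> y \<and> \<not> adj t u \<and> \<not> adj y u" if "u \<in> T - {t}" for u
      using that T(3)[of u] T(2) t unfolding indep_def by blast
  qed (use T in blast)
  then show ?thesis using t by (simp add: card_Diff_singleton)
qed simp

text \<open>New edges join neighbours of \<open>y\<close> to neighbours of \<open>w\<close>.
  Removing the closed neighbourhood of a neighbour of \<open>y\<close> therefore deletes all
  neighbours of \<open>w\<close>, and with them every new edge. The neighbours of \<open>y\<close>
  are removed in two rounds, because a different pair of blocks is available in each.\<close>

lemma colon_outside_block:
  assumes w: "w \<in> U" "adj y w" "w \<noteq> z y" "\<not> adj (z y) w"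
  shows "reg_le TYPE('k::ab_group_add) (has_edge (colon_adj y w)) (U - {y} - {w}) (Suc (Suc k))"
proof -
  let ?Q = "colon_adj y w" and ?X = "U - {y} - {w}"
  have wD: "w \<notin> D" using w z_facts(5)[OF y] by blast
  have zw: "z y \<noteq> z w" using z_facts(3)[OF w(1) wD] w(4) by metis
  have Q_sym: "?Q b a" if "?Q a b" for a b using that adj_sym by (auto simp: colon_adj_def)
  have Q_irrefl: "\<not> ?Q a a" for a by (simp add: colon_adj_def)
  have Q_w: "?Q a t" if "adj y a" "adj w t" "t \<noteq> a" for a t using that by (auto simp: colon_adj_def)
  have Q_adj: "?Q a t" if "adj a t" for a t using that adj_irrefl by (auto simp: colon_adj_def)
  \<comment> \<open>For \<open>a\<close> in \<open>A1\<close> the blocks of \<open>a\<close> and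
    \<open>w\<close> differ, and what survives the removal avoids both \<open>a\<close> and
    \<open>w\<close>.\<close>
  define A1 where "A1 = {a \<in> ?X. adj y a \<and> a \<noteq> z y \<and> \<not> adj (z w) a}"
  \<comment> \<open>The remaining neighbours of \<open>y\<close>. Here the blocks of
    \<open>y\<close> and \<open>w\<close> are used: a surviving neighbour of \<open>y\<close>
    outside \<open>D\<close> would be adjacent to \<open>z w\<close>, hence to \<open>w\<close>, and
    those are gone.\<close>
  define A2 where "A2 = {a \<in> ?X - A1. adj y a}"
  \<comment> \<open>No surviving vertex is adjacent to \<open>w\<close>, so the colon graph agrees
    with the original one.\<close>
  have cong: "?Q p q \<longleftrightarrow> adj p q"
    if "adj y a" "p \<in> ?X - {u. u = a \<or> ?Q a u}" "q \<in> ?X - {u. u = a \<or> ?Q a u}" for a p q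
    using that Q_w[of a p] Q_w[of a q] adj_irrefl unfolding colon_adj_def[of y w p q] by blast
  show ?thesis
  proof (rule reg_le_has_edge_split[where Z = A1])
    fix a assume a: "a \<in> A1"
    then have a': "a \<in> U" "adj y a" "a \<noteq> z y" "\<not> adj (z w) a" by (auto simp: A1_def)
    have aD: "a \<notin> D" using a' z_facts(5)[OF y] by blast
    have za: "z a \<noteq> z w" using z_facts(3)[OF a'(1) aD] a'(4) by metis
    have "reg_le TYPE('k) (has_edge ?Q) (?X - {u. u = a \<or> ?Q a u}) (Suc k)"
    proof (rule reg_le_has_edge_cong)
      fix T assume T: "T \<subseteq> ?X - {u. u = a \<or> ?Q a u} - D" "indep T"
      show "card T \<le> k"
      proof (rule two_blocks[OF a'(1) aD w(1) wD za _ T(2)])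
        fix t assume "t \<in> T"
        then have "t \<noteq> a" "t \<noteq> w" "\<not> ?Q a t" using T(1) by blast+
        then show "t \<noteq> a \<and> t \<noteq> w \<and> \<not> adj a t \<and> \<not> adj w t"
          using Q_w[OF a'(2), of t] Q_adj by blast
      qed (use T in blast)
    qed ((use U in blast), (rule cong[OF a'(2)]; blast))
    then show "\<not> ?Q a a \<and> reg_le TYPE('k) (has_edge ?Q) (?X - {u. u = a \<or> ?Q a u}) (Suc k)"
      using Q_irrefl by blast
  next
    show "reg_le TYPE('k) (has_edge ?Q) (?X - A1) (Suc (Suc k))"
    proof (rule reg_le_has_edge_split[where Z = A2])
      fix a assume a: "a \<in> A2"
      then have a': "a \<in> U" "adj y a" by (auto simp: A2_def)
      have "reg_le TYPE('k) (has_edge ?Q) (?X - A1 - {u. u = a \<or> ?Q a u}) (Suc k)"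
      proof (rule reg_le_has_edge_cong)
        fix T assume T: "T \<subseteq> ?X - A1 - {u. u = a \<or> ?Q a u} - D" "indep T"
        show "card T \<le> k"
        proof (rule two_blocks[OF y w(1) wD zw _ T(2)])
          fix t assume t: "t \<in> T"
          then have t': "t \<in> ?X" "t \<notin> A1" "t \<noteq> a" "t \<noteq> w" "t \<noteq> y" "\<not> ?Q a t" "t \<notin> D" using T(1) by blast+
          have nw: "\<not> adj w t" using Q_w[OF a'(2), of t] t' by blast
          have "t \<noteq> z y" using t'(7) z_facts(1)[OF y] by blast
          then have "\<not> adj y t" using t' nw z_facts(6)[OF w(1) wD, of t] unfolding A1_def by blast
          then show "t \<noteq> y \<and> t \<noteq> w \<and> \<not> adj y t \<and> \<not> adj w t" using nw t' by blast
        qed (use T in blast)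
      qed ((use U in blast), (rule cong[OF a'(2)]; blast))
      then show "\<not> ?Q a a \<and> reg_le TYPE('k) (has_edge ?Q) (?X - A1 - {u. u = a \<or> ?Q a u}) (Suc k)"
        using Q_irrefl by blast
    next
      \<comment> \<open>With no neighbour of \<open>y\<close> left there are no new edges, and
        \<open>one_block\<close> applies.\<close>
      have no_nb: "\<not> adj y t" if "t \<in> ?X - A1 - A2" for t using that by (auto simp: A2_def)
      show "reg_le TYPE('k) (has_edge ?Q) (?X - A1 - A2) (Suc (Suc k))"
      proof (rule reg_le_has_edge_cong)
        fix T assume T: "T \<subseteq> ?X - A1 - A2 - D" "indep T"
        show "card T \<le> Suc k"
          by (rule one_block[OF _ T(2)]) (use T(1) no_nb in blast)+
      next
        fix p q assume "p \<in> ?X - A1 - A2" "q \<in> ?X - A1 - A2"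
        then show "?Q p q \<longleftrightarrow> adj p q"
          using no_nb[of p] no_nb[of q] adj_irrefl by (auto simp: colon_adj_def)
      qed (use U in blast)
    qed (erule Q_sym, (use U in blast), unfold A2_def, blast)
  qed (erule Q_sym, (use U in blast), unfold A1_def, blast)
qed

text \<open>Now \<open>y\<close> and \<open>w\<close> share a block, and the remaining neighbours of
  \<open>y\<close> lie in it. Only neighbours of \<open>w\<close> outside this block can create new
  edges, and removing the closed neighbourhood of such a vertex deletes all neighbours of
  \<open>y\<close>.\<close>

lemma colon_inside_block:
  assumes X: "X \<subseteq> U - {y}" and nb: "\<And>u. u \<in> X \<Longrightarrow> adj y u \<Longrightarrow> u = z y \<or> adj (z y) u"
    and w: "w \<in> X" "adj y w" "w \<noteq> z y"
  shows "reg_le TYPE('k::ab_group_add) (has_edge (colon_adj y w)) (X - {w}) (Suc (Suc k))"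
proof -
  let ?Q = "colon_adj y w" and ?X = "X - {w}"
  have wU: "w \<in> U" using w X by blast
  have wD: "w \<notin> D" using w z_facts(5)[OF y] by blast
  have xw: "adj (z y) w" using nb[OF w(1,2)] w(3) by blast
  note x = z_facts[OF y]
  have zw: "z w = z y" using z_facts(5)[OF wU wD x(1) adj_sym[OF xw]] by simp
  have Q_sym: "?Q b a" if "?Q a b" for a b using that adj_sym by (auto simp: colon_adj_def)
  have Q_irrefl: "\<not> ?Q a a" for a by (simp add: colon_adj_def)
  have Q_y: "?Q b t" if "adj w b" "adj y t" "t \<noteq> b" for b t using that by (auto simp: colon_adj_def)
  have Q_adj: "?Q a t" if "adj a t" for a t using that adj_irrefl by (auto simp: colon_adj_def)
  \<comment> \<open>A vertex of \<open>Z\<close> lies in a block other than that of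
    \<open>y\<close>, so these two blocks bound the independent sets that survive.\<close>
  define Z where "Z = {b \<in> ?X. adj w b \<and> \<not> adj y b}"
  show ?thesis
  proof (rule reg_le_has_edge_split[where Z = Z])
    fix b assume b: "b \<in> Z"
    then have b': "b \<in> U" "adj w b" "\<not> adj y b" "b \<noteq> y" using X by (auto simp: Z_def)
    have bD: "b \<notin> D" using z_facts(5)[OF wU wD _ b'(2)] zw b'(3) x(2) by metis
    have zb: "z y \<noteq> z b" using z_facts(3)[OF b'(1) bD] x(6)[of b] b' by metis
    have K_y: "\<not> adj y t" if "t \<in> ?X - {u. u = b \<or> ?Q b u}" for t
      using that Q_y[OF b'(2), of t] by blast
    have "reg_le TYPE('k) (has_edge ?Q) (?X - {u. u = b \<or> ?Q b u}) (Suc k)"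
    proof (rule reg_le_has_edge_cong)
      fix T assume T: "T \<subseteq> ?X - {u. u = b \<or> ?Q b u} - D" "indep T"
      show "card T \<le> k"
      proof (rule two_blocks[OF y b'(1) bD zb _ T(2)])
        fix t assume "t \<in> T"
        then have "t \<in> ?X - {u. u = b \<or> ?Q b u}" using T(1) by blast
        then show "t \<noteq> y \<and> t \<noteq> b \<and> \<not> adj y t \<and> \<not> adj b t"
          using K_y Q_adj X by blast
      qed (use T X in blast)
    next
      fix p q assume "p \<in> ?X - {u. u = b \<or> ?Q b u}" "q \<in> ?X - {u. u = b \<or> ?Q b u}"
      then show "?Q p q \<longleftrightarrow> adj p q"
        using K_y[of p] K_y[of q] adj_irrefl unfolding colon_adj_def[of y w p q] by blast
    qed (use U X in blast)
    then show "\<not> ?Q b b \<and> reg_le TYPE('k) (has_edge ?Q) (?X - {u. u = b \<or> ?Q b u}) (Suc k)"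
      using Q_irrefl by blast
  next
    have w_y: "adj y t" if "t \<in> ?X - Z" "adj w t" for t using that by (auto simp: Z_def)
    \<comment> \<open>After \<open>Z\<close> is gone, a new edge joins two neighbours of
      \<open>y\<close>. These form a clique, so the edge was already there.\<close>
    have clique: "adj p q" if "p \<in> X" "q \<in> X" "adj y p" "adj y q" "p \<noteq> q" for p q
      using nb[OF that(1,3)] nb[OF that(2,4)] that(5) D_clique[OF x(1)] adj_sym by blast
    show "reg_le TYPE('k) (has_edge ?Q) (?X - Z) (Suc (Suc k))"
    proof (rule reg_le_has_edge_cong)
      fix p q assume pq: "p \<in> ?X - Z" "q \<in> ?X - Z"
      then show "?Q p q \<longleftrightarrow> adj p q"
        using w_y[of p] w_y[of q] clique[of p q] adj_irrefl unfolding colon_adj_def by blast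
    next
      fix T assume T: "T \<subseteq> ?X - Z - D" "indep T"
      have TU: "T \<subseteq> U - D" using T X by blast
      show "card T \<le> Suc k"
      proof (cases "\<exists>a\<in>T. adj y a")
        case False
        show ?thesis by (rule one_block[OF TU T(2)]) (use T(1) X False in blast)
      next
        case True
        then obtain a where a: "a \<in> T" "adj y a" by blast
        have a': "a \<in> X" "a \<in> U" "a \<notin> D" "a \<noteq> w" "a \<noteq> y" "a \<noteq> z y" using a T(1) X x(1) by auto
        have xa: "adj (z y) a" using nb[OF a'(1) a(2)] a' by blast
        \<comment> \<open>The four vertices \<open>y\<close>, \<open>w\<close>, \<open>a\<close>,
          \<open>z y\<close> lie in a single block and carry two disjoint edges. This is the case in
          which the two special edges of an admissible matching come from the same clique.\<close>
        have "2 + card (T - {a}) \<le> Suc (Suc k)"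
        proof (rule admissible_boundD[OF bound])
          show "{y, w, a, z y} \<subseteq> U" using y wU a' x by blast
          show "distinct [y, w, a, z y]" using w(2,3) a' adj_irrefl x(1) y by auto
          show "adj y w" "adj a (z y)" using w xa adj_sym by blast+
          show "indep (T - {a})" using T(2) by (auto simp: indep_def)
          fix t u assume t: "t \<in> T - {a}" and u: "u \<in> {y, w, a, z y}"
          have t': "t \<in> ?X - Z" "t \<in> X" "t \<noteq> y" "t \<noteq> w" "t \<noteq> a" "t \<noteq> z y" using t T(1) X x(1) by auto
          have na: "\<not> adj a t" using t a T(2) by (auto simp: indep_def)
          have ny: "\<not> adj y t" using clique[OF a'(1) t'(2) a(2)] na t' by blast
          have nw: "\<not> adj w t" using w_y[OF t'(1)] ny by blast
          have nx: "\<not> adj (z y) t" using x(6)[of t] ny t' by blast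
          show "t \<noteq> u \<and> \<not> adj u t" using u t' na ny nw nx by blast
        qed (use TU in blast)
        then show ?thesis using a by (simp add: card_Diff_singleton)
      qed
    qed (use U X in blast)
  qed (erule Q_sym, (use U X in blast), unfold Z_def, blast)
qed

text \<open>With no neighbour of \<open>y\<close> left in \<open>X\<close>, the colon creates no
  edge.\<close>

lemma colon_free_vertex:
  assumes X: "X \<subseteq> U - {y}" and nb: "\<And>u. u \<in> X \<Longrightarrow> \<not> adj y u"
  shows "reg_le TYPE('k::ab_group_add) (has_edge (colon_adj y (z y))) X (Suc (Suc k))"
proof (rule reg_le_has_edge_cong)
  fix T assume T: "T \<subseteq> X - D" "indep T"
  show "card T \<le> Suc k"
    by (rule one_block[OF _ T(2)]) (use T(1) X nb in blast)+
next
  fix p q assume "p \<in> X" "q \<in> X"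
  then show "colon_adj y (z y) p q \<longleftrightarrow> adj p q"
    using nb[of p] nb[of q] adj_irrefl unfolding colon_adj_def by blast
qed (use X U in blast)

text \<open>Colons by the edges at \<open>y\<close> contribute \<open>k + 2\<close>, and deleting
  the corresponding neighbours costs one more. When all of them are gone, \<open>y\<close> is
  isolated and the problem without its closed neighbourhood remains.\<close>

lemma colon_vertex:
  assumes rest: "reg_le TYPE('k::ab_group_add) two_edges (U - {u. u = y \<or> adj y u}) (Suc (Suc (Suc k)))"
  shows "reg_le TYPE('k) (\<lambda>A. two_edges (insert y A)) (U - {y}) (Suc (Suc (Suc k)))"
proof -
  let ?L = "\<lambda>A. two_edges (insert y A)"
  have mono: "?L A \<Longrightarrow> ?L B" if "A \<subseteq> B" for A B
    by (rule two_edges_mono) (use that in auto)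
  have link: "reg_le TYPE('k) (\<lambda>A. ?L (insert w A)) (X - {w}) (Suc (Suc k))"
    if "reg_le TYPE('k) (has_edge (colon_adj y w)) (X - {w}) (Suc (Suc k))" "adj y w" "X \<subseteq> U - {y}" for X w
  proof -
    have "?L (insert w A) = has_edge (colon_adj y w) A" if "A \<subseteq> X - {w}" for A
      by (rule two_edges_insert_edge) (use \<open>adj y w\<close> \<open>X \<subseteq> U - {y}\<close> that in auto)
    then show ?thesis using that(1) reg_le_cong[of "X - {w}" "\<lambda>A. ?L (insert w A)"] by blast
  qed
  note x = z_facts[OF y]
  \<comment> \<open>The order is forced: the second stage needs the neighbours of \<open>y\<close>
    outside its block gone, and the free vertex needs all other neighbours gone.\<close>
  define Z1 where "Z1 = {w \<in> U - {y}. adj y w \<and> w \<noteq> z y \<and> \<not> adj (z y) w}"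
  define X1 where "X1 = U - {y} - Z1"
  define Z2 where "Z2 = {w \<in> X1. adj y w \<and> w \<noteq> z y}"
  define X2 where "X2 = X1 - Z2"
  have X1: "X1 \<subseteq> U - {y}" and X2: "X2 \<subseteq> U - {y}" by (auto simp: X1_def X2_def)
  have nb2: "\<not> adj y u" if "u \<in> X2 - {z y}" for u using that by (auto simp: X2_def Z2_def)
  have X2_eq: "X2 - {z y} = U - {u. u = y \<or> adj y u}"
    using x(2) unfolding X2_def Z2_def X1_def Z1_def by blast
  have "?L A = two_edges A" if "A \<subseteq> X2 - {z y}" for A
  proof
    assume "?L A"
    then show "two_edges A" unfolding two_edges_def
      using that nb2 adj_sym adj_irrefl by (elim bexE conjE) (blast intro: adj_sym)
  qed (rule two_edges_mono, auto)
  then have X2_rest: "reg_le TYPE('k) ?L (X2 - {z y}) (Suc (Suc (Suc k)))"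
    using rest reg_le_cong[of "X2 - {z y}" ?L two_edges] X2_eq by auto
  show ?thesis
  proof (rule reg_le_split_set[OF mono, where Z = Z1])
    show "U - {y} \<subseteq> V" using U by blast
    fix w assume "w \<in> Z1"
    then show "reg_le TYPE('k) (\<lambda>A. ?L (insert w A)) (U - {y} - {w}) (Suc (Suc k))"
      by (intro link colon_outside_block) (auto simp: Z1_def)
  next
    show "reg_le TYPE('k) ?L (U - {y} - Z1) (Suc (Suc (Suc k)))"
      unfolding X1_def[symmetric]
    proof (rule reg_le_split_set[OF mono, where Z = Z2])
      show "X1 \<subseteq> V" using X1 U by blast
      fix w assume w: "w \<in> Z2"
      show "reg_le TYPE('k) (\<lambda>A. ?L (insert w A)) (X1 - {w}) (Suc (Suc k))"
        by (intro link colon_inside_block X1) (use w in \<open>auto simp: Z2_def X1_def Z1_def\<close>)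
    next
      show "reg_le TYPE('k) ?L (X1 - Z2) (Suc (Suc (Suc k)))"
        unfolding X2_def[symmetric]
      proof (rule reg_le_split[OF mono])
        show "X2 \<subseteq> V" using X2 U by blast
        show "reg_le TYPE('k) ?L (X2 - {z y}) (Suc (Suc (Suc k)))" by (rule X2_rest)
        show "reg_le TYPE('k) (\<lambda>A. ?L (insert (z y) A)) (X2 - {z y}) (Suc (Suc k))"
          by (intro link colon_free_vertex X2 x(2)) (use X2 nb2 in auto)
      qed
    qed (auto simp: Z2_def)
  qed (auto simp: Z1_def)
qed

end

text \<open>Induction on \<open>U\<close>, removing a vertex \<open>y\<close> outside
  \<open>D\<close>. The deletion keeps the bound \<open>c\<close>; the colon has to have regularity
  at most \<open>c + 1\<close>, and without the closed neighbourhood of \<open>y\<close> the bound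
  becomes \<open>c - 1\<close>, which leaves exactly enough room.\<close>

lemma reg_le_two_edges:
  assumes "U \<subseteq> V" "\<And>v. v \<in> U \<Longrightarrow> v \<notin> D \<Longrightarrow> z v \<in> U" "admissible_bound U c"
  shows "reg_le TYPE('k::ab_group_add) two_edges U (Suc (Suc c))"
proof -
  have "finite U" using assms(1) finite_V finite_subset by blast
  then show ?thesis using assms
  proof (induction "card U" arbitrary: U c rule: less_induct)
    case less
    note U = less.prems(2) and closed = less.prems(3) and bound = less.prems(4)
    show ?case
    proof (cases "two_edges U")
      case False
      then show ?thesis using two_edges_mono by (intro reg_le_bot) blast
    next
      case True
      then obtain a b a' b' where e: "{a, b, a', b'} \<subseteq> U" "distinct [a, b, a', b']" "adj a b" "adj a' b'"
        unfolding two_edges_def by blast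
      have "2 + card ({}::'v set) \<le> c"
        by (rule admissible_boundD[OF bound e(1) _ e(2-4)]) (auto simp: indep_def)
      \<comment> \<open>The empty independent set already gives \<open>2 \<le> c\<close>.\<close>
      then obtain k where c: "c = Suc (Suc k)" by (metis add_2_eq_Suc add_leE le_Suc_ex card.empty add.right_neutral)
      \<comment> \<open>\<open>D\<close> is independent, so no edge lies inside it.\<close>
      obtain y where y: "y \<in> U" "y \<notin> D" using e D_indep by (metis insert_subset)
      have smaller: "card Y < card U" "finite Y" if "Y \<subseteq> U - {y}" for Y
        using that y less.prems(1) by (meson Diff_subset card_Diff1_less card_mono finite_Diff le_less_trans finite_subset)+
      have zy: "z v \<noteq> y" if "v \<in> U" "v \<notin> D" for v
        using z_in_D[of v] that U y by blast
      let ?R = "U - {u. u = y \<or> adj y u}"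
      have R: "reg_le TYPE('k) two_edges ?R (Suc (Suc (Suc k)))"
      proof (rule less.hyps)
        show "card ?R < card U" "finite ?R" by (rule smaller; blast)+
        show "?R \<subseteq> V" using U by blast
        show "z v \<in> ?R" if v: "v \<in> ?R" "v \<notin> D" for v
        proof -
          have vU: "v \<in> U" "v \<in> V" "v \<noteq> y" "\<not> adj y v" using v U by auto
          have yV: "y \<in> V - D" using y U by blast
          \<comment> \<open>Otherwise \<open>y\<close> and \<open>v\<close> have the same free
            vertex, and by domination \<open>v\<close> would be a neighbour of
            \<open>y\<close>.\<close>
          have "\<not> adj y (z v)"
          proof
            assume "adj y (z v)"
            then have "z v = z y" using z_unique[OF yV] z_in_D[of v] vU v by blast
            then have "adj (z y) v" using adj_sym[OF adj_z[of v]] vU v by auto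
            then show False using D_dominated[of y v] yV vU by blast
          qed
          then show ?thesis using closed[OF vU(1) v(2)] zy[OF vU(1) v(2)] by blast
        qed
        show "admissible_bound ?R (Suc k)"
          unfolding admissible_bound_def
        proof (intro ballI allI impI, elim conjE)
          fix a b a' b' T
          assume S: "a \<in> ?R" "b \<in> ?R" "a' \<in> ?R" "b' \<in> ?R" "T \<subseteq> ?R - D" "distinct [a, b, a', b']"
            "adj a b" "adj a' b'" "indep T" "T \<inter> closed_nbhd {a, b, a', b'} = {}"
          have finT: "finite T" by (rule finite_subset[OF _ less.prems(1)]) (use S(5) in blast)
          have ny: "y \<notin> T" using S(5) by blast
          \<comment> \<open>No remaining vertex is adjacent to \<open>y\<close>, so \<open>y\<close>
            enlarges \<open>T\<close>. This is where the bound drops by one.\<close>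
          have "2 + card (insert y T) \<le> c"
          proof (rule admissible_boundD[OF bound, of a b a' b'])
            show "indep (insert y T)"
              using S(5,9) adj_irrefl adj_sym unfolding indep_def by blast
            fix t u assume t: "t \<in> insert y T" and u: "u \<in> {a, b, a', b'}"
            have uR: "u \<in> ?R" using u S by blast
            show "t \<noteq> u \<and> \<not> adj u t"
            proof (cases "t = y")
              case True
              then show ?thesis using uR adj_sym by blast
            next
              case False
              then have "t \<in> T" using t by blast
              then have "t \<notin> closed_nbhd {a, b, a', b'}" using S(10) by blast
              then show ?thesis using u unfolding closed_nbhd_def by blast
            qed
          qed (use S y in auto)
          then show "2 + card T \<le> Suc k" using finT ny by (simp add: c)
        qed
      qed
      show ?thesis
      proof (rule reg_le_split[OF two_edges_mono U])
        show "reg_le TYPE('k) two_edges (U - {y}) (Suc (Suc c))"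
        proof (rule less.hyps)
          show "card (U - {y}) < card U" "finite (U - {y})" by (rule smaller; blast)+
          show "U - {y} \<subseteq> V" using U by blast
          show "z v \<in> U - {y}" if "v \<in> U - {y}" "v \<notin> D" for v
            using that closed zy by blast
          show "admissible_bound (U - {y}) c"
            using bound unfolding admissible_bound_def by blast
        qed
        show "reg_le TYPE('k) (\<lambda>A. two_edges (insert y A)) (U - {y}) (Suc c)"
          unfolding c by (rule colon_vertex[OF U closed bound[unfolded c] y R])
      qed
    qed
  qed
qed

end

section \<open>Betti numbers and Koszul homology\<close>


definition vec_mult :: "('v, 'k::field) mpoly \<Rightarrow> (nat \<Rightarrow> ('v, 'k) mpoly) \<Rightarrow> nat \<Rightarrow> ('v, 'k) mpoly" where
  "vec_mult p w r = p * w r"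

definition lin_comb ::
  "nat \<Rightarrow> (nat \<Rightarrow> nat \<Rightarrow> ('v, 'k::field) mpoly) \<Rightarrow> (nat \<Rightarrow> ('v, 'k) mpoly) \<Rightarrow> nat \<Rightarrow> ('v, 'k) mpoly" where
  "lin_comb n g w r = (\<Sum>c<n. g c r * w c)"

definition direct_sum :: "nat \<Rightarrow> (nat \<Rightarrow> int \<Rightarrow> 'a::zero set) \<Rightarrow> int \<Rightarrow> (nat \<Rightarrow> 'a) set" where
  "direct_sum n N e = {w. \<forall>r. if r < n then w r \<in> N r e else w r = 0}"

abbreviation homogeneous :: "'v set \<Rightarrow> int \<Rightarrow> ('v, 'k::field) mpoly set" where
  "homogeneous V \<equiv> monomial_ideal V (\<lambda>_. True)"

text \<open>The basis vector \<open>r\<close> has degree \<open>d r\<close>, hence the shift in the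
  degree of its coordinate.\<close>

definition free_graded :: "'v set \<Rightarrow> nat \<Rightarrow> (nat \<Rightarrow> nat) \<Rightarrow> int \<Rightarrow> (nat \<Rightarrow> ('v, 'k::field) mpoly) set" where
  "free_graded V n d = direct_sum n (\<lambda>r e. homogeneous V (e - int (d r)))"

lemma direct_sum_in: "w \<in> direct_sum n N e \<Longrightarrow> r < n \<Longrightarrow> w r \<in> N r e"
  unfolding direct_sum_def by (auto dest: spec[of _ r])

lemma direct_sum_out: "w \<in> direct_sum n N e \<Longrightarrow> \<not> r < n \<Longrightarrow> w r = 0"
  unfolding direct_sum_def by (auto dest: spec[of _ r])

lemma direct_sumI: "(\<And>r. r < n \<Longrightarrow> w r \<in> N r e) \<Longrightarrow> (\<And>r. \<not> r < n \<Longrightarrow> w r = 0) \<Longrightarrow> w \<in> direct_sum n N e"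
  by (auto simp: direct_sum_def)

lemma operators_vec_mult: "operators (\<lambda>v. vec_mult (var v :: ('v, 'k::field) mpoly))"
  by (auto simp: operators_def vec_mult_def fun_eq_iff algebra_simps)

lemma lin_comb_add: "lin_comb n g (w + w') = lin_comb n g w + lin_comb n g w'"
  by (auto simp: lin_comb_def fun_eq_iff algebra_simps sum.distrib)

lemma lin_comb_vec_mult: "lin_comb n g (vec_mult p w) = vec_mult p (lin_comb n g w)"
  by (auto simp: lin_comb_def vec_mult_def fun_eq_iff sum_distrib_left algebra_simps)

lemma homogeneous_lookup_0: "p \<in> homogeneous V e \<Longrightarrow> e \<noteq> 0 \<Longrightarrow> Poly_Mapping.lookup p 0 = 0"
  using monomial_idealD[of p V "\<lambda>_. True" e 0] by auto

lemma one_homogeneous: "1 \<in> homogeneous V 0"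
  by (rule monomial_idealI) (auto simp: lookup_one when_def split: if_splits)

context koszul_signs begin

lemma submodule_direct_sum:
  assumes "\<And>r. r < n \<Longrightarrow> submodule_by (\<lambda>v (p::('v, 'k::field) mpoly). var v * p) (N r)"
  shows "submodule_by (\<lambda>v. vec_mult (var v)) (direct_sum n N)"
  unfolding submodule_by_def
proof (intro allI conjI ballI)
  fix e
  show "0 \<in> direct_sum n N e"
    by (rule direct_sumI) (auto intro: submodule_byD(1)[OF assms])
  show "a - b \<in> direct_sum n N e" if "a \<in> direct_sum n N e" "b \<in> direct_sum n N e" for a b
    by (rule direct_sumI)
      (use that in \<open>auto simp: direct_sum_out intro: submodule_byD(2)[OF assms] direct_sum_in\<close>)
  show "vec_mult (var v) a \<in> direct_sum n N e" if "v \<in> V" "a \<in> direct_sum n N (e - 1)" for v a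
    by (rule direct_sumI)
      (use that in \<open>auto simp: vec_mult_def direct_sum_out intro: submodule_byD(5)[OF assms] direct_sum_in\<close>)
qed

lemma submodule_free_graded: "submodule_by (\<lambda>v. vec_mult (var v :: ('v, 'k::field) mpoly)) (free_graded V n d)"
  unfolding free_graded_def
proof (rule submodule_direct_sum)
  fix r
  have "submodule_by (\<lambda>v (p::('v, 'k) mpoly). var v * p) (homogeneous V)"
    by (rule submodule_monomial_ideal) simp
  note H = submodule_byD[OF this]
  show "submodule_by (\<lambda>v (p::('v, 'k) mpoly). var v * p) (\<lambda>e. homogeneous V (e - int (d r)))"
    unfolding submodule_by_def
  proof (intro allI conjI ballI)
    fix e v and a :: "('v, 'k) mpoly"
    assume "v \<in> V" "a \<in> homogeneous V (e - 1 - int (d r))"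
    then show "var v * a \<in> homogeneous V (e - int (d r))"
      by (intro H(5)) (simp_all add: algebra_simps)
  qed (auto intro: H)
qed

lemma bd_component:
  "bd (\<lambda>v. vec_mult (var v :: ('v, 'k::field) mpoly)) V c \<rho> r = bd (\<lambda>v p. var v * p) V (\<lambda>\<tau>. c \<tau> r) \<rho>"
  by (rule bd_hom[symmetric, of "\<lambda>w. w r"]) (auto simp: vec_mult_def)

lemma boundary_from_components:
  fixes c :: "'v set \<Rightarrow> nat \<Rightarrow> ('v, 'k::field) mpoly"
  assumes c: "c \<in> koszul_chains V i (\<lambda>_. direct_sum n N e)"
    and comp: "\<And>r. r < n \<Longrightarrow> (\<lambda>\<tau>. c \<tau> r) \<in> koszul_chains V i (\<lambda>_. N r e) \<Longrightarrow>
      \<exists>b\<in>koszul_chains V (Suc i) (\<lambda>_. N r (e - 1)). bd (\<lambda>v p. var v * p) V b = (\<lambda>\<tau>. c \<tau> r)"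
  shows "\<exists>b\<in>koszul_chains V (Suc i) (\<lambda>_. direct_sum n N (e - 1)). bd (\<lambda>v. vec_mult (var v)) V b = c"
proof -
  have "(\<lambda>\<tau>. c \<tau> r) \<in> koszul_chains V i (\<lambda>_. N r e)" if "r < n" for r
  proof (rule chainsI)
    show "c \<tau> r \<in> N r e" if "\<tau> \<subseteq> V" "card \<tau> = i" for \<tau>
      by (rule direct_sum_in[OF chains_in[OF c that] \<open>r < n\<close>])
    show "c \<tau> r = 0" if "\<not> (\<tau> \<subseteq> V \<and> card \<tau> = i)" for \<tau>
      using chains_out[OF c that] by simp
  qed
  then have "\<forall>r. \<exists>b. r < n \<longrightarrow> b \<in> koszul_chains V (Suc i) (\<lambda>_. N r (e - 1)) \<and>
      bd (\<lambda>v p. var v * p) V b = (\<lambda>\<tau>. c \<tau> r)"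
    using comp by blast
  then obtain B where B: "\<And>r. r < n \<Longrightarrow> B r \<in> koszul_chains V (Suc i) (\<lambda>_. N r (e - 1))"
      "\<And>r. r < n \<Longrightarrow> bd (\<lambda>v p. var v * p) V (B r) = (\<lambda>\<tau>. c \<tau> r)"
    by metis
  define b where "b \<tau> r = (if r < n then B r \<tau> else 0)" for \<tau> r
  have "b \<in> koszul_chains V (Suc i) (\<lambda>_. direct_sum n N (e - 1))"
  proof (rule chainsI)
    fix \<tau> assume \<tau>: "\<tau> \<subseteq> V" "card \<tau> = Suc i"
    show "b \<tau> \<in> direct_sum n N (e - 1)"
      by (rule direct_sumI) (auto simp: b_def intro: chains_in[OF B(1) \<tau>])
  next
    fix \<tau> assume \<tau>: "\<not> (\<tau> \<subseteq> V \<and> card \<tau> = Suc i)"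
    have "B r \<tau> = 0" if "r < n" for r using chains_out[OF B(1)[OF that] \<tau>] .
    then show "b \<tau> = 0" by (simp add: b_def fun_eq_iff)
  qed
  moreover have "bd (\<lambda>v. vec_mult (var v)) V b \<rho> r = c \<rho> r" for \<rho> r
  proof (cases "r < n")
    case True
    then show ?thesis using B(2)[OF True] by (simp add: bd_component b_def)
  next
    case False
    have "c \<rho> r = 0"
    proof (cases "\<rho> \<subseteq> V \<and> card \<rho> = i")
      case True
      then show ?thesis using direct_sum_out[OF chains_in[OF c] False] by blast
    next
      case False
      then show ?thesis using chains_out[OF c False] by simp
    qed
    then show ?thesis using False by (simp add: bd_component b_def bd_zero[OF operators_var])
  qed
  ultimately show ?thesis by (auto simp: fun_eq_iff)
qed

lemma koszul_exact_direct_sum: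
  assumes "\<And>r. r < n \<Longrightarrow> koszul_exact (\<lambda>v (p::('v, 'k::field) mpoly). var v * p) (N r) i e"
  shows "koszul_exact (\<lambda>v. vec_mult (var v)) (direct_sum n N) i e"
  unfolding koszul_exact_def
proof (intro ballI impI)
  fix c :: "'v set \<Rightarrow> nat \<Rightarrow> ('v, 'k) mpoly"
  assume c: "c \<in> koszul_chains V i (\<lambda>_. direct_sum n N e)"
    and cycle: "bd (\<lambda>v. vec_mult (var v)) V c = (\<lambda>_. 0)"
  have cyc: "bd (\<lambda>v p. var v * p) V (\<lambda>\<tau>. c \<tau> r) = (\<lambda>_. 0)" for r
    using cycle by (auto simp: bd_component[symmetric] fun_eq_iff)
  show "\<exists>b\<in>koszul_chains V (Suc i) (\<lambda>_. direct_sum n N (e - 1)). bd (\<lambda>v. vec_mult (var v)) V b = c"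
    by (rule boundary_from_components[OF c]) (use koszul_exactD[OF assms _ cyc] in blast)
qed

lemma koszul_exact_direct_sum_1:
  fixes N :: "int \<Rightarrow> ('v, 'k::field) mpoly set"
  shows "koszul_exact (\<lambda>v. vec_mult (var v)) (direct_sum (Suc 0) (\<lambda>_. N)) i e
    \<longleftrightarrow> koszul_exact (\<lambda>v p. var v * p) N i e"
proof
  assume exact: "koszul_exact (\<lambda>v. vec_mult (var v)) (direct_sum (Suc 0) (\<lambda>_. N)) i e"
  show "koszul_exact (\<lambda>v p. var v * p) N i e"
    unfolding koszul_exact_def
  proof (intro ballI impI)
    fix c :: "'v set \<Rightarrow> ('v, 'k) mpoly"
    assume c: "c \<in> koszul_chains V i (\<lambda>_. N e)" and cycle: "bd (\<lambda>v p. var v * p) V c = (\<lambda>_. 0)"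
    define C where "C \<tau> r = (if r = (0::nat) then c \<tau> else 0)" for \<tau> r
    have "C \<in> koszul_chains V i (\<lambda>_. direct_sum (Suc 0) (\<lambda>_. N) e)"
    proof (rule chainsI)
      fix \<tau> assume "\<tau> \<subseteq> V" "card \<tau> = i"
      then show "C \<tau> \<in> direct_sum (Suc 0) (\<lambda>_. N) e"
        by (intro direct_sumI) (auto simp: C_def intro: chains_in[OF c])
    qed (auto simp: C_def fun_eq_iff chains_out[OF c])
    moreover have "bd (\<lambda>v. vec_mult (var v)) V C \<rho> r = 0" for \<rho> r
      using cycle by (cases "r = 0") (simp_all add: bd_component C_def bd_zero[OF operators_var])
    ultimately obtain b where b: "b \<in> koszul_chains V (Suc i) (\<lambda>_. direct_sum (Suc 0) (\<lambda>_. N) (e - 1))"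
        "bd (\<lambda>v. vec_mult (var v)) V b = C"
      using koszul_exactD[OF exact, of C] by (auto simp: fun_eq_iff)
    show "\<exists>b\<in>koszul_chains V (Suc i) (\<lambda>_. N (e - 1)). bd (\<lambda>v p. var v * p) V b = c"
    proof
      show "(\<lambda>\<tau>. b \<tau> 0) \<in> koszul_chains V (Suc i) (\<lambda>_. N (e - 1))"
        by (rule chainsI) (use direct_sum_in[OF chains_in[OF b(1)]] chains_out[OF b(1)] in auto)
      show "bd (\<lambda>v p. var v * p) V (\<lambda>\<tau>. b \<tau> 0) = c"
        using b(2) by (auto simp: bd_component[symmetric] C_def fun_eq_iff)
    qed
  qed
qed (rule koszul_exact_direct_sum)

lemma koszul_exact_shift:
  "koszul_exact X (\<lambda>e. N (e + a)) i e \<longleftrightarrow> koszul_exact X N i (e + a)"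
  by (simp add: koszul_exact_def algebra_simps)

lemma koszul_exact_free:
  "koszul_exact (\<lambda>v. vec_mult (var v :: ('v, 'k::field) mpoly)) (free_graded V n d) (Suc i) e"
  unfolding free_graded_def
proof (rule koszul_exact_direct_sum)
  fix r
  show "koszul_exact (\<lambda>v (p::('v, 'k) mpoly). var v * p) (\<lambda>e. homogeneous V (e - int (d r))) (Suc i) e"
    using koszul_exact_shift[of "\<lambda>v (p::('v, 'k) mpoly). var v * p" "homogeneous V" "- int (d r)" "Suc i" e]
      koszul_exact_poly_ring by simp
qed

lemma free_without_constants_boundary:
  fixes c :: "'v set \<Rightarrow> nat \<Rightarrow> ('v, 'k::field) mpoly"
  assumes c: "c \<in> koszul_chains V 0 (\<lambda>_. free_graded V n d e)"
    and const: "\<And>r. Poly_Mapping.lookup (c {} r) 0 = 0"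
  shows "\<exists>b\<in>koszul_chains V 1 (\<lambda>_. free_graded V n d (e - 1)). bd (\<lambda>v. vec_mult (var v)) V b = c"
  using c unfolding free_graded_def One_nat_def
proof (rule boundary_from_components)
  fix r assume "(\<lambda>\<tau>. c \<tau> r) \<in> koszul_chains V 0 (\<lambda>_. homogeneous V (e - int (d r)))"
  from poly_without_constant_boundary[OF this const]
  show "\<exists>b\<in>koszul_chains V (Suc 0) (\<lambda>_. homogeneous V (e - 1 - int (d r))). bd (\<lambda>v p. var v * p) V b = (\<lambda>\<tau>. c \<tau> r)"
    by (simp add: algebra_simps)
qed

text \<open>A resolution cut into short exact sequences, with \<open>N i\<close> the image of the
  \<open>i\<close>-th free module and \<open>N (Suc i)\<close> its syzygies. Minimality appears as
  the absence of constant terms in syzygies.\<close>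

context
  fixes n :: "nat \<Rightarrow> nat" and d :: "nat \<Rightarrow> nat \<Rightarrow> nat" and g :: "nat \<Rightarrow> nat \<Rightarrow> nat \<Rightarrow> ('v, 'k::field) mpoly"
    and N :: "nat \<Rightarrow> int \<Rightarrow> (nat \<Rightarrow> ('v, 'k) mpoly) set"
  assumes surj: "\<And>i e. lin_comb (n i) (g i) ` free_graded V (n i) (d i) e = N i e"
    and kernel: "\<And>i e. N (Suc i) e = {w \<in> free_graded V (n i) (d i) e. lin_comb (n i) (g i) w = 0}"
    and minimal: "\<And>i e w r. w \<in> N (Suc i) e \<Longrightarrow> Poly_Mapping.lookup (w r) 0 = 0"
begin

text \<open>Both directions of dimension shifting. Minimality supplies the missing case of
  homological degree 0, where the free module is not acyclic.\<close>

lemma syzygy_shift: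
  "koszul_exact (\<lambda>v. vec_mult (var v)) (N j) (Suc i) e \<longleftrightarrow> koszul_exact (\<lambda>v. vec_mult (var v)) (N (Suc j)) i (e + 1)"
proof
  show "koszul_exact (\<lambda>v. vec_mult (var v)) (N j) (Suc i) e"
    if "koszul_exact (\<lambda>v. vec_mult (var v)) (N (Suc j)) i (e + 1)"
    by (rule exact_of_exact_kernel[OF operators_vec_mult operators_vec_mult submodule_free_graded
        lin_comb_add lin_comb_vec_mult surj kernel koszul_exact_free that])
  show "koszul_exact (\<lambda>v. vec_mult (var v)) (N (Suc j)) i (e + 1)"
    if "koszul_exact (\<lambda>v. vec_mult (var v)) (N j) (Suc i) e"
  proof (rule exact_kernel_of_exact[OF operators_vec_mult operators_vec_mult submodule_free_graded
        lin_comb_add lin_comb_vec_mult surj kernel koszul_exact_free that])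
    fix c assume c: "c \<in> koszul_chains V 0 (\<lambda>_. N (Suc j) (e + 1))"
    have "c {} \<in> N (Suc j) (e + 1)" by (rule chains_in[OF c]) auto
    moreover have "c \<in> koszul_chains V 0 (\<lambda>_. free_graded V (n j) (d j) (e + 1))"
      by (rule chainsI) (use chains_in[OF c] chains_out[OF c] kernel in auto)
    ultimately show "\<exists>f\<in>koszul_chains V 1 (\<lambda>_. free_graded V (n j) (d j) e). bd (\<lambda>v. vec_mult (var v)) V f = c"
      using free_without_constants_boundary[of c "n j" "d j" "e + 1"] minimal by simp
  qed
qed

text \<open>Graded Nakayama: homology in degree 0 is the module modulo the variables, and a minimal
  generator cannot vanish there.\<close>

lemma syzygy_generators:
  "koszul_exact (\<lambda>v. vec_mult (var v)) (N i) 0 e \<longleftrightarrow> \<not> (\<exists>c<n i. int (d i c) = e)"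
proof
  assume none: "\<not> (\<exists>c<n i. int (d i c) = e)"
  show "koszul_exact (\<lambda>v. vec_mult (var v)) (N i) 0 e"
    unfolding koszul_exact_def
  proof (intro ballI impI)
    fix c assume c: "c \<in> koszul_chains V 0 (\<lambda>_. N i e)"
    obtain f where f: "f \<in> koszul_chains V 0 (\<lambda>_. free_graded V (n i) (d i) e)"
        "c = (\<lambda>\<tau>. lin_comb (n i) (g i) (f \<tau>))"
      by (rule lift_chain[OF operators_vec_mult operators_vec_mult submodule_free_graded
        lin_comb_add lin_comb_vec_mult surj kernel koszul_exact_free c])
    have f0: "f {} \<in> free_graded V (n i) (d i) e" by (rule chains_in[OF f(1)]) auto
    have "Poly_Mapping.lookup (f {} r) 0 = 0" for r
    proof (cases "r < n i")
      case True
      then show ?thesis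
        using homogeneous_lookup_0[OF direct_sum_in[OF f0[unfolded free_graded_def] True]] none by force
    next
      case False
      then show ?thesis using direct_sum_out[OF f0[unfolded free_graded_def]] by simp
    qed
    then obtain b where b: "b \<in> koszul_chains V 1 (\<lambda>_. free_graded V (n i) (d i) (e - 1))"
        "bd (\<lambda>v. vec_mult (var v)) V b = f"
      using free_without_constants_boundary[OF f(1)] by blast
    show "\<exists>b\<in>koszul_chains V (Suc 0) (\<lambda>_. N i (e - 1)). bd (\<lambda>v. vec_mult (var v)) V b = c"
    proof
      show "(\<lambda>\<tau>. lin_comb (n i) (g i) (b \<tau>)) \<in> koszul_chains V (Suc 0) (\<lambda>_. N i (e - 1))"
        using map_chain[OF operators_vec_mult operators_vec_mult submodule_free_graded
          lin_comb_add lin_comb_vec_mult surj kernel koszul_exact_free] b(1) by simp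
      show "bd (\<lambda>v. vec_mult (var v)) V (\<lambda>\<tau>. lin_comb (n i) (g i) (b \<tau>)) = c"
        unfolding f(2) b(2)[symmetric]
        by (rule ext, rule bd_hom[of "lin_comb (n i) (g i)"]) (simp_all only: lin_comb_add lin_comb_vec_mult)
    qed
  qed
next
  assume exact: "koszul_exact (\<lambda>v. vec_mult (var v)) (N i) 0 e"
  show "\<not> (\<exists>c<n i. int (d i c) = e)"
  proof
    assume "\<exists>c<n i. int (d i c) = e"
    then obtain a where a: "a < n i" "int (d i a) = e" by blast
    define w :: "nat \<Rightarrow> ('v, 'k) mpoly" where "w r = (if r = a then 1 else 0)" for r
    have w: "w \<in> free_graded V (n i) (d i) e"
      unfolding free_graded_def
      by (rule direct_sumI)
        (use a one_homogeneous in \<open>auto simp: w_def monomial_ideal_def\<close>)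
    define C where "C \<tau> = (if \<tau> = {} then lin_comb (n i) (g i) w else 0)" for \<tau> :: "'v set"
    have finV: "finite \<tau>" if "\<tau> \<subseteq> V" for \<tau> using that finite_V finite_subset by blast
    have "C \<in> koszul_chains V 0 (\<lambda>_. N i e)"
    proof (rule chainsI)
      fix \<tau> assume "\<tau> \<subseteq> V" "card \<tau> = 0"
      then have "\<tau> = {}" using finV by auto
      then show "C \<tau> \<in> N i e" using surj w by (auto simp: C_def)
    qed (auto simp: C_def)
    moreover have "bd (\<lambda>v. vec_mult (var v)) V C = (\<lambda>_. 0)"
      by (rule ext) (simp add: bd_def C_def operators_0[OF operators_vec_mult])
    ultimately obtain b where b: "b \<in> koszul_chains V (Suc 0) (\<lambda>_. N i (e - 1))" "bd (\<lambda>v. vec_mult (var v)) V b = C"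
      using koszul_exactD[OF exact] by blast
    obtain f where f: "f \<in> koszul_chains V (Suc 0) (\<lambda>_. free_graded V (n i) (d i) (e - 1))"
        "b = (\<lambda>\<tau>. lin_comb (n i) (g i) (f \<tau>))"
      by (rule lift_chain[OF operators_vec_mult operators_vec_mult submodule_free_graded
        lin_comb_add lin_comb_vec_mult surj kernel koszul_exact_free b(1)])
    let ?u = "bd (\<lambda>v. vec_mult (var v)) V f {}"
    have u: "?u \<in> free_graded V (n i) (d i) e"
      by (rule chains_in[OF bd_chains[OF submodule_free_graded operators_vec_mult f(1)]]) auto
    have "lin_comb (n i) (g i) ?u = bd (\<lambda>v. vec_mult (var v)) V b {}"
      unfolding f(2) by (rule bd_hom[symmetric, of "lin_comb (n i) (g i)"]) (simp_all only: lin_comb_add lin_comb_vec_mult)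
    also have "\<dots> = lin_comb (n i) (g i) w" by (simp add: b(2) C_def)
    finally have eq: "lin_comb (n i) (g i) ?u = lin_comb (n i) (g i) w" .
    \<comment> \<open>\<open>?u\<close> is a combination of multiples of variables and has no
      constant terms, so \<open>w - ?u\<close> is a syzygy with constant term 1 at \<open>a\<close>,
      against minimality.\<close>
    have "lin_comb (n i) (g i) (w - ?u) = 0"
      using lin_comb_add[of "n i" "g i" "w - ?u" ?u] eq by simp
    moreover have "w - ?u \<in> free_graded V (n i) (d i) e"
      by (rule submodule_byD(2)[OF submodule_free_graded w u])
    ultimately have "w - ?u \<in> N (Suc i) e" by (simp add: kernel)
    then have "Poly_Mapping.lookup ((w - ?u) a) 0 = 0" by (rule minimal)
    moreover have "Poly_Mapping.lookup (?u a) 0 = 0"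
      unfolding bd_component by (simp add: bd_def lookup_sum lookup_sgn_act lookup_var_mult)
    ultimately show False by (simp add: w_def lookup_minus)
  qed
qed

text \<open>Each of the \<open>i\<close> shifts trades one homological degree for one step along the
  resolution and raises \<open>e\<close> by one.\<close>

lemma betti_iff_koszul:
  "(\<exists>c<n i. int (d i c) = e + int i) \<longleftrightarrow> \<not> koszul_exact (\<lambda>v. vec_mult (var v)) (N 0) i e"
proof -
  have "koszul_exact (\<lambda>v. vec_mult (var v)) (N j) i e \<longleftrightarrow> koszul_exact (\<lambda>v. vec_mult (var v)) (N (j + i)) 0 (e + int i)" for j e
    by (induction i arbitrary: j e) (simp_all add: syzygy_shift algebra_simps)
  from this[of 0 e] show ?thesis by (simp add: syzygy_generators)
qed

end

end

section \<open>Existence of minimal resolutions\<close>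


lemma sum_apply: "(sum f A) x = (\<Sum>a\<in>A. f a x)"
  by (induction A rule: infinite_finite_induct) auto

lemma lookup_mult_keys:
  assumes "Poly_Mapping.lookup (p * q) m \<noteq> 0"
  obtains a b where "m = a + b" "Poly_Mapping.lookup p a \<noteq> 0" "Poly_Mapping.lookup q b \<noteq> 0"
  using assms keys_mult[of p q] by (auto simp: in_keys_iff[symmetric])

lemma lookup_mult_0:
  fixes p q :: "('v, 'k::field) mpoly"
  assumes "Poly_Mapping.lookup p 0 = 0 \<or> Poly_Mapping.lookup q 0 = 0"
  shows "Poly_Mapping.lookup (p * q) 0 = 0"
proof (rule ccontr)
  assume "Poly_Mapping.lookup (p * q) 0 \<noteq> 0"
  then obtain a b where ab: "0 = a + b" "Poly_Mapping.lookup p a \<noteq> 0" "Poly_Mapping.lookup q b \<noteq> 0"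
    by (rule lookup_mult_keys)
  have "mon_deg a = 0" "mon_deg b = 0"
    using arg_cong[OF ab(1), of mon_deg] by (simp_all add: mon_deg_add)
  then show False using ab assms by simp
qed

lemma monomial_ideal_mult:
  assumes mono: "\<And>A B. A \<subseteq> B \<Longrightarrow> F A \<Longrightarrow> F B"
    and p: "p \<in> homogeneous V a" and q: "q \<in> monomial_ideal V F b"
  shows "p * q \<in> monomial_ideal V F (a + b)"
proof (rule monomial_idealI)
  fix m assume "Poly_Mapping.lookup (p * q) m \<noteq> 0"
  then obtain m1 m2 where m: "m = m1 + m2" "Poly_Mapping.lookup p m1 \<noteq> 0" "Poly_Mapping.lookup q m2 \<noteq> 0"
    by (rule lookup_mult_keys)
  then show "Poly_Mapping.keys m \<subseteq> V \<and> int (mon_deg m) = a + b \<and> F (Poly_Mapping.keys m)"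
    using monomial_idealD[OF p m(2)] monomial_idealD[OF q m(3)]
      mono[of "Poly_Mapping.keys m2" "Poly_Mapping.keys m"]
    by (auto simp: keys_add_nat mon_deg_add)
qed

lemmas homogeneous_mult = monomial_ideal_mult[where F = "\<lambda>_. True", simplified]

lemma monomial_ideal_add:
  assumes "p \<in> monomial_ideal V F e" "q \<in> monomial_ideal V F e"
  shows "p + q \<in> monomial_ideal V F e"
proof (rule monomial_idealI)
  fix m assume "Poly_Mapping.lookup (p + q) m \<noteq> 0"
  then have "Poly_Mapping.lookup p m \<noteq> 0 \<or> Poly_Mapping.lookup q m \<noteq> 0" by (auto simp: lookup_add)
  then show "Poly_Mapping.keys m \<subseteq> V \<and> int (mon_deg m) = e \<and> F (Poly_Mapping.keys m)"
    using monomial_idealD[OF assms(1)] monomial_idealD[OF assms(2)] by blast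
qed

lemma monomial_ideal_0: "0 \<in> monomial_ideal V F e"
  by (rule monomial_idealI) simp

lemma constant_homogeneous: "Poly_Mapping.single 0 a \<in> homogeneous V 0"
  by (rule monomial_idealI) (auto simp: lookup_single when_def split: if_splits)

lemma var_homogeneous: "v \<in> V \<Longrightarrow> var v \<in> homogeneous V 1"
  by (rule monomial_idealI) (auto simp: var_def lookup_single when_def split: if_splits)

lemma homogeneous_0_constant:
  assumes "p \<in> homogeneous V 0"
  shows "p = Poly_Mapping.single 0 (Poly_Mapping.lookup p 0)"
proof (rule poly_mapping_eqI)
  fix m show "Poly_Mapping.lookup p m = Poly_Mapping.lookup (Poly_Mapping.single 0 (Poly_Mapping.lookup p 0)) m"
    using monomial_idealD[OF assms, of m] by (cases "m = 0") (auto simp: lookup_single when_def)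
qed

lemma homogeneous_negative: "p \<in> monomial_ideal V F e \<Longrightarrow> e < 0 \<Longrightarrow> p = 0"
  using monomial_idealD[of p V F e] by (intro poly_mapping_eqI) force

section \<open>Homogeneous generating sets\<close>

definition graded_module :: "'v set \<Rightarrow> (int \<Rightarrow> (nat \<Rightarrow> ('v, 'k::field) mpoly) set) \<Rightarrow> bool" where
  "graded_module V N \<longleftrightarrow> (\<forall>e. 0 \<in> N e \<and> (\<forall>w\<in>N e. \<forall>w'\<in>N e. w + w' \<in> N e) \<and>
     (\<forall>a. \<forall>p\<in>homogeneous V a. \<forall>w\<in>N e. vec_mult p w \<in> N (e + a)))"

lemma graded_moduleD:
  assumes "graded_module V N"
  shows "0 \<in> N e" "w \<in> N e \<Longrightarrow> w' \<in> N e \<Longrightarrow> w + w' \<in> N e"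
    "p \<in> homogeneous V a \<Longrightarrow> w \<in> N b \<Longrightarrow> a + b = e \<Longrightarrow> vec_mult p w \<in> N e"
proof -
  show "0 \<in> N e" "w \<in> N e \<Longrightarrow> w' \<in> N e \<Longrightarrow> w + w' \<in> N e"
    using assms unfolding graded_module_def by blast+
  assume "p \<in> homogeneous V a" "w \<in> N b" "a + b = e"
  then have "vec_mult p w \<in> N (b + a)" using assms unfolding graded_module_def by blast
  then show "vec_mult p w \<in> N e" using \<open>a + b = e\<close> by (simp add: add.commute)
qed

lemma graded_module_sum: "graded_module V N \<Longrightarrow> (\<And>x. x \<in> A \<Longrightarrow> f x \<in> N e) \<Longrightarrow> sum f A \<in> N e"
  by (induction A rule: infinite_finite_induct) (auto intro: graded_moduleD)

lemma lin_comb_eq_sum: "lin_comb n g w = (\<Sum>c<n. vec_mult (w c) (g c))"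
  by (rule ext) (simp add: lin_comb_def vec_mult_def sum_apply mult.commute)

lemma lin_comb_mem:
  assumes "graded_module V N" "\<And>c. c < n \<Longrightarrow> g c \<in> N (int (d c))" "w \<in> free_graded V n d e"
  shows "lin_comb n g w \<in> N e"
  unfolding lin_comb_eq_sum
  by (rule graded_module_sum[OF assms(1)])
    (use assms(2) direct_sum_in[OF assms(3)[unfolded free_graded_def]] in \<open>auto intro!: graded_moduleD(3)[OF assms(1)]\<close>)

text \<open>Scalars act as constant polynomials; the vector space structure provides bases and the
  bound on their size.\<close>

lemma vector_space_vec_mult:
  "vector_space (\<lambda>a. vec_mult (Poly_Mapping.single 0 a :: ('v, 'k::field) mpoly))"
  unfolding vector_space_def
  by (auto simp: vec_mult_def fun_eq_iff distrib_left distrib_right single_add mult.assoc[symmetric] mult_single)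

lemma free_graded_finite_dim:
  fixes N :: "(nat \<Rightarrow> ('v, 'k::field) mpoly) set"
  assumes V: "finite V" and N: "N \<subseteq> free_graded V n d e"
  obtains B where "finite B" "B \<subseteq> N"
    "\<And>w. w \<in> N \<Longrightarrow> \<exists>u. w = (\<Sum>b\<in>B. vec_mult (Poly_Mapping.single 0 (u b)) b)"
proof -
  interpret vs: vector_space "\<lambda>a. vec_mult (Poly_Mapping.single 0 a :: ('v, 'k::field) mpoly)"
    by (rule vector_space_vec_mult)
  obtain B where B: "B \<subseteq> N" "vs.independent B" "N \<subseteq> vs.span B"
    using vs.maximal_independent_subset[of N] by auto
  \<comment> \<open>A monomial of the right degree in one coordinate: finitely many such vectors
    span the whole degree \<open>e\<close> piece.\<close>
  define E where "E = (\<lambda>(c, m) r. if r = c then Poly_Mapping.single m (1::'k) else 0) `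
      (SIGMA c:{..<n}. monomials_of_degree V (e - int (d c)))"
  have finE: "finite E"
    unfolding E_def by (intro finite_imageI finite_SigmaI finite_lessThan finite_monomials_of_degree V)
  have "N \<subseteq> vs.span E"
  proof
    fix w assume "w \<in> N"
    then have w: "w \<in> free_graded V n d e" using N by blast
    have "w = (\<Sum>c<n. \<Sum>m\<in>monomials_of_degree V (e - int (d c)).
        vec_mult (Poly_Mapping.single 0 (Poly_Mapping.lookup (w c) m)) (\<lambda>r. if r = c then Poly_Mapping.single m 1 else 0))"
      (is "w = ?s")
    proof (rule ext, rule poly_mapping_eqI)
      fix r m
      have "Poly_Mapping.lookup (?s r) m = (\<Sum>c<n. if c = r then
          (if m \<in> monomials_of_degree V (e - int (d c)) then Poly_Mapping.lookup (w c) m else 0) else 0)"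
      proof (simp only: sum_apply lookup_sum vec_mult_def, intro sum.cong refl)
        fix c
        have "(\<Sum>x\<in>monomials_of_degree V (e - int (d c)). Poly_Mapping.lookup
            (Poly_Mapping.single 0 (Poly_Mapping.lookup (w c) x) * (if r = c then Poly_Mapping.single x 1 else 0)) m)
          = (\<Sum>x\<in>monomials_of_degree V (e - int (d c)). if x = m then (if c = r then Poly_Mapping.lookup (w c) m else 0) else 0)"
          by (intro sum.cong refl) (auto simp: mult_single lookup_single when_def)
        then show "(\<Sum>x\<in>monomials_of_degree V (e - int (d c)). Poly_Mapping.lookup
            (Poly_Mapping.single 0 (Poly_Mapping.lookup (w c) x) * (if r = c then Poly_Mapping.single x 1 else 0)) m)
          = (if c = r then (if m \<in> monomials_of_degree V (e - int (d c)) then Poly_Mapping.lookup (w c) m else 0) else 0)"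
          using finite_monomials_of_degree[OF V] by simp
      qed
      also have "\<dots> = Poly_Mapping.lookup (w r) m"
      proof (cases "r < n")
        case True
        have "Poly_Mapping.lookup (w r) m = 0" if "m \<notin> monomials_of_degree V (e - int (d r))"
          using monomial_idealD[OF direct_sum_in[OF w[unfolded free_graded_def] True], of m] that
          by (auto simp: monomials_of_degree_def)
        then show ?thesis using True by simp
      next
        case False
        then show ?thesis using direct_sum_out[OF w[unfolded free_graded_def], of r] by simp
      qed
      finally show "Poly_Mapping.lookup (w r) m = Poly_Mapping.lookup (?s r) m" ..
    qed
    also have "?s \<in> vs.span E"
      by (intro vs.span_sum vs.span_scale vs.span_base) (auto simp: E_def)
    finally show "w \<in> vs.span E" .
  qed
  then have "finite B"
    using vs.independent_span_bound[OF finE B(2)] B(1) by blast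
  then show thesis
  proof (rule that[OF _ B(1)])
    fix w assume "w \<in> N"
    then show "\<exists>u. w = (\<Sum>b\<in>B. vec_mult (Poly_Mapping.single 0 (u b)) b)"
      using B(3) vs.span_finite[OF \<open>finite B\<close>] by auto
  qed
qed

text \<open>Each generator carries its degree as first component, which prescribes the degree of its
  coefficient.\<close>

definition span_at ::
  "'v set \<Rightarrow> (nat \<times> (nat \<Rightarrow> ('v, 'k::field) mpoly)) set \<Rightarrow> int \<Rightarrow> (nat \<Rightarrow> ('v, 'k) mpoly) set" where
  "span_at V B e = {w. \<exists>q. (\<forall>b\<in>B. q b \<in> homogeneous V (e - int (fst b))) \<and> w = (\<Sum>b\<in>B. vec_mult (q b) (snd b))}"

lemma graded_module_span_at:
  fixes B :: "(nat \<times> (nat \<Rightarrow> ('v, 'k::field) mpoly)) set"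
  shows "graded_module V (span_at V B)"
  unfolding graded_module_def
proof (intro allI conjI ballI)
  fix e
  show "0 \<in> span_at V B e"
    unfolding span_at_def by (auto intro!: exI[of _ "\<lambda>_. 0"] monomial_ideal_0 ext simp: vec_mult_def sum_apply)
  fix w assume "w \<in> span_at V B e"
  then obtain q where q: "\<And>b. b \<in> B \<Longrightarrow> q b \<in> homogeneous V (e - int (fst b))" "w = (\<Sum>b\<in>B. vec_mult (q b) (snd b))"
    unfolding span_at_def by blast
  show "w + w' \<in> span_at V B e" if w': "w' \<in> span_at V B e" for w'
  proof -
    obtain q' where q': "\<And>b. b \<in> B \<Longrightarrow> q' b \<in> homogeneous V (e - int (fst b))" "w' = (\<Sum>b\<in>B. vec_mult (q' b) (snd b))"
      using w' unfolding span_at_def by blast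
    have "w + w' = (\<Sum>b\<in>B. vec_mult (q b + q' b) (snd b))"
      unfolding q(2) q'(2) by (rule ext) (simp add: sum_apply vec_mult_def sum.distrib algebra_simps)
    then show ?thesis
      unfolding span_at_def using q(1) q'(1) by (auto intro!: exI[of _ "\<lambda>b. q b + q' b"] monomial_ideal_add)
  qed
  fix a and p :: "('v, 'k) mpoly" assume p: "p \<in> homogeneous V a"
  have "vec_mult p w = (\<Sum>b\<in>B. vec_mult (p * q b) (snd b))"
    unfolding q(2) by (rule ext) (simp add: sum_apply vec_mult_def sum_distrib_left algebra_simps)
  moreover have "p * q b \<in> homogeneous V (e + a - int (fst b))" if "b \<in> B" for b
    using homogeneous_mult[OF p q(1)[OF that]] by (simp add: algebra_simps)
  ultimately show "vec_mult p w \<in> span_at V B (e + a)"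
    unfolding span_at_def by (auto intro!: exI[of _ "\<lambda>b. p * q b"])
qed

definition generates ::
  "'v set \<Rightarrow> (nat \<times> (nat \<Rightarrow> ('v, 'k::field) mpoly)) set \<Rightarrow> (int \<Rightarrow> (nat \<Rightarrow> ('v, 'k) mpoly) set) \<Rightarrow> bool" where
  "generates V B N \<longleftrightarrow> finite B \<and> (\<forall>b\<in>B. snd b \<in> N (int (fst b))) \<and> (\<forall>e. N e \<subseteq> span_at V B e)"

context koszul_signs begin

lemma graded_module_submodule_by:
  fixes N :: "int \<Rightarrow> (nat \<Rightarrow> ('v, 'k::field) mpoly) set"
  assumes "graded_module V N"
  shows "submodule_by (\<lambda>v. vec_mult (var v)) N"
  unfolding submodule_by_def
proof (intro allI conjI ballI)
  fix e a b assume ab: "a \<in> N e" "b \<in> N e"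
  have "a - b = a + vec_mult (Poly_Mapping.single 0 (- 1)) b"
    by (rule ext) (simp add: vec_mult_def single_uminus)
  then show "a - b \<in> N e"
    using graded_moduleD(2)[OF assms ab(1) graded_moduleD(3)[OF assms constant_homogeneous ab(2)]]
    by (metis add_0)
qed (auto intro: graded_moduleD(1)[OF assms] graded_moduleD(3)[OF assms var_homogeneous])

text \<open>Takes the place of the Noetherian property. Bases of the pieces of degrees 0 to
  \<open>l\<close> suffice, because above \<open>l\<close> exactness writes every element through
  elements of the preceding degree. Negative degrees contain only zero.\<close>

lemma generates_exists:
  fixes N :: "int \<Rightarrow> (nat \<Rightarrow> ('v, 'k::field) mpoly) set"
  assumes N: "graded_module V N" and sub: "\<And>e. N e \<subseteq> free_graded V n d e"
    and exact: "\<And>e. e > int l \<Longrightarrow> koszul_exact (\<lambda>v. vec_mult (var v)) N 0 e"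
  shows "\<exists>B. generates V B N"
proof -
  have "\<forall>e. \<exists>B. finite B \<and> B \<subseteq> N e \<and> (\<forall>w\<in>N e. \<exists>u. w = (\<Sum>b\<in>B. vec_mult (Poly_Mapping.single 0 (u b)) b))"
  proof
    fix e
    obtain B where "finite B" "B \<subseteq> N e"
        "\<And>w. w \<in> N e \<Longrightarrow> \<exists>u. w = (\<Sum>b\<in>B. vec_mult (Poly_Mapping.single 0 (u b)) b)"
      using free_graded_finite_dim[OF finite_V sub, of e] by auto
    then show "\<exists>B. finite B \<and> B \<subseteq> N e \<and>
        (\<forall>w\<in>N e. \<exists>u. w = (\<Sum>b\<in>B. vec_mult (Poly_Mapping.single 0 (u b)) b))"
      by blast
  qed
  then obtain B0 where B0: "\<And>e. finite (B0 e)" "\<And>e. B0 e \<subseteq> N e"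
      "\<And>e w. w \<in> N e \<Longrightarrow> \<exists>u. w = (\<Sum>b\<in>B0 e. vec_mult (Poly_Mapping.single 0 (u b)) b)"
    unfolding choice_iff by blast
  define B where "B = (SIGMA a:{..l}. B0 (int a))"
  have finB: "finite B" by (auto simp: B_def B0)
  note S = graded_moduleD[OF graded_module_span_at[of V B]]
  have low: "N (int a) \<subseteq> span_at V B (int a)" if "a \<le> l" for a
  proof
    fix w assume "w \<in> N (int a)"
    then obtain u where u: "w = (\<Sum>b\<in>B0 (int a). vec_mult (Poly_Mapping.single 0 (u b)) b)" using B0(3) by blast
    let ?q = "\<lambda>b. if fst b = a then Poly_Mapping.single 0 (u (snd b)) else 0"
    have "w = (\<Sum>b\<in>Pair a ` B0 (int a). vec_mult (?q b) (snd b))"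
      unfolding u by (subst sum.reindex) (auto simp: inj_on_def)
    also have "\<dots> = (\<Sum>b\<in>B. vec_mult (?q b) (snd b))"
      using that finB by (intro sum.mono_neutral_left) (auto simp: B_def vec_mult_def fun_eq_iff)
    finally show "w \<in> span_at V B (int a)"
      unfolding span_at_def using constant_homogeneous
      by (auto intro!: exI[of _ ?q] monomial_ideal_0)
  qed
  have nonneg: "N (int a) \<subseteq> span_at V B (int a)" for a
  proof (induction a)
    case 0
    then show ?case using low[of 0] by simp
  next
    case (Suc a)
    show ?case
    proof (cases "Suc a \<le> l")
      case False
      show ?thesis
      proof
        fix w assume w: "w \<in> N (int (Suc a))"
        define c where "c \<tau> = (if \<tau> = {} then w else 0)" for \<tau> :: "'v set"
        have fin: "finite \<tau>" if "\<tau> \<subseteq> V" for \<tau> using that finite_V finite_subset by blast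
        have "c \<in> koszul_chains V 0 (\<lambda>_. N (int (Suc a)))"
        proof (rule chainsI)
          fix \<tau> assume "\<tau> \<subseteq> V" "card \<tau> = 0"
          then have "\<tau> = {}" using fin by auto
          then show "c \<tau> \<in> N (int (Suc a))" using w by (simp add: c_def)
        qed (auto simp: c_def)
        moreover have "bd (\<lambda>v. vec_mult (var v)) V c = (\<lambda>_. 0)"
          by (rule ext) (simp add: bd_def c_def operators_0[OF operators_vec_mult])
        ultimately obtain b where b: "b \<in> koszul_chains V (Suc 0) (\<lambda>_. N (int (Suc a) - 1))"
            "bd (\<lambda>v. vec_mult (var v)) V b = c"
          using koszul_exactD[OF exact] False by (metis not_less_eq_eq of_nat_less_iff not_le)
        \<comment> \<open>A bounding chain evaluated at the empty set: \<open>w\<close> is a sum of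
          variables times elements one degree lower.\<close>
        have "w = (\<Sum>v\<in>V. sgn_act (s v {}) (vec_mult (var v) (b {v})))"
          using fun_cong[OF b(2), of "{}"] by (simp add: bd_def c_def)
        also have "\<dots> \<in> span_at V B (int (Suc a))"
        proof (rule graded_module_sum[OF graded_module_span_at])
          fix v assume v: "v \<in> V"
          have "b {v} \<in> N (int a)" using chains_in[OF b(1), of "{v}"] v by simp
          then have "b {v} \<in> span_at V B (int (Suc a) - 1)" using Suc.IH by auto
          then show "sgn_act (s v {}) (vec_mult (var v) (b {v})) \<in> span_at V B (int (Suc a))"
            using submodule_byD(5,6)[OF graded_module_submodule_by[OF graded_module_span_at]] v by blast
        qed
        finally show "w \<in> span_at V B (int (Suc a))" .
      qed
    qed (rule low)
  qed
  have "N e \<subseteq> span_at V B e" for e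
  proof (cases "e < 0")
    case True
    have "w = 0" if "w \<in> N e" for w
    proof
      fix r
      have w: "w \<in> free_graded V n d e" using that sub by blast
      show "w r = 0 r"
        using homogeneous_negative[OF direct_sum_in[OF w[unfolded free_graded_def]]]
          direct_sum_out[OF w[unfolded free_graded_def]] True by (cases "r < n") auto
    qed
    then show ?thesis using S(1) by auto
  next
    case False
    then show ?thesis using nonneg[of "nat e"] by simp
  qed
  moreover have "\<forall>b\<in>B. snd b \<in> N (int (fst b))" using B0(2) by (auto simp: B_def)
  ultimately show ?thesis using finB unfolding generates_def by blast
qed

lemma minimal_generators:
  fixes N :: "int \<Rightarrow> (nat \<Rightarrow> ('v, 'k::field) mpoly) set"
  assumes N: "graded_module V N" and gen: "\<exists>B. generates V B N"
  shows "\<exists>n d g. (\<forall>e. lin_comb n g ` free_graded V n d e = N e) \<and>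
    (\<forall>e. \<forall>w\<in>free_graded V n d e. lin_comb n g w = 0 \<longrightarrow> (\<forall>r. Poly_Mapping.lookup (w r) 0 = 0))"
proof -
  obtain B where B: "generates V B N" and least: "\<And>B'. generates V B' N \<Longrightarrow> card B \<le> card B'"
    using gen ex_has_least_nat[of "\<lambda>B. generates V B N" _ card] by blast
  have finB: "finite B" and BN: "\<And>b. b \<in> B \<Longrightarrow> snd b \<in> N (int (fst b))" and span: "\<And>e. N e \<subseteq> span_at V B e"
    using B by (auto simp: generates_def)
  obtain h where h: "bij_betw h {..<card B} B"
    using ex_bij_betw_nat_finite[OF finB] by (auto simp: atLeast0LessThan)
  define n where "n = card B"
  define d where "d c = fst (h c)" for c
  define g where "g c = snd (h c)" for c
  have hB: "h c \<in> B" if "c < n" for c using h that by (auto simp: n_def bij_betw_def)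
  have gN: "g c \<in> N (int (d c))" if "c < n" for c using BN[OF hB[OF that]] by (simp add: g_def d_def)
  have sum_h: "(\<Sum>b\<in>B. f b) = (\<Sum>c<n. f (h c))" for f :: "nat \<times> (nat \<Rightarrow> ('v, 'k) mpoly) \<Rightarrow> nat \<Rightarrow> ('v, 'k) mpoly"
    using sum.reindex_bij_betw[OF h, of f] by (simp add: n_def)
  have "lin_comb n g ` free_graded V n d e = N e" for e
  proof
    show "lin_comb n g ` free_graded V n d e \<subseteq> N e"
      using lin_comb_mem[OF N, of n g d] gN by blast
    show "N e \<subseteq> lin_comb n g ` free_graded V n d e"
    proof
      fix x assume "x \<in> N e"
      then obtain q where q: "\<And>b. b \<in> B \<Longrightarrow> q b \<in> homogeneous V (e - int (fst b))"
          "x = (\<Sum>b\<in>B. vec_mult (q b) (snd b))"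
        using span unfolding span_at_def by blast
      define w where "w c = (if c < n then q (h c) else 0)" for c
      have "w \<in> free_graded V n d e"
        unfolding free_graded_def by (rule direct_sumI) (auto simp: w_def d_def intro: q(1) hB)
      moreover have "x = lin_comb n g w"
        unfolding q(2) sum_h lin_comb_eq_sum by (rule sum.cong) (auto simp: w_def g_def)
      ultimately show "x \<in> lin_comb n g ` free_graded V n d e" by blast
    qed
  qed
  moreover have "Poly_Mapping.lookup (w a) 0 = 0"
    if w: "w \<in> free_graded V n d e" and rel: "lin_comb n g w = 0" for e w a
  proof (rule ccontr)
    assume nz: "Poly_Mapping.lookup (w a) 0 \<noteq> 0"
    have a: "a < n"
      using direct_sum_out[OF w[unfolded free_graded_def], of a] nz by (cases "a < n") auto
    have wa: "w a \<in> homogeneous V (e - int (d a))" by (rule direct_sum_in[OF w[unfolded free_graded_def] a])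
    \<comment> \<open>A homogeneous polynomial with nonzero constant term has degree 0.\<close>
    have e: "e = int (d a)" using homogeneous_lookup_0[OF wa] nz by force
    define k where "k = Poly_Mapping.lookup (w a) 0"
    have wk: "w a = Poly_Mapping.single 0 k" using homogeneous_0_constant[of "w a" V] wa e by (simp add: k_def)
    define u where "u b = w (the_inv_into {..<n} h b)" for b
    have uh: "u (h c) = w c" if "c < n" for c
      using that h by (simp add: u_def n_def bij_betw_def the_inv_into_f_f)
    have u: "u b \<in> homogeneous V (int (d a) - int (fst b))" if "b \<in> B" for b
    proof -
      have "b \<in> h ` {..<n}" using that h by (simp add: n_def bij_betw_def)
      then obtain c where c: "b = h c" "c < n" by blast
      then show ?thesis using uh direct_sum_in[OF w[unfolded free_graded_def] c(2)] e by (simp add: d_def)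
    qed
    have rel': "(\<Sum>b\<in>B. vec_mult (u b) (snd b)) = 0"
      using rel unfolding sum_h lin_comb_eq_sum by (simp add: uh g_def)
    have "generates V (B - {h a}) N"
      unfolding generates_def
    proof (intro conjI allI ballI subsetI)
      fix e' x assume "x \<in> N e'"
      then obtain q where q: "\<And>b. b \<in> B \<Longrightarrow> q b \<in> homogeneous V (e' - int (fst b))"
          "x = (\<Sum>b\<in>B. vec_mult (q b) (snd b))"
        using span unfolding span_at_def by blast
      \<comment> \<open>Chosen so that adding \<open>p\<close> times the relation cancels the
        coefficient of the generator \<open>h a\<close>.\<close>
      define p where "p = q (h a) * Poly_Mapping.single 0 (- 1 / k)"
      have p: "p \<in> homogeneous V (e' - int (d a))"
        using homogeneous_mult[OF q(1)[OF hB[OF a]] constant_homogeneous] by (simp add: p_def d_def)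
      define q' where "q' b = q b + p * u b" for b
      have q': "q' b \<in> homogeneous V (e' - int (fst b))" if "b \<in> B" for b
        unfolding q'_def using homogeneous_mult[OF p u[OF that]] by (intro monomial_ideal_add q(1) that) simp
      have "Poly_Mapping.single 0 (- 1 / k) * Poly_Mapping.single 0 k = (- 1 :: ('v, 'k) mpoly)"
        using nz by (simp add: mult_single k_def single_uminus)
      then have "q' (h a) = 0"
        by (simp add: q'_def p_def uh[OF a] wk mult.assoc)
      have "(\<Sum>b\<in>B - {h a}. vec_mult (q' b) (snd b)) = (\<Sum>b\<in>B. vec_mult (q' b) (snd b))"
        using finB \<open>q' (h a) = 0\<close> by (intro sum.mono_neutral_left) (auto simp: vec_mult_def fun_eq_iff)
      also have "\<dots> = x + vec_mult p (\<Sum>b\<in>B. vec_mult (u b) (snd b))"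
        unfolding q(2) q'_def
        by (rule ext) (simp add: sum_apply vec_mult_def sum.distrib sum_distrib_left algebra_simps)
      also have "\<dots> = x" unfolding rel' by (rule ext) (simp add: vec_mult_def)
      finally show "x \<in> span_at V (B - {h a}) e'"
        unfolding span_at_def using q' by (auto intro!: exI[of _ q'])
    qed (use finB BN in auto)
    then have "card B \<le> card (B - {h a})" by (rule least)
    then show False using card_Diff1_less[OF finB hB[OF a]] by simp
  qed
  ultimately show ?thesis by blast
qed

section \<open>Construction of minimal resolutions\<close>

definition syzygies ::
  "nat \<Rightarrow> (nat \<Rightarrow> nat) \<Rightarrow> (nat \<Rightarrow> nat \<Rightarrow> ('v, 'k::field) mpoly) \<Rightarrow> int \<Rightarrow> (nat \<Rightarrow> ('v, 'k) mpoly) set" where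
  "syzygies n d g e = {w \<in> free_graded V n d e. lin_comb n g w = 0}"

lemma graded_module_free_graded: "graded_module V (free_graded V n d :: int \<Rightarrow> (nat \<Rightarrow> ('v, 'k::field) mpoly) set)"
  unfolding graded_module_def
proof (intro allI conjI ballI)
  fix e a and p :: "('v, 'k) mpoly" and w w' :: "nat \<Rightarrow> ('v, 'k) mpoly"
  show "(0 :: nat \<Rightarrow> ('v, 'k) mpoly) \<in> free_graded V n d e"
    unfolding free_graded_def by (rule direct_sumI) (auto intro: monomial_ideal_0)
  assume w: "w \<in> free_graded V n d e"
  note wi = direct_sum_in[OF w[unfolded free_graded_def]] and wo = direct_sum_out[OF w[unfolded free_graded_def]]
  show "w + w' \<in> free_graded V n d e" if w': "w' \<in> free_graded V n d e" for w'
    unfolding free_graded_def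
    by (rule direct_sumI)
      (simp_all add: wo direct_sum_out[OF w'[unfolded free_graded_def]] monomial_ideal_add wi
        direct_sum_in[OF w'[unfolded free_graded_def]])
  assume p: "p \<in> homogeneous V a"
  show "vec_mult p w \<in> free_graded V n d (e + a)"
    unfolding free_graded_def
  proof (rule direct_sumI)
    fix r assume "r < n"
    then show "vec_mult p w r \<in> homogeneous V (e + a - int (d r))"
      using homogeneous_mult[OF p wi[of r]] by (simp add: vec_mult_def algebra_simps)
  qed (simp add: vec_mult_def wo)
qed

lemma graded_module_syzygies:
  "graded_module V (syzygies n d g :: int \<Rightarrow> (nat \<Rightarrow> ('v, 'k::field) mpoly) set)"
proof -
  note F = graded_moduleD[OF graded_module_free_graded[of n d]]
  have 0: "lin_comb n g 0 = 0" "vec_mult p (0 :: nat \<Rightarrow> ('v, 'k) mpoly) = 0" for p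
    by (auto simp: lin_comb_def vec_mult_def fun_eq_iff)
  show ?thesis
    unfolding graded_module_def syzygies_def
    by (auto simp: 0 lin_comb_add lin_comb_vec_mult intro: F)
qed

text \<open>Finite generation has to persist for all syzygy modules. The vanishing hypothesis is
  stated in terms of the total degree \<open>i + e\<close>, which dimension shifting preserves, so
  the same \<open>l\<close> serves at every stage.\<close>

lemma minimal_resolution_exists:
  fixes N0 :: "int \<Rightarrow> (nat \<Rightarrow> ('v, 'k::field) mpoly) set"
  assumes "graded_module V N0" "\<And>e. N0 e \<subseteq> free_graded V n0 d0 e"
    and exact0: "\<And>i e. int i + e > int l \<Longrightarrow> koszul_exact (\<lambda>v. vec_mult (var v)) N0 i e"
  obtains n d g N where "N 0 = N0"
    "\<And>i e. lin_comb (n i) (g i) ` free_graded V (n i) (d i) e = N i e"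
    "\<And>i e. N (Suc i) e = {w \<in> free_graded V (n i) (d i) e. lin_comb (n i) (g i) w = 0}"
    "\<And>i e w r. w \<in> N (Suc i) e \<Longrightarrow> Poly_Mapping.lookup (w r) 0 = 0"
proof -
  \<comment> \<open>The invariant handed from a module to its syzygies.\<close>
  define good :: "(int \<Rightarrow> (nat \<Rightarrow> ('v, 'k) mpoly) set) \<Rightarrow> bool" where
    "good N \<longleftrightarrow> graded_module V N \<and> (\<exists>n d. \<forall>e. N e \<subseteq> free_graded V n d e) \<and>
       (\<forall>i e. int i + e > int l \<longrightarrow> koszul_exact (\<lambda>v. vec_mult (var v)) N i e)" for N
  define res :: "nat \<times> (nat \<Rightarrow> nat) \<times> (nat \<Rightarrow> nat \<Rightarrow> ('v, 'k) mpoly) \<Rightarrow> (int \<Rightarrow> (nat \<Rightarrow> ('v, 'k) mpoly) set) \<Rightarrow> bool" where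
    "res x N \<longleftrightarrow> (case x of (n, d, g) \<Rightarrow> (\<forall>e. lin_comb n g ` free_graded V n d e = N e) \<and>
       (\<forall>e. \<forall>w\<in>syzygies n d g e. \<forall>r. Poly_Mapping.lookup (w r) 0 = 0))" for x N
  have res_ex: "\<exists>x. res x N" if "good N" for N
  proof -
    obtain n d where nd: "\<And>e. N e \<subseteq> free_graded V n d e" using \<open>good N\<close> unfolding good_def by blast
    have gm: "graded_module V N" using \<open>good N\<close> by (simp add: good_def)
    have "\<exists>B. generates V B N"
    proof (rule generates_exists[OF gm nd])
      have ke: "int i + e > int l \<longrightarrow> koszul_exact (\<lambda>v. vec_mult (var v)) N i e" for i e
        using \<open>good N\<close> unfolding good_def by (elim conjE) (rule spec, rule spec)
      show "koszul_exact (\<lambda>v. vec_mult (var v)) N 0 e" if "e > int l" for e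
        by (rule mp[OF ke]) (use that in simp)
    qed
    from minimal_generators[OF gm this] obtain n d g where "\<forall>e. lin_comb n g ` free_graded V n d e = N e"
        "\<forall>e. \<forall>w\<in>free_graded V n d e. lin_comb n g w = 0 \<longrightarrow> (\<forall>r. Poly_Mapping.lookup (w r) 0 = 0)"
      by (elim exE conjE)
    then show ?thesis
      unfolding res_def syzygies_def by (intro exI[of _ "(n, d, g)"]) auto
  qed
  have step: "good (syzygies (fst x) (fst (snd x)) (snd (snd x)))" if N: "good N" and x: "res x N" for x N
  proof -
    obtain n d g where x_eq: "x = (n, d, g)" by (cases x)
    have surj: "lin_comb n g ` free_graded V n d e = N e" for e using x by (simp add: res_def x_eq)
    have min: "Poly_Mapping.lookup (w r) 0 = 0" if "w \<in> syzygies n d g e" for w e r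
      using x that by (auto simp: res_def x_eq)
    have sub: "syzygies n d g e \<subseteq> free_graded V n d e" for e by (auto simp: syzygies_def)
    have "koszul_exact (\<lambda>v. vec_mult (var v)) (syzygies n d g) i (e - 1 + 1)" if "int i + e > int l" for i e
    proof (rule exact_kernel_of_exact[OF operators_vec_mult operators_vec_mult submodule_free_graded
          lin_comb_add lin_comb_vec_mult surj syzygies_def koszul_exact_free])
      show "koszul_exact (\<lambda>v. vec_mult (var v)) N (Suc i) (e - 1)"
        using N that unfolding good_def by (elim conjE) (erule allE, erule allE, erule mp, simp)
      fix c assume c: "c \<in> koszul_chains V 0 (\<lambda>_. syzygies n d g (e - 1 + 1))"
      have "c {} \<in> syzygies n d g e" using chains_in[OF c, of "{}"] by simp
      moreover have "c \<in> koszul_chains V 0 (\<lambda>_. free_graded V n d e)"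
      proof (rule chainsI)
        show "c \<tau> \<in> free_graded V n d e" if "\<tau> \<subseteq> V" "card \<tau> = 0" for \<tau>
          using chains_in[OF c that] sub by (simp add: subset_iff)
      qed (rule chains_out[OF c])
      ultimately show "\<exists>f\<in>koszul_chains V 1 (\<lambda>_. free_graded V n d (e - 1)). bd (\<lambda>v. vec_mult (var v)) V f = c"
        using free_without_constants_boundary[of c n d e] min by blast
    qed
    then show ?thesis
      using graded_module_syzygies sub unfolding good_def x_eq by auto
  qed
  have N0: "good N0" using assms by (auto simp: good_def)
  have "\<exists>f. \<forall>i. ((good (snd (f i)) \<and> res (fst (f i)) (snd (f i))) \<and> (i = 0 \<longrightarrow> snd (f i) = N0)) \<and>
      snd (f (Suc i)) = (case fst (f i) of (n, d, g) \<Rightarrow> syzygies n d g)"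
  proof (rule dependent_nat_choice)
    obtain x where "res x N0" using res_ex[OF N0] by blast
    then show "\<exists>y. (good (snd y) \<and> res (fst y) (snd y)) \<and> (0 = (0::nat) \<longrightarrow> snd y = N0)"
      using N0 by (intro exI[of _ "(x, N0)"]) simp
  next
    fix y i assume y: "(good (snd y) \<and> res (fst y) (snd y)) \<and> (i = (0::nat) \<longrightarrow> snd y = N0)"
    let ?N = "case fst y of (n, d, g) \<Rightarrow> syzygies n d g"
    have "good ?N" using step[of "snd y" "fst y"] y by (simp add: case_prod_beta)
    moreover obtain x where "res x ?N" using res_ex[OF \<open>good ?N\<close>] by blast
    ultimately show "\<exists>y'. ((good (snd y') \<and> res (fst y') (snd y')) \<and> (Suc i = 0 \<longrightarrow> snd y' = N0)) \<and> snd y' = ?N"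
      by (intro exI[of _ "(x, ?N)"]) simp
  qed
  then obtain f where f: "\<And>i. res (fst (f i)) (snd (f i))" "snd (f 0) = N0"
      "\<And>i. snd (f (Suc i)) = (case fst (f i) of (n, d, g) \<Rightarrow> syzygies n d g)"
    by blast
  define n d g N where "n i = fst (fst (f i))" and "d i = fst (snd (fst (f i)))"
    and "g i = snd (snd (fst (f i)))" and "N i = snd (f i)" for i
  have fi: "fst (f i) = (n i, d i, g i)" for i by (simp add: n_def d_def g_def)
  have r: "lin_comb (n i) (g i) ` free_graded V (n i) (d i) e = N i e"
    "\<forall>w\<in>syzygies (n i) (d i) (g i) e. \<forall>r. Poly_Mapping.lookup (w r) 0 = 0" for i e
    using f(1)[of i] by (auto simp: res_def fi N_def)
  have k: "N (Suc i) = syzygies (n i) (d i) (g i)" for i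
    using f(3)[of i] by (simp add: fi N_def)
  show thesis
  proof (rule that[of N n g d])
    show "N 0 = N0" by (simp add: N_def f(2))
  qed (use r k in \<open>auto simp: syzygies_def\<close>)
qed

end

section \<open>Regularity of squarefree monomial ideals\<close>


text \<open>Resolutions are defined as exact on ungraded modules, whereas the Koszul argument works
  in one degree at a time. Homogeneous components translate between the two.\<close>

definition hom_part :: "int \<Rightarrow> ('v, 'k::field) mpoly \<Rightarrow> ('v, 'k) mpoly" where
  "hom_part e p = (\<Sum>m\<in>{m \<in> Poly_Mapping.keys p. int (mon_deg m) = e}. Poly_Mapping.single m (Poly_Mapping.lookup p m))"

lemma lookup_hom_part:
  "Poly_Mapping.lookup (hom_part e p) m = (if int (mon_deg m) = e then Poly_Mapping.lookup p m else 0)"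
proof -
  have "Poly_Mapping.lookup (hom_part e p) m
      = (\<Sum>x\<in>{m \<in> Poly_Mapping.keys p. int (mon_deg m) = e}. if x = m then Poly_Mapping.lookup p m else 0)"
    unfolding hom_part_def lookup_sum by (intro sum.cong refl) (auto simp: lookup_single when_def)
  then show ?thesis by (simp add: in_keys_iff)
qed

lemma hom_part_0 [simp]: "hom_part e 0 = 0"
  by (rule poly_mapping_eqI) (simp add: lookup_hom_part)

lemma hom_part_sum: "hom_part e (sum f A) = (\<Sum>x\<in>A. hom_part e (f x))"
  by (rule poly_mapping_eqI) (simp add: lookup_hom_part lookup_sum)

lemma hom_part_mult:
  assumes p: "p \<in> homogeneous V a"
  shows "hom_part (a + b) (p * q) = p * hom_part b q"
proof (rule poly_mapping_eqI)
  fix m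
  have eq: "Poly_Mapping.lookup (p * q) m = Poly_Mapping.lookup (p * hom_part b q) m
      + Poly_Mapping.lookup (p * (q - hom_part b q)) m"
    by (simp add: lookup_add[symmetric] algebra_simps)
  have "Poly_Mapping.lookup (p * (q - hom_part b q)) m = 0" if "int (mon_deg m) = a + b"
  proof (rule ccontr)
    assume "Poly_Mapping.lookup (p * (q - hom_part b q)) m \<noteq> 0"
    then obtain m1 m2 where m: "m = m1 + m2" "Poly_Mapping.lookup p m1 \<noteq> 0"
        "Poly_Mapping.lookup (q - hom_part b q) m2 \<noteq> 0" by (rule lookup_mult_keys)
    then show False
      using monomial_idealD[OF p m(2)] that by (auto simp: mon_deg_add lookup_minus lookup_hom_part)
  qed
  moreover have "Poly_Mapping.lookup (p * hom_part b q) m = 0" if "int (mon_deg m) \<noteq> a + b"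
  proof (rule ccontr)
    assume "Poly_Mapping.lookup (p * hom_part b q) m \<noteq> 0"
    then obtain m1 m2 where m: "m = m1 + m2" "Poly_Mapping.lookup p m1 \<noteq> 0"
        "Poly_Mapping.lookup (hom_part b q) m2 \<noteq> 0" by (rule lookup_mult_keys)
    then show False
      using monomial_idealD[OF p m(2)] that by (auto simp: mon_deg_add lookup_hom_part split: if_splits)
  qed
  ultimately show "Poly_Mapping.lookup (hom_part (a + b) (p * q)) m = Poly_Mapping.lookup (p * hom_part b q) m"
    using eq by (simp add: lookup_hom_part)
qed

definition graded_part :: "(nat \<Rightarrow> nat) \<Rightarrow> int \<Rightarrow> (nat \<Rightarrow> ('v, 'k::field) mpoly) \<Rightarrow> nat \<Rightarrow> ('v, 'k) mpoly" where
  "graded_part d e w r = hom_part (e - int (d r)) (w r)"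

lemma homogeneous_poly_ring: "p \<in> homogeneous V e \<Longrightarrow> p \<in> poly_ring V"
  by (auto simp: monomial_ideal_def monomials_of_degree_def poly_ring_def)

lemma poly_ringD: "p \<in> poly_ring V \<Longrightarrow> Poly_Mapping.lookup p m \<noteq> 0 \<Longrightarrow> Poly_Mapping.keys m \<subseteq> V"
  by (simp add: poly_ring_def in_keys_iff)

lemma hom_part_homogeneous: "p \<in> poly_ring V \<Longrightarrow> hom_part e p \<in> homogeneous V e"
  by (rule monomial_idealI) (auto simp: lookup_hom_part dest: poly_ringD split: if_splits)

lemma free_graded_free_mod: "w \<in> free_graded V n d e \<Longrightarrow> w \<in> free_mod V n"
  unfolding free_graded_def free_mod_def
proof (intro CollectI conjI allI impI)
  fix c assume w: "w \<in> direct_sum n (\<lambda>r e. homogeneous V (e - int (d r))) e"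
  show "w c \<in> poly_ring V" if "c < n" by (rule homogeneous_poly_ring[OF direct_sum_in[OF w that]])
  show "w c = 0" if "n \<le> c" by (rule direct_sum_out[OF w]) (use that in simp)
qed

lemma graded_part_free_graded:
  assumes "w \<in> free_mod V n" shows "graded_part d e w \<in> free_graded V n d e"
  unfolding free_graded_def
  by (rule direct_sumI) (use assms in \<open>auto simp: graded_part_def free_mod_def intro: hom_part_homogeneous\<close>)

lemma graded_part_0 [simp]: "graded_part d e (\<lambda>_. 0) = (\<lambda>_. 0)" "graded_part d e 0 = 0"
  by (auto simp: graded_part_def fun_eq_iff)

lemma graded_part_lin_comb:
  assumes "\<And>c r. c < n \<Longrightarrow> g c r \<in> homogeneous V (int (d c) - int (d' r))"
  shows "graded_part d' e (lin_comb n g w) = lin_comb n g (graded_part d e w)"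
proof
  fix r
  have "hom_part (e - int (d' r)) (g c r * w c) = g c r * hom_part (e - int (d c)) (w c)" if "c < n" for c
    using hom_part_mult[OF assms[OF that, of r], of "e - int (d c)" "w c"] by simp
  then show "graded_part d' e (lin_comb n g w) r = lin_comb n g (graded_part d e w) r"
    by (simp add: graded_part_def lin_comb_def hom_part_sum)
qed

lemma graded_part_eq:
  assumes "w \<in> free_graded V n d e" shows "graded_part d e w = w"
proof (rule ext, rule poly_mapping_eqI)
  fix r m
  show "Poly_Mapping.lookup (graded_part d e w r) m = Poly_Mapping.lookup (w r) m"
  proof (cases "r < n")
    case True
    then show ?thesis
      using monomial_idealD[OF direct_sum_in[OF assms[unfolded free_graded_def] True], of m]
      by (auto simp: graded_part_def lookup_hom_part)
  qed (simp add: graded_part_def direct_sum_out[OF assms[unfolded free_graded_def]])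
qed

lemma sum_graded_parts:
  assumes w: "w \<in> free_mod V n"
  obtains E where "finite E" "w = (\<Sum>e\<in>E. graded_part d e w)"
proof
  let ?E = "\<Union>r<n. (\<lambda>m. int (mon_deg m) + int (d r)) ` Poly_Mapping.keys (w r)"
  show fin: "finite ?E" by auto
  show "w = (\<Sum>e\<in>?E. graded_part d e w)"
  proof (rule ext, rule poly_mapping_eqI)
    fix r m
    have "Poly_Mapping.lookup ((\<Sum>e\<in>?E. graded_part d e w) r) m
        = (\<Sum>e\<in>?E. if e = int (mon_deg m) + int (d r) then Poly_Mapping.lookup (w r) m else 0)"
      unfolding sum_apply lookup_sum graded_part_def lookup_hom_part by (intro sum.cong) auto
    also have "\<dots> = (if int (mon_deg m) + int (d r) \<in> ?E then Poly_Mapping.lookup (w r) m else 0)"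
      using fin by simp
    also have "\<dots> = Poly_Mapping.lookup (w r) m"
    proof (cases "Poly_Mapping.lookup (w r) m = 0")
      case False
      then have "r < n" using w by (cases "r < n") (auto simp: free_mod_def)
      moreover have "m \<in> Poly_Mapping.keys (w r)" using False by (simp add: in_keys_iff)
      ultimately show ?thesis by auto
    qed simp
    finally show "Poly_Mapping.lookup (w r) m = Poly_Mapping.lookup ((\<Sum>e\<in>?E. graded_part d e w) r) m" ..
  qed
qed

lemma lin_comb_0 [simp]: "lin_comb n g 0 = 0"
  by (auto simp: lin_comb_def fun_eq_iff)

lemma lin_comb_sum: "lin_comb n g (sum f A) = (\<Sum>x\<in>A. lin_comb n g (f x))"
  by (rule ext) (simp add: lin_comb_def sum_apply sum_distrib_left sum.swap[of _ A])

lemma lin_comb_cong: "(\<And>c. c < n \<Longrightarrow> g c = g' c) \<Longrightarrow> lin_comb n g w = lin_comb n g' w"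
  by (auto simp: lin_comb_def fun_eq_iff)

lemma free_mod_sum:
  fixes f :: "'a \<Rightarrow> nat \<Rightarrow> ('v, 'k::field) mpoly"
  shows "(\<And>x. x \<in> A \<Longrightarrow> f x \<in> free_mod V n) \<Longrightarrow> sum f A \<in> free_mod V n"
proof (induction A rule: infinite_finite_induct)
  case (insert x A)
  have "p + q \<in> poly_ring V" if "p \<in> poly_ring V" "q \<in> poly_ring V" for p q :: "('v, 'k) mpoly"
    using that keys_add[of p q] unfolding poly_ring_def by blast
  then show ?case using insert by (auto simp: free_mod_def)
qed (auto simp: free_mod_def poly_ring_def)

definition monomial_span :: "'v set \<Rightarrow> ('v set \<Rightarrow> bool) \<Rightarrow> ('v, 'k::field) mpoly set" where
  "monomial_span V F = {p \<in> poly_ring V. \<forall>m\<in>Poly_Mapping.keys p. F (Poly_Mapping.keys m)}"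

lemma monomial_ideal_span:
  "p \<in> monomial_ideal V F e \<Longrightarrow> p \<in> homogeneous V e" "p \<in> monomial_ideal V F e \<Longrightarrow> p \<in> monomial_span V F"
  by (auto simp: monomial_ideal_def monomial_span_def monomials_of_degree_def poly_ring_def)

lemma monomial_span_sum:
  fixes f :: "'a \<Rightarrow> ('v, 'k::field) mpoly"
  shows "(\<And>x. x \<in> A \<Longrightarrow> f x \<in> monomial_span V F) \<Longrightarrow> sum f A \<in> monomial_span V F"
proof (induction A rule: infinite_finite_induct)
  case (insert x A)
  have "p + q \<in> monomial_span V F" if "p \<in> monomial_span V F" "q \<in> monomial_span V F" for p q :: "('v, 'k) mpoly"
    using that keys_add[of p q] unfolding monomial_span_def poly_ring_def by blast
  then show ?case using insert by auto
qed (auto simp: monomial_span_def poly_ring_def)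

lemma hom_part_monomial_ideal: "p \<in> monomial_span V F \<Longrightarrow> hom_part e p \<in> monomial_ideal V F e"
  by (rule monomial_idealI)
    (auto simp: lookup_hom_part monomial_span_def in_keys_iff dest: poly_ringD split: if_splits)

text \<open>The augmentation becomes stage 0, a matrix whose only row is 0, and differential
  \<open>i\<close> becomes stage \<open>Suc i\<close>. Exactness and homogeneity then have the same
  form at every stage.\<close>

definition res_col :: "('v, 'k::field) resolution \<Rightarrow> nat \<Rightarrow> nat \<Rightarrow> nat \<Rightarrow> ('v, 'k) mpoly" where
  "res_col F i c r = (case i of 0 \<Rightarrow> if r = 0 then res_aug F c else 0
     | Suc j \<Rightarrow> if r < res_rank F j then res_mat F j r c else 0)"

definition row_deg :: "('v, 'k::field) resolution \<Rightarrow> nat \<Rightarrow> nat \<Rightarrow> nat" where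
  "row_deg F i = (case i of 0 \<Rightarrow> \<lambda>_. 0 | Suc j \<Rightarrow> res_deg F j)"

lemma lin_comb_res_col_0: "lin_comb (res_rank F 0) (res_col F 0) w = (\<lambda>r. if r = 0 then aug_map F w else 0)"
  by (auto simp: lin_comb_def res_col_def aug_map_def fun_eq_iff)

lemma lin_comb_res_col_Suc: "lin_comb (res_rank F (Suc i)) (res_col F (Suc i)) w = diff_map F i w"
  by (auto simp: lin_comb_def res_col_def diff_map_def fun_eq_iff)

lemma graded_maps_iff:
  fixes F :: "('v, 'k::field) resolution"
  shows "graded_maps V F \<longleftrightarrow>
     (\<forall>i c r. c < res_rank F i \<longrightarrow> res_col F i c r \<in> homogeneous V (int (res_deg F i c) - int (row_deg F i r)))"
proof -
  have hom: "p \<in> homogeneous V (int a - int b) \<longleftrightarrow> p \<in> poly_ring V \<and> (\<forall>m\<in>Poly_Mapping.keys p. mon_deg m + b = a)"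
    for p :: "('v, 'k) mpoly" and a b
    by (auto simp: monomial_ideal_def monomials_of_degree_def poly_ring_def)
  have zero_in: "(0 :: ('v, 'k) mpoly) \<in> poly_ring V" by (simp add: poly_ring_def)
  have all: "(\<forall>i. P i) \<longleftrightarrow> P 0 \<and> (\<forall>i. P (Suc i))" for P :: "nat \<Rightarrow> bool"
    by (metis not0_implies_Suc)
  show ?thesis
    unfolding graded_maps_def hom
    by (subst all[of "\<lambda>i. \<forall>c r. c < res_rank F i \<longrightarrow> _ i c r"])
      (auto simp: res_col_def row_deg_def zero_in)
qed

lemma graded_free_resolution_iff:
  fixes F :: "('v, 'k::field) resolution"
  shows "graded_free_resolution V I F \<longleftrightarrow> graded_maps V F \<and> aug_map F ` free_mod V (res_rank F 0) = I \<and>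
     (\<forall>i. {w \<in> free_mod V (res_rank F i). lin_comb (res_rank F i) (res_col F i) w = 0}
        = lin_comb (res_rank F (Suc i)) (res_col F (Suc i)) ` free_mod V (res_rank F (Suc i)))"
proof -
  have all: "(\<forall>i. P i) \<longleftrightarrow> P 0 \<and> (\<forall>i. P (Suc i))" for P :: "nat \<Rightarrow> bool"
    by (metis not0_implies_Suc)
  have 0: "lin_comb (res_rank F 0) (res_col F 0) w = 0 \<longleftrightarrow> aug_map F w = 0" for w
    unfolding lin_comb_res_col_0 by (auto simp: fun_eq_iff)
  have image: "lin_comb (res_rank F (Suc i)) (res_col F (Suc i)) ` A = diff_map F i ` A" for i A
    by (simp add: lin_comb_res_col_Suc)
  have zero: "(\<lambda>_. 0) = (0 :: nat \<Rightarrow> ('v, 'k) mpoly)" by (simp add: fun_eq_iff)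
  show ?thesis
    unfolding graded_free_resolution_def image zero
    by (subst all[of "\<lambda>i. {w \<in> free_mod V (res_rank F i). lin_comb (res_rank F i) (res_col F i) w = 0} = _ i"])
      (simp add: 0 lin_comb_res_col_Suc)
qed

section \<open>From minimal resolutions to regularity\<close>

context koszul_signs begin

context
  fixes F :: "'v set \<Rightarrow> bool"
  assumes mono: "\<And>A B. A \<subseteq> B \<Longrightarrow> F A \<Longrightarrow> F B"
begin

abbreviation ideal_module :: "int \<Rightarrow> (nat \<Rightarrow> ('v, 'k::field) mpoly) set" where
  "ideal_module \<equiv> direct_sum (Suc 0) (\<lambda>_. monomial_ideal V F)"

lemma ideal_module_iff: "w \<in> ideal_module e \<longleftrightarrow> w 0 \<in> monomial_ideal V F e \<and> (\<forall>r>0. w r = 0)"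
  by (auto simp: direct_sum_def)

lemma ideal_moduleD:
  assumes "w \<in> ideal_module e"
  shows "w 0 \<in> monomial_ideal V F e" "r > 0 \<Longrightarrow> w r = 0"
proof -
  note * = assms[unfolded ideal_module_iff]
  show "w 0 \<in> monomial_ideal V F e" by (rule conjunct1[OF *])
  show "r > 0 \<Longrightarrow> w r = 0" by (rule conjunct2[OF *, rule_format])
qed

text \<open>Homogeneous components of the exact sequence are exact, so the given resolution splits
  into the graded syzygy sequences required by \<open>betti_iff_koszul\<close>.\<close>

lemma minimal_resolution_betti:
  fixes R :: "('v, 'k::field) resolution"
  assumes R: "minimal_graded_free_resolution V (monomial_span V F) R"
  shows "(\<exists>c<res_rank R i. int (res_deg R i c) = e + int i) \<longleftrightarrow>
    \<not> koszul_exact (\<lambda>v (p::('v, 'k) mpoly). var v * p) (monomial_ideal V F) i e"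
proof -
  let ?n = "res_rank R" and ?d = "res_deg R" and ?g = "res_col R"
  have res: "graded_free_resolution V (monomial_span V F) R"
    and min: "\<And>i r c. r < ?n i \<Longrightarrow> c < ?n (Suc i) \<Longrightarrow> Poly_Mapping.lookup (res_mat R i r c) 0 = 0"
    using R by (auto simp: minimal_graded_free_resolution_def)
  have aug: "aug_map R ` free_mod V (?n 0) = monomial_span V F"
    and exact: "\<And>i. {w \<in> free_mod V (?n i). lin_comb (?n i) (?g i) w = 0}
        = lin_comb (?n (Suc i)) (?g (Suc i)) ` free_mod V (?n (Suc i))"
    and hom: "\<And>i c r. c < ?n i \<Longrightarrow> ?g i c r \<in> homogeneous V (int (?d i c) - int (row_deg R i r))"
  proof -
    note res' = res[unfolded graded_free_resolution_iff graded_maps_iff]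
    show "aug_map R ` free_mod V (?n 0) = monomial_span V F" by (rule conjunct1[OF conjunct2[OF res']])
    show "{w \<in> free_mod V (?n i). lin_comb (?n i) (?g i) w = 0}
        = lin_comb (?n (Suc i)) (?g (Suc i)) ` free_mod V (?n (Suc i))" for i
      by (rule spec[OF conjunct2[OF conjunct2[OF res']]])
    show "?g i c r \<in> homogeneous V (int (?d i c) - int (row_deg R i r))" if "c < ?n i" for i c r
      using conjunct1[OF res'] that by blast
  qed
  have part: "graded_part (row_deg R i) e (lin_comb (?n i) (?g i) w)
      = lin_comb (?n i) (?g i) (graded_part (?d i) e w)" for i e w
    by (rule graded_part_lin_comb) (rule hom)
  define N where "N i e = (case i of 0 \<Rightarrow> ideal_module e
      | Suc j \<Rightarrow> {w \<in> free_graded V (?n j) (?d j) e. lin_comb (?n j) (?g j) w = 0})" for i e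
  have N0: "N 0 = ideal_module" by (auto simp: N_def fun_eq_iff)
  have kernel: "N (Suc i) e = {w \<in> free_graded V (?n i) (?d i) e. lin_comb (?n i) (?g i) w = 0}" for i e
    by (simp add: N_def)
  have surj: "lin_comb (?n i) (?g i) ` free_graded V (?n i) (?d i) e = N i e" for i e
  proof (cases i)
    case 0
    show ?thesis
    proof (intro set_eqI iffI)
      fix z assume "z \<in> lin_comb (?n i) (?g i) ` free_graded V (?n i) (?d i) e"
      then obtain w where w: "w \<in> free_graded V (?n 0) (?d 0) e" "z = lin_comb (?n 0) (?g 0) w" using 0 by auto
      have z: "z = (\<lambda>r. if r = 0 then aug_map R w else 0)" using w(2) by (simp add: lin_comb_res_col_0)
      have "graded_part (row_deg R 0) e z = z"
        unfolding w(2) part graded_part_eq[OF w(1)] ..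
      then have "graded_part (row_deg R 0) e z 0 = z 0" by simp
      then have "hom_part e (aug_map R w) = aug_map R w"
        by (simp add: z graded_part_def row_deg_def)
      moreover have "aug_map R w \<in> monomial_span V F"
        unfolding aug[symmetric] by (rule imageI) (rule free_graded_free_mod[OF w(1)])
      ultimately have "aug_map R w \<in> monomial_ideal V F e"
        using hom_part_monomial_ideal by metis
      then show "z \<in> N i e" by (simp add: 0 N0 ideal_module_iff z)
    next
      fix z assume "z \<in> N i e"
      then have "z \<in> ideal_module e" by (simp only: 0 N0)
      note z = ideal_moduleD[OF this]
      from z(1) have "z 0 \<in> monomial_span V F" by (simp add: monomial_ideal_span)
      then have "z 0 \<in> aug_map R ` free_mod V (?n 0)" by (simp only: aug)
      then obtain w where w: "w \<in> free_mod V (?n 0)" "z 0 = aug_map R w" by (elim imageE)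
      have z_eq: "z = lin_comb (?n 0) (?g 0) w"
        unfolding lin_comb_res_col_0 using z(2) w(2) by (auto simp: fun_eq_iff)
      have "z \<in> free_graded V (Suc 0) (row_deg R 0) e"
        unfolding free_graded_def
        by (rule direct_sumI) (use z in \<open>auto simp: monomial_ideal_span row_deg_def\<close>)
      then have "z = lin_comb (?n 0) (?g 0) (graded_part (?d 0) e w)"
        using graded_part_eq[of z] part[of 0 e w] z_eq by metis
      then show "z \<in> lin_comb (?n i) (?g i) ` free_graded V (?n i) (?d i) e"
        using graded_part_free_graded[OF w(1)] 0 by blast
    qed
  next
    case (Suc j)
    show ?thesis
    proof (intro set_eqI iffI)
      fix z assume "z \<in> lin_comb (?n i) (?g i) ` free_graded V (?n i) (?d i) e"
      then obtain w where w: "w \<in> free_graded V (?n i) (?d i) e" "z = lin_comb (?n i) (?g i) w" by auto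
      have zk: "z \<in> {w \<in> free_mod V (?n j). lin_comb (?n j) (?g j) w = 0}"
        unfolding exact w(2) Suc using free_graded_free_mod[OF w(1)] Suc by (intro imageI) simp
      have "z = graded_part (row_deg R i) e z"
        unfolding w(2) part graded_part_eq[OF w(1)] ..
      also have "\<dots> \<in> free_graded V (?n j) (?d j) e"
        using graded_part_free_graded[of z V "?n j" "?d j" e] zk by (simp add: Suc row_deg_def)
      finally show "z \<in> N i e" using zk by (simp add: Suc kernel)
    next
      fix z assume "z \<in> N i e"
      then have z: "z \<in> free_graded V (?n j) (?d j) e" "lin_comb (?n j) (?g j) z = 0" by (auto simp: Suc kernel)
      then have "z \<in> {w \<in> free_mod V (?n j). lin_comb (?n j) (?g j) w = 0}"
        using free_graded_free_mod by simp
      then obtain w where w: "w \<in> free_mod V (?n i)" "z = lin_comb (?n i) (?g i) w"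
        unfolding exact Suc by (elim imageE)
      have "z = graded_part (row_deg R i) e z"
        using graded_part_eq[OF z(1)] by (simp add: Suc row_deg_def)
      also have "\<dots> = lin_comb (?n i) (?g i) (graded_part (?d i) e w)"
        unfolding w(2) part ..
      finally show "z \<in> lin_comb (?n i) (?g i) ` free_graded V (?n i) (?d i) e"
        using graded_part_free_graded[OF w(1)] by blast
    qed
  qed
  \<comment> \<open>Syzygies are images under a matrix whose entries have no constant terms.\<close>
  have minimal: "Poly_Mapping.lookup (w r) 0 = 0" if w: "w \<in> N (Suc i) e" for i e w r
  proof -
    obtain u where "w = lin_comb (?n (Suc i)) (?g (Suc i)) u" using w unfolding surj[symmetric] by (elim imageE)
    moreover have "Poly_Mapping.lookup (?g (Suc i) c r * u c) 0 = 0" if "c < ?n (Suc i)" for c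
      by (rule lookup_mult_0) (use min that in \<open>auto simp: res_col_def\<close>)
    ultimately show ?thesis by (simp add: lin_comb_def lookup_sum)
  qed
  have "(\<exists>c<?n i. int (?d i c) = e + int i) \<longleftrightarrow> \<not> koszul_exact (\<lambda>v. vec_mult (var v)) (N 0) i e"
  proof (rule betti_iff_koszul)
    show "lin_comb (?n i) (?g i) ` free_graded V (?n i) (?d i) e = N i e" for i e by (rule surj)
    show "N (Suc i) e = {w \<in> free_graded V (?n i) (?d i) e. lin_comb (?n i) (?g i) w = 0}" for i e
      by (rule kernel)
    show "w \<in> N (Suc i) e \<Longrightarrow> Poly_Mapping.lookup (w r) 0 = 0" for i e w r by (rule minimal)
  qed
  then show ?thesis unfolding N0 koszul_exact_direct_sum_1 .
qed

text \<open>Needed because \<open>graded_betti\<close> inspects a chosen resolution. The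
  construction is exact in each degree; exactness for arbitrary vectors follows by splitting them
  into finitely many homogeneous parts.\<close>

lemma minimal_graded_free_resolution_exists:
  assumes exact: "\<And>i e. int i + e > int l \<Longrightarrow>
    koszul_exact (\<lambda>v (p::('v, 'k::field) mpoly). var v * p) (monomial_ideal V F) i e"
  shows "\<exists>R::('v, 'k) resolution. minimal_graded_free_resolution V (monomial_span V F) R"
proof -
  let ?I = "ideal_module :: int \<Rightarrow> (nat \<Rightarrow> ('v, 'k) mpoly) set"
  have I_free: "?I e \<subseteq> free_graded V (Suc 0) (\<lambda>_. 0) e" for e
    unfolding free_graded_def by (auto simp: direct_sum_def monomial_ideal_span)
  have I_module: "graded_module V ?I"
    unfolding graded_module_def
  proof (intro allI conjI ballI)
    fix e a w w' and p :: "('v, 'k) mpoly" assume w: "w \<in> ?I e"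
    show "w' \<in> ?I e \<Longrightarrow> w + w' \<in> ?I e"
      using w by (auto simp: ideal_module_iff intro: monomial_ideal_add)
    show "p \<in> homogeneous V a \<Longrightarrow> vec_mult p w \<in> ?I (e + a)"
      using w monomial_ideal_mult[of F p V a "w 0" e, OF mono]
      by (auto simp: ideal_module_iff vec_mult_def add.commute)
  qed (auto simp: ideal_module_iff monomial_ideal_0)
  obtain n d g N where N0: "N 0 = ?I"
    and surj: "\<And>i e. lin_comb (n i) (g i) ` free_graded V (n i) (d i) e = N i e"
    and kernel: "\<And>i e. N (Suc i) e = {w \<in> free_graded V (n i) (d i) e. lin_comb (n i) (g i) w = 0}"
    and minimal: "\<And>i e w r. w \<in> N (Suc i) e \<Longrightarrow> Poly_Mapping.lookup (w r) 0 = 0"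
    by (rule minimal_resolution_exists[OF I_module I_free, of l])
      (use exact koszul_exact_direct_sum_1 in blast)+
  define R :: "('v, 'k) resolution" where
    "R = \<lparr>res_rank = n, res_deg = d, res_aug = \<lambda>c. g 0 c 0, res_mat = \<lambda>i r c. g (Suc i) c r\<rparr>"
  have R_simps [simp]: "res_rank R = n" "res_deg R = d" "res_aug R = (\<lambda>c. g 0 c 0)"
      "res_mat R = (\<lambda>i r c. g (Suc i) c r)"
    by (simp_all add: R_def)
  have gN: "g i c \<in> N i (int (d i c))" if c: "c < n i" for i c
  proof -
    define u :: "nat \<Rightarrow> ('v, 'k) mpoly" where "u r = (if r = c then 1 else 0)" for r
    have "u \<in> free_graded V (n i) (d i) (int (d i c))"
      unfolding free_graded_def
      by (rule direct_sumI) (use c one_homogeneous monomial_ideal_0 in \<open>auto simp: u_def\<close>)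
    moreover have "lin_comb (n i) (g i) u = g i c"
    proof
      fix r
      have "lin_comb (n i) (g i) u r = (\<Sum>a<n i. if a = c then g i c r else 0)"
        unfolding lin_comb_def by (intro sum.cong) (auto simp: u_def)
      then show "lin_comb (n i) (g i) u r = g i c r" using c by simp
    qed
    ultimately show ?thesis unfolding surj[symmetric] by (metis imageI)
  qed
  have g_free: "g (Suc i) c \<in> free_graded V (n i) (d i) (int (d (Suc i) c))" if "c < n (Suc i)" for i c
    using gN[OF that] unfolding kernel by simp
  have g0: "g 0 c 0 \<in> monomial_ideal V F (int (d 0 c))" "r > 0 \<Longrightarrow> g 0 c r = 0" if "c < n 0" for c r
    using ideal_moduleD[OF gN[OF that, unfolded N0]] by simp_all
  have col: "res_col R i c = g i c" if "c < n i" for i c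
  proof (cases i)
    case 0
    then show ?thesis using g0[of c] that by (auto simp: res_col_def fun_eq_iff)
  next
    case (Suc j)
    then show ?thesis
      using direct_sum_out[OF g_free[of c j, unfolded free_graded_def]] that by (auto simp: res_col_def fun_eq_iff)
  qed
  have lc: "lin_comb (n i) (res_col R i) w = lin_comb (n i) (g i) w" for i w
    by (rule lin_comb_cong) (rule col)
  have hom: "res_col R i c r \<in> homogeneous V (int (d i c) - int (row_deg R i r))" if c: "c < n i" for i c r
  proof (cases i)
    case 0
    then show ?thesis
      using g0[of c] c unfolding col[OF c] by (cases "r = 0") (auto simp: row_deg_def monomial_ideal_span monomial_ideal_0)
  next
    case (Suc j)
    then show ?thesis
      using direct_sum_in[OF g_free[of c j, unfolded free_graded_def], of r]
        direct_sum_out[OF g_free[of c j, unfolded free_graded_def], of r] c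
      unfolding col[OF c] by (cases "r < n j") (auto simp: row_deg_def monomial_ideal_0)
  qed
  have image: "lin_comb (n i) (g i) w \<in> {z. \<exists>E f. finite E \<and> z = (\<Sum>e\<in>E. f e) \<and> (\<forall>e\<in>E. f e \<in> N i e)}"
    if w: "w \<in> free_mod V (n i)" for i w
  proof -
    obtain E where E: "finite E" "w = (\<Sum>e\<in>E. graded_part (d i) e w)" using sum_graded_parts[OF w] .
    have "lin_comb (n i) (g i) w = (\<Sum>e\<in>E. lin_comb (n i) (g i) (graded_part (d i) e w))"
      by (subst E(2)) (simp only: lin_comb_sum)
    moreover have "lin_comb (n i) (g i) (graded_part (d i) e w) \<in> N i e" for e
      unfolding surj[symmetric] by (rule imageI) (rule graded_part_free_graded[OF w])
    ultimately show ?thesis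
      by (intro CollectI exI[of _ E] exI[of _ "\<lambda>e. lin_comb (n i) (g i) (graded_part (d i) e w)"]) (simp add: E(1))
  qed
  have preimage: "(\<Sum>e\<in>E. f e) \<in> lin_comb (n i) (g i) ` free_mod V (n i)"
    if f: "\<And>e. e \<in> E \<Longrightarrow> f e \<in> N i e" for E f i
  proof -
    have "\<forall>e\<in>E. \<exists>u. u \<in> free_graded V (n i) (d i) e \<and> f e = lin_comb (n i) (g i) u"
    proof
      fix e assume "e \<in> E"
      then have "f e \<in> lin_comb (n i) (g i) ` free_graded V (n i) (d i) e" unfolding surj by (rule f)
      then show "\<exists>u. u \<in> free_graded V (n i) (d i) e \<and> f e = lin_comb (n i) (g i) u" by (elim imageE) metis
    qed
    then obtain u where u: "\<forall>e\<in>E. u e \<in> free_graded V (n i) (d i) e \<and> f e = lin_comb (n i) (g i) (u e)"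
      by (rule bchoice[THEN exE])
    have "(\<Sum>e\<in>E. f e) = lin_comb (n i) (g i) (\<Sum>e\<in>E. u e)"
      unfolding lin_comb_sum by (rule sum.cong) (use u in auto)
    moreover have "(\<Sum>e\<in>E. u e) \<in> free_mod V (n i)"
    proof (rule free_mod_sum)
      fix e assume "e \<in> E"
      then show "u e \<in> free_mod V (n i)" using free_graded_free_mod[OF conjunct1[OF bspec[OF u]]] by simp
    qed
    ultimately show ?thesis by (simp only: imageI)
  qed
  have "aug_map R ` free_mod V (n 0) = monomial_span V F"
  proof (intro set_eqI iffI)
    fix p assume "p \<in> aug_map R ` free_mod V (n 0)"
    then obtain w where w: "w \<in> free_mod V (n 0)" "p = aug_map R w" by (elim imageE)
    obtain E f where E: "lin_comb (n 0) (g 0) w = (\<Sum>e\<in>E. f e)" "\<forall>e\<in>E. f e \<in> N 0 e"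
      using image[OF w(1)] by auto
    have "p = lin_comb (n 0) (g 0) w 0"
      using fun_cong[OF lin_comb_res_col_0[of R w], of 0] lc[of 0 w] w(2) by simp
    also have "\<dots> = (\<Sum>e\<in>E. f e 0)" by (simp add: E(1) sum_apply)
    also have "\<dots> \<in> monomial_span V F"
    proof (rule monomial_span_sum)
      fix e assume "e \<in> E"
      then have "f e \<in> ideal_module e" using E(2) unfolding N0 by simp
      then show "f e 0 \<in> monomial_span V F" by (rule monomial_ideal_span(2)[OF ideal_moduleD(1)])
    qed
    finally show "p \<in> monomial_span V F" .
  next
    fix p :: "('v, 'k) mpoly" assume p: "p \<in> monomial_span V F"
    define z where "z r = (if r = 0 then p else 0)" for r :: nat
    have "z \<in> free_mod V (Suc 0)" using p by (auto simp: z_def free_mod_def monomial_span_def)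
    then obtain E where E: "z = (\<Sum>e\<in>E. graded_part (\<lambda>_. 0) e z)" using sum_graded_parts[of z V "Suc 0" "\<lambda>_. 0"] by blast
    have "graded_part (\<lambda>_. 0) e z \<in> N 0 e" for e
      using hom_part_monomial_ideal[OF p] by (simp add: N0 ideal_module_iff graded_part_def z_def)
    then have "z \<in> lin_comb (n 0) (g 0) ` free_mod V (n 0)" by (subst E) (rule preimage)
    then obtain w where w: "w \<in> free_mod V (n 0)" "z = lin_comb (n 0) (g 0) w" by (elim imageE)
    have "aug_map R w = p"
      using fun_cong[OF lin_comb_res_col_0[of R w], of 0] lc[of 0 w] w(2)[symmetric] by (simp add: z_def)
    then show "p \<in> aug_map R ` free_mod V (n 0)" using w(1) by (metis imageI)
  qed
  moreover have "{w \<in> free_mod V (n i). lin_comb (n i) (res_col R i) w = 0}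
      = lin_comb (n (Suc i)) (res_col R (Suc i)) ` free_mod V (n (Suc i))" for i
    unfolding lc
  proof (intro set_eqI iffI)
    fix z assume "z \<in> lin_comb (n (Suc i)) (g (Suc i)) ` free_mod V (n (Suc i))"
    then obtain w where w: "w \<in> free_mod V (n (Suc i))" "z = lin_comb (n (Suc i)) (g (Suc i)) w" by (elim imageE)
    obtain E f where E: "z = (\<Sum>e\<in>E. f e)" "\<forall>e\<in>E. f e \<in> N (Suc i) e"
      using image[OF w(1)] w(2) by auto
    have "z \<in> free_mod V (n i)"
      unfolding E(1)
    proof (rule free_mod_sum)
      fix e assume "e \<in> E"
      then have "f e \<in> free_graded V (n i) (d i) e" using E(2) kernel by simp
      then show "f e \<in> free_mod V (n i)" by (rule free_graded_free_mod)
    qed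
    moreover have "lin_comb (n i) (g i) z = 0"
      unfolding E(1) lin_comb_sum by (rule sum.neutral) (use E(2) kernel in simp)
    ultimately show "z \<in> {w \<in> free_mod V (n i). lin_comb (n i) (g i) w = 0}" by simp
  next
    fix z assume "z \<in> {w \<in> free_mod V (n i). lin_comb (n i) (g i) w = 0}"
    then have z: "z \<in> free_mod V (n i)" "lin_comb (n i) (g i) z = 0" by auto
    obtain E where E: "z = (\<Sum>e\<in>E. graded_part (d i) e z)" using sum_graded_parts[OF z(1)] by blast
    have "graded_part (d i) e z \<in> N (Suc i) e" for e
    proof -
      have "lin_comb (n i) (res_col R i) (graded_part (d i) e z) = graded_part (row_deg R i) e (lin_comb (n i) (res_col R i) z)"
        by (rule graded_part_lin_comb[symmetric]) (rule hom)
      then show ?thesis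
        using graded_part_free_graded[OF z(1)] z(2) by (simp add: kernel lc)
    qed
    then show "z \<in> lin_comb (n (Suc i)) (g (Suc i)) ` free_mod V (n (Suc i))"
      by (subst E) (rule preimage)
  qed
  moreover have "graded_maps V R" using hom by (simp add: graded_maps_iff)
  moreover have "Poly_Mapping.lookup (g (Suc i) c r) 0 = 0" if "c < n (Suc i)" for i r c
    by (rule minimal[OF gN[OF that]])
  ultimately have "minimal_graded_free_resolution V (monomial_span V F) R"
    unfolding minimal_graded_free_resolution_def graded_free_resolution_iff by simp
  then show ?thesis by blast
qed

theorem regularity_monomial_span:
  assumes upper: "reg_le TYPE('k::field) F V l"
    and lower: "W \<subseteq> V" "card W = i0 + l" "\<not> exact_sets TYPE('k) F W i0"
  shows "regularity V (monomial_span V F :: ('v, 'k) mpoly set) = int l"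
proof -
  let ?K = "\<lambda>i e. koszul_exact (\<lambda>v (p::('v, 'k) mpoly). var v * p) (monomial_ideal V F) i e"
  have up: "?K i e" if "e > int l" for i e
  proof (rule koszul_exact_monomial_ideal[OF mono])
    fix W assume W: "W \<subseteq> V" "int (card W) = int i + e"
    then have "card W > l + i" using that by simp
    then show "exact_sets TYPE('k) F W i" using upper W(1) unfolding reg_le_def by blast
  qed
  \<comment> \<open>No multidegree has more than \<open>card V\<close> variables. This supplies the
    degree bound for the existence of the resolution.\<close>
  have large: "?K i e" if "int i + e > int (card V)" for i e
  proof (rule koszul_exact_monomial_ideal[OF mono])
    fix W assume "W \<subseteq> V" "int (card W) = int i + e"
    then show "exact_sets TYPE('k) F W i" using that card_mono[OF finite_V, of W] by linarith
  qed
  \<comment> \<open>There are no polynomials of negative degree. This bounds the set of differences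
    from below and lets each of them be written with natural numbers \<open>i\<close> and
    \<open>j\<close>.\<close>
  have neg: "?K i e" if "e < 0" for i e
    unfolding koszul_exact_def
  proof (intro ballI impI)
    fix c :: "'v set \<Rightarrow> ('v, 'k) mpoly" assume c: "c \<in> koszul_chains V i (\<lambda>_. monomial_ideal V F e)"
    have "c = (\<lambda>_. 0)"
    proof
      fix \<tau> show "c \<tau> = 0"
      proof (cases "\<tau> \<subseteq> V \<and> card \<tau> = i")
        case True
        then have "c \<tau> \<in> monomial_ideal V F e" using chains_in[OF c, of \<tau>] by blast
        then show ?thesis using homogeneous_negative that by blast
      qed (rule chains_out[OF c])
    qed
    then show "\<exists>b\<in>koszul_chains V (Suc i) (\<lambda>_. monomial_ideal V F (e - 1)). bd (\<lambda>v p. var v * p) V b = c"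
      using bd_zero[OF operators_var] by (intro bexI[of _ "\<lambda>_. 0"]) (auto intro: chainsI monomial_ideal_0)
  qed
  define R where "R = (SOME R::('v, 'k) resolution. minimal_graded_free_resolution V (monomial_span V F) R)"
  have "minimal_graded_free_resolution V (monomial_span V F) R"
    unfolding R_def by (rule someI_ex, rule minimal_graded_free_resolution_exists[OF large])
  note betti = minimal_resolution_betti[OF this]
  have "graded_betti V (monomial_span V F :: ('v, 'k) mpoly set) i j \<noteq> 0 \<longleftrightarrow> (\<exists>c<res_rank R i. res_deg R i c = j)" for i j
    by (auto simp: graded_betti_def R_def[symmetric] card_eq_0_iff)
  then have "graded_betti V (monomial_span V F :: ('v, 'k) mpoly set) i j \<noteq> 0 \<longleftrightarrow> \<not> ?K i (int j - int i)" for i j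
    unfolding betti[symmetric] by simp
  then have "{int j - int i |i j. graded_betti V (monomial_span V F :: ('v, 'k) mpoly set) i j \<noteq> 0}
      = {int j - int i |i j. \<not> ?K i (int j - int i)}" by simp
  also have "\<dots> = {e. \<exists>i. \<not> ?K i e}"
  proof (intro set_eqI iffI)
    fix e assume "e \<in> {e. \<exists>i. \<not> ?K i e}"
    then obtain i where i: "\<not> ?K i e" by auto
    then have "e \<ge> 0" by (rule contrapos_np) (simp add: neg)
    then have "e = int (nat e + i) - int i" by simp
    then show "e \<in> {int j - int i |i j. \<not> ?K i (int j - int i)}" using i by (intro CollectI exI[of _ i] exI[of _ "nat e + i"]) simp
  qed auto
  finally have set_eq: "{int j - int i |i j. graded_betti V (monomial_span V F :: ('v, 'k) mpoly set) i j \<noteq> 0}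
      = {e. \<exists>i. \<not> ?K i e}" .
  have sub: "{e. \<exists>i. \<not> ?K i e} \<subseteq> {0..int l}"
  proof
    fix e assume "e \<in> {e. \<exists>i. \<not> ?K i e}"
    then obtain i where i: "\<not> ?K i e" by auto
    then have "\<not> e < 0" "\<not> e > int l" using neg[of e i] up[of e i] by argo+
    then show "e \<in> {0..int l}" by simp
  qed
  then have fin: "finite {e. \<exists>i. \<not> ?K i e}" by (rule finite_subset) simp
  have "\<not> ?K i0 (int l)"
  proof
    assume "?K i0 (int l)"
    then have "exact_sets TYPE('k) F W i0"
      by (rule exact_sets_of_koszul_exact[OF _ lower(1)]) (simp add: lower(2))
    then show False using lower(3) by simp
  qed
  then have "int l \<in> {e. \<exists>i. \<not> ?K i e}" by auto
  then show ?thesis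
    unfolding regularity_def set_eq using sub fin by (intro Max_eqI) auto
qed

end

end

section \<open>Transversal cycles and the square-free square\<close>


text \<open>The usual sign, determined by the number of smaller elements, for any injective
  numbering.\<close>

lemma koszul_signs_of_order:
  fixes ord :: "'v \<Rightarrow> nat"
  assumes V: "finite V" and inj: "inj_on ord V"
  shows "koszul_signs V (\<lambda>v \<tau>. even (card {u \<in> \<tau>. ord u < ord v}))"
proof
  fix u v \<tau> assume *: "u \<in> V" "v \<in> V" "\<tau> \<subseteq> V" "u \<noteq> v" "u \<notin> \<tau>" "v \<notin> \<tau>"
  have fin: "finite {x \<in> \<tau>. ord x < a}" for a using V *(3) finite_subset by fastforce
  have ins: "card {x \<in> insert y \<tau>. ord x < a} = card {x \<in> \<tau>. ord x < a} + (if ord y < a then 1 else 0)"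
    if "y \<notin> \<tau>" for y a
  proof (cases "ord y < a")
    case True
    then have "{x \<in> insert y \<tau>. ord x < a} = insert y {x \<in> \<tau>. ord x < a}" by auto
    then show ?thesis using True fin that by simp
  next
    case False
    then have "{x \<in> insert y \<tau>. ord x < a} = {x \<in> \<tau>. ord x < a}" by auto
    then show ?thesis using False by simp
  qed
  have "ord u \<noteq> ord v" using inj * by (meson inj_onD)
  then consider "ord u < ord v" | "ord v < ord u" by linarith
  then show "(even (card {x \<in> insert v \<tau>. ord x < ord u}) = even (card {x \<in> \<tau>. ord x < ord v})) \<longleftrightarrow>
      (even (card {x \<in> insert u \<tau>. ord x < ord v}) \<noteq> even (card {x \<in> \<tau>. ord x < ord u}))"
    unfolding ins[OF *(5)] ins[OF *(6)] by cases auto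
qed (rule V)

context koszul_signs begin

text \<open>
  The cycle is the boundary of the simplex spanned by one vertex of \<open>S\<close> and one vertex of each pair.  It is
  detected by the cocycle that sums the coefficients of all sets meeting every pair in exactly one vertex.
\<close>

lemma not_exact_transversals:
  fixes p q :: "'l \<Rightarrow> 'v" and F :: "'v set \<Rightarrow> bool"
  assumes L: "finite L" and W: "W \<subseteq> V" "W = S \<union> p ` L \<union> q ` L"
    and inj: "inj_on p L" "inj_on q L" "p ` L \<inter> q ` L = {}" "S \<inter> p ` L = {}" "S \<inter> q ` L = {}"
    and s0: "s0 \<in> S"
    and swap: "\<And>l \<rho>. l \<in> L \<Longrightarrow> \<rho> \<subseteq> W - {p l, q l} \<Longrightarrow> s (p l) (insert (q l) \<rho>) \<noteq> s (q l) (insert (p l) \<rho>)"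
    and faces: "\<And>v. v \<in> insert s0 (p ` L) \<Longrightarrow> F (W - (insert s0 (p ` L) - {v}))"
    and nonfaces: "\<And>\<tau> u. \<tau> \<subseteq> p ` L \<union> q ` L \<Longrightarrow> (\<And>l. l \<in> L \<Longrightarrow> p l \<in> \<tau> \<longleftrightarrow> q l \<notin> \<tau>) \<Longrightarrow> u \<in> S \<Longrightarrow>
      \<not> F (W - insert u \<tau>)"
  shows "\<not> exact_sets TYPE('k::field) F W (card L)"
proof
  assume exact: "exact_sets TYPE('k) F W (card L)"
  let ?X = "\<lambda>(_::'v) (a::'k). a"
  define \<sigma> where "\<sigma> = insert s0 (p ` L)"
  \<comment> \<open>The transversals: sets with exactly one vertex from each pair and none from
    \<open>S\<close>.\<close>
  define Tr where "Tr = {\<tau>. \<tau> \<subseteq> p ` L \<union> q ` L \<and> (\<forall>l\<in>L. p l \<in> \<tau> \<longleftrightarrow> q l \<notin> \<tau>)}"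
  have finW: "finite W" using W(1) finite_V finite_subset by blast
  have "Tr \<subseteq> Pow W" using W(2) by (auto simp: Tr_def)
  then have finTr: "finite Tr" by (rule finite_subset) (simp add: finW)
  \<comment> \<open>The simplex on \<open>s0\<close> and all \<open>p l\<close>. It need not be a
    face; only its proper faces have to be.\<close>
  define x where "x \<tau> = (if \<tau> = \<sigma> then 1 else 0 :: 'k)" for \<tau>
  define c where "c = bd ?X W x"
  have s0p: "s0 \<notin> p ` L" using s0 inj(4) by blast
  have \<sigma>: "\<sigma> \<subseteq> W" "card \<sigma> = Suc (card L)"
    using s0 W(2) s0p L card_image[OF inj(1)] by (auto simp: \<sigma>_def)
  have pq: "p l \<noteq> q l'" if "l \<in> L" "l' \<in> L" for l l' using that inj(3) by blast
  have c_nz: "\<exists>v. v \<in> \<sigma> \<and> \<rho> = \<sigma> - {v}" if nz: "c \<rho> \<noteq> 0" for \<rho>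
  proof -
    have "\<exists>v\<in>W - \<rho>. insert v \<rho> = \<sigma>"
    proof (rule ccontr)
      assume "\<not> ?thesis"
      then have "c \<rho> = 0" by (auto simp: c_def bd_def x_def intro!: sum.neutral)
      then show False using nz by simp
    qed
    then obtain v where "v \<notin> \<rho>" "insert v \<rho> = \<sigma>" by blast
    then show ?thesis by (intro exI[of _ v]) auto
  qed
  have "c \<in> complex W (card L) (\<lambda>\<tau>. F (W - \<tau>))"
  proof (unfold complex_iff, intro allI impI)
    fix \<rho> assume "c \<rho> \<noteq> 0"
    then obtain v where v: "v \<in> \<sigma>" "\<rho> = \<sigma> - {v}" using c_nz by blast
    have "F (W - (\<sigma> - {v}))" using faces v(1) by (simp add: \<sigma>_def)
    then show "\<rho> \<subseteq> W \<and> card \<rho> = card L \<and> F (W - \<rho>)"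
      using v \<sigma> by (auto simp: card_Diff_singleton)
  qed
  moreover have "bd ?X W c = (\<lambda>_. 0)" unfolding c_def by (rule bd_bd[OF operators_id W(1)])
  ultimately obtain b where b: "b \<in> complex W (Suc (card L)) (\<lambda>\<tau>. F (W - \<tau>))" "bd ?X W b = c"
    using exact_setsD[OF exact] by blast
  define other where "other l \<tau> = (if p l \<in> \<tau> then q l else p l)" for l \<tau>
  have rest: "W - \<tau> = S \<union> (\<lambda>l. other l \<tau>) ` L" "inj_on (\<lambda>l. other l \<tau>) L" "S \<inter> (\<lambda>l. other l \<tau>) ` L = {}"
    if \<tau>: "\<tau> \<in> Tr" for \<tau>
  proof -
    have t: "\<tau> \<subseteq> p ` L \<union> q ` L" "\<And>l. l \<in> L \<Longrightarrow> p l \<in> \<tau> \<longleftrightarrow> q l \<notin> \<tau>" using \<tau> by (auto simp: Tr_def)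
    have o: "other l \<tau> \<in> {p l, q l}" "other l \<tau> \<notin> \<tau>" if "l \<in> L" for l
      using t(2)[OF that] by (auto simp: other_def)
    have o': "v = other l \<tau>" if "l \<in> L" "v \<in> {p l, q l}" "v \<notin> \<tau>" for l v
      using t(2)[OF that(1)] that by (auto simp: other_def)
    show "S \<inter> (\<lambda>l. other l \<tau>) ` L = {}" using o(1) inj(4,5) by blast
    show "W - \<tau> = S \<union> (\<lambda>l. other l \<tau>) ` L"
    proof (intro set_eqI iffI)
      fix v assume "v \<in> W - \<tau>"
      then show "v \<in> S \<union> (\<lambda>l. other l \<tau>) ` L" using o' unfolding W(2) by blast
    next
      fix v assume "v \<in> S \<union> (\<lambda>l. other l \<tau>) ` L"
      then show "v \<in> W - \<tau>"
      proof
        assume "v \<in> S"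
        then show ?thesis using t(1) inj(4,5) unfolding W(2) by blast
      next
        assume "v \<in> (\<lambda>l. other l \<tau>) ` L"
        then show ?thesis using o unfolding W(2) by blast
      qed
    qed
    show "inj_on (\<lambda>l. other l \<tau>) L"
    proof (rule inj_onI)
      fix l l' assume l: "l \<in> L" "l' \<in> L" and eq: "other l \<tau> = other l' \<tau>"
      then show "l = l'"
        using pq[of l l'] pq[of l' l] inj_onD[OF inj(1) _ l] inj_onD[OF inj(2) _ l]
        unfolding other_def by (auto split: if_splits)
    qed
  qed
  define f where "f l \<tau> = sgn_act (s (other l \<tau>) \<tau>) (b (insert (other l \<tau>) \<tau>))" for l \<tau>
  \<comment> \<open>At a transversal the terms that add a vertex of \<open>S\<close> vanish, since
    the enlarged set is no face. Only additions of the missing partner in a pair remain.\<close>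
  have c_f: "c \<tau> = (\<Sum>l\<in>L. f l \<tau>)" if \<tau>: "\<tau> \<in> Tr" for \<tau>
  proof -
    have "\<tau> \<subseteq> W" using \<tau> W(2) by (auto simp: Tr_def)
    have zero: "b (insert u \<tau>) = 0" if "u \<in> S" for u
    proof (rule ccontr)
      assume "b (insert u \<tau>) \<noteq> 0"
      then have "F (W - insert u \<tau>)" using b(1) by (auto simp: complex_iff)
      then show False using nonfaces[of \<tau> u] \<tau> that by (auto simp: Tr_def)
    qed
    have finS: "finite S" "finite ((\<lambda>l. other l \<tau>) ` L)" using finW L W(2) by auto
    have "c \<tau> = (\<Sum>v\<in>S \<union> (\<lambda>l. other l \<tau>) ` L. sgn_act (s v \<tau>) (b (insert v \<tau>)))"
      using \<open>\<tau> \<subseteq> W\<close> by (simp add: b(2)[symmetric] bd_def rest(1)[OF \<tau>])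
    also have "\<dots> = (\<Sum>v\<in>(\<lambda>l. other l \<tau>) ` L. sgn_act (s v \<tau>) (b (insert v \<tau>)))"
      unfolding sum.union_disjoint[OF finS rest(3)[OF \<tau>]] by (simp add: zero)
    also have "\<dots> = (\<Sum>l\<in>L. f l \<tau>)"
      by (simp add: sum.reindex[OF rest(2)[OF \<tau>]] f_def)
    finally show ?thesis .
  qed
  \<comment> \<open>Exchanging \<open>p l\<close> with \<open>q l\<close> pairs the transversals.
    Both members acquire the same set when the partner is added, with opposite signs by
    \<open>swap\<close>.\<close>
  have pair: "(\<Sum>\<tau>\<in>Tr. f l \<tau>) = 0" if l: "l \<in> L" for l
  proof -
    let ?P = "{\<tau> \<in> Tr. p l \<in> \<tau>}" and ?Q = "{\<tau> \<in> Tr. p l \<notin> \<tau>}"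
    let ?h = "\<lambda>\<tau>. insert (q l) (\<tau> - {p l})"
    have ne: "p l \<noteq> q l" using pq l by blast
    have key: "\<And>l'. l' \<in> L \<Longrightarrow> l' \<noteq> l \<Longrightarrow> p l' \<noteq> p l \<and> q l' \<noteq> q l \<and> p l' \<noteq> q l \<and> q l' \<noteq> p l"
      using inj_onD[OF inj(1)] inj_onD[OF inj(2)] pq l by metis
    have bij: "bij_betw ?h ?P ?Q"
    proof (rule bij_betw_byWitness[where f' = "\<lambda>\<tau>. insert (p l) (\<tau> - {q l})"])
      show "\<forall>\<tau>\<in>?P. insert (p l) (?h \<tau> - {q l}) = \<tau>"
      proof
        fix \<tau> assume "\<tau> \<in> ?P"
        then have "p l \<in> \<tau>" "q l \<notin> \<tau>" using l by (auto simp: Tr_def)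
        then show "insert (p l) (?h \<tau> - {q l}) = \<tau>" using ne by blast
      qed
      show "\<forall>\<tau>\<in>?Q. ?h (insert (p l) (\<tau> - {q l})) = \<tau>"
      proof
        fix \<tau> assume "\<tau> \<in> ?Q"
        then have "p l \<notin> \<tau>" "q l \<in> \<tau>" using l by (auto simp: Tr_def)
        then show "?h (insert (p l) (\<tau> - {q l})) = \<tau>" using ne by blast
      qed
      show "?h ` ?P \<subseteq> ?Q"
      proof (intro image_subsetI CollectI conjI)
        fix \<tau> assume "\<tau> \<in> ?P"
        then have t: "\<tau> \<subseteq> p ` L \<union> q ` L" "\<And>l. l \<in> L \<Longrightarrow> p l \<in> \<tau> \<longleftrightarrow> q l \<notin> \<tau>" by (auto simp: Tr_def)
        have mem: "p l' \<in> ?h \<tau> \<longleftrightarrow> q l' \<notin> ?h \<tau>" if "l' \<in> L" for l'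
          using t(2)[OF that] key[OF that] ne by (cases "l' = l") auto
        have "?h \<tau> \<subseteq> p ` L \<union> q ` L" using t(1) l by blast
        then show "?h \<tau> \<in> Tr"
          unfolding Tr_def by (intro CollectI conjI ballI mem)
      qed (use ne in auto)
      show "(\<lambda>\<tau>. insert (p l) (\<tau> - {q l})) ` ?Q \<subseteq> ?P"
      proof (intro image_subsetI CollectI conjI)
        fix \<tau> assume "\<tau> \<in> ?Q"
        then have t: "\<tau> \<subseteq> p ` L \<union> q ` L" "\<And>l. l \<in> L \<Longrightarrow> p l \<in> \<tau> \<longleftrightarrow> q l \<notin> \<tau>" by (auto simp: Tr_def)
        have mem: "p l' \<in> insert (p l) (\<tau> - {q l}) \<longleftrightarrow> q l' \<notin> insert (p l) (\<tau> - {q l})" if "l' \<in> L" for l'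
          using t(2)[OF that] key[OF that] ne by (cases "l' = l") auto
        have "insert (p l) (\<tau> - {q l}) \<subseteq> p ` L \<union> q ` L" using t(1) l by blast
        then show "insert (p l) (\<tau> - {q l}) \<in> Tr"
          unfolding Tr_def by (intro CollectI conjI ballI mem)
      qed auto
    qed
    have "f l \<tau> + f l (?h \<tau>) = 0" if \<tau>: "\<tau> \<in> ?P" for \<tau>
    proof -
      define \<rho> where "\<rho> = \<tau> - {p l}"
      have t: "\<tau> \<subseteq> W" "p l \<in> \<tau>" "q l \<notin> \<tau>" using \<tau> l W(2) by (auto simp: Tr_def)
      have eq: "\<tau> = insert (p l) \<rho>" "?h \<tau> = insert (q l) \<rho>" and \<rho>: "\<rho> \<subseteq> W - {p l, q l}"
        using t by (auto simp: \<rho>_def)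
      have o: "other l \<tau> = q l" "other l (?h \<tau>) = p l" using t ne by (auto simp: other_def)
      have "s (p l) (insert (q l) \<rho>) = (\<not> s (q l) (insert (p l) \<rho>))" using swap[OF l \<rho>] by blast
      then show ?thesis
        unfolding f_def o by (simp add: eq(2) insert_commute[of "p l"]) (simp add: eq(1) insert_commute sgn_act_def)
    qed
    moreover have "(\<Sum>\<tau>\<in>Tr. f l \<tau>) = (\<Sum>\<tau>\<in>?P. f l \<tau>) + (\<Sum>\<tau>\<in>?Q. f l \<tau>)"
    proof -
      have "sum (f l) (?P \<union> ?Q) = sum (f l) ?P + sum (f l) ?Q"
        by (rule sum.union_disjoint) (simp_all add: finTr disjoint_iff)
      moreover have "?P \<union> ?Q = Tr" by blast
      ultimately show ?thesis by simp
    qed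
    moreover have "(\<Sum>\<tau>\<in>?Q. f l \<tau>) = (\<Sum>\<tau>\<in>?P. f l (?h \<tau>))"
      by (rule sum.reindex_bij_betw[OF bij, symmetric])
    ultimately show ?thesis by (simp add: sum.distrib[symmetric])
  qed
  have "(\<Sum>\<tau>\<in>Tr. c \<tau>) = (\<Sum>l\<in>L. \<Sum>\<tau>\<in>Tr. f l \<tau>)"
    by (subst sum.swap) (simp add: c_f)
  then have zero: "(\<Sum>\<tau>\<in>Tr. c \<tau>) = 0" by (simp add: pair)
  \<comment> \<open>Among the facets of the simplex only the one opposite \<open>s0\<close> is a
    transversal, so the sum over all transversals is a unit, while for a boundary it would be
    zero.\<close>
  have "(\<Sum>\<tau>\<in>Tr. c \<tau>) = (\<Sum>\<tau>\<in>{p ` L}. c \<tau>)"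
  proof (rule sum.mono_neutral_right[OF finTr])
    show "{p ` L} \<subseteq> Tr" using pq inj_onD[OF inj(1)] by (fastforce simp: Tr_def)
    show "\<forall>\<tau>\<in>Tr - {p ` L}. c \<tau> = 0"
    proof (rule ballI, rule ccontr)
      fix \<tau> assume \<tau>: "\<tau> \<in> Tr - {p ` L}" and "c \<tau> \<noteq> 0"
      then obtain v where v: "v \<in> \<sigma>" "\<tau> = \<sigma> - {v}" using c_nz by blast
      have "\<tau> \<subseteq> p ` L \<union> q ` L" using \<tau> by (simp add: Tr_def)
      then have "s0 \<notin> \<tau>" using s0 inj(4,5) by blast
      then have "v = s0" using v by (auto simp: \<sigma>_def)
      then show False using \<tau> v s0p by (auto simp: \<sigma>_def)
    qed
  qed
  also have "\<dots> = c (p ` L)" by simp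
  also have "\<dots> = (\<Sum>v\<in>W - p ` L. if v = s0 then sgn_act (s s0 (p ` L)) 1 else 0)"
  proof -
    have "insert v (p ` L) = \<sigma> \<longleftrightarrow> v = s0" if "v \<in> W - p ` L" for v
      using that s0p by (auto simp: \<sigma>_def)
    then show ?thesis using W(2) by (auto simp: c_def bd_def x_def intro!: sum.cong)
  qed
  also have "\<dots> = sgn_act (s s0 (p ` L)) 1" using finW s0 s0p W(2) by simp
  finally show False using zero by (simp add: sgn_act_def split: if_splits)
qed

end

text \<open>The predicate sees the whole exponent: membership in the square of the edge ideal does
  not depend on the support alone.\<close>

definition monomials_span :: "'v set \<Rightarrow> (('v \<Rightarrow>\<^sub>0 nat) \<Rightarrow> bool) \<Rightarrow> ('v, 'k::field) mpoly set" where
  "monomials_span V Q = {p \<in> poly_ring V. \<forall>m\<in>Poly_Mapping.keys p. Q m}"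

lemma monomials_span_keys: "monomials_span V (\<lambda>m. F (Poly_Mapping.keys m)) = monomial_span V F"
  by (simp add: monomials_span_def monomial_span_def)

lemma monomials_span_mult:
  fixes p q :: "('v, 'k::field) mpoly"
  assumes "\<And>m m'. Q m \<Longrightarrow> Q' m' \<Longrightarrow> Q'' (m + m')" and p: "p \<in> monomials_span V Q" and q: "q \<in> monomials_span V Q'"
  shows "p * q \<in> monomials_span V Q''"
proof -
  have "Poly_Mapping.keys m \<subseteq> V \<and> Q'' m" if m: "m \<in> Poly_Mapping.keys (p * q)" for m
  proof -
    obtain a b where ab: "m = a + b" "a \<in> Poly_Mapping.keys p" "b \<in> Poly_Mapping.keys q"
      using keys_mult[of p q] m by blast
    have "Poly_Mapping.keys a \<subseteq> V" "Q a" "Poly_Mapping.keys b \<subseteq> V" "Q' b"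
      using p q ab(2,3) unfolding monomials_span_def poly_ring_def by blast+
    then show ?thesis using assms(1)[of a b] unfolding ab(1) keys_add_nat by simp
  qed
  then show ?thesis unfolding monomials_span_def poly_ring_def by blast
qed

lemma monomials_span_sum:
  fixes f :: "'a \<Rightarrow> ('v, 'k::field) mpoly"
  shows "(\<And>x. x \<in> A \<Longrightarrow> f x \<in> monomials_span V Q) \<Longrightarrow> sum f A \<in> monomials_span V Q"
proof (induction A rule: infinite_finite_induct)
  case (insert x A)
  have "p + q \<in> monomials_span V Q" if "p \<in> monomials_span V Q" "q \<in> monomials_span V Q" for p q :: "('v, 'k) mpoly"
    using that keys_add[of p q] unfolding monomials_span_def poly_ring_def by blast
  then show ?case using insert by auto
qed (auto simp: monomials_span_def poly_ring_def)

lemma ideal_gen_subset: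
  fixes S :: "('v, 'k::field) mpoly set"
  assumes "\<And>m m'. Q m' \<Longrightarrow> Q (m + m')" "S \<subseteq> monomials_span V Q"
  shows "ideal_gen V S \<subseteq> monomials_span V Q"
proof
  fix p assume "p \<in> ideal_gen V S"
  then obtain T q where T: "p = (\<Sum>f\<in>T. q f * f)" "T \<subseteq> S" "q ` T \<subseteq> poly_ring V"
    unfolding ideal_gen_def by blast
  have "q f * f \<in> monomials_span V Q" if "f \<in> T" for f
  proof (rule monomials_span_mult[where Q = "\<lambda>_. True"])
    show "q f \<in> monomials_span V (\<lambda>_. True)" using T(3) that by (auto simp: monomials_span_def)
    show "f \<in> monomials_span V Q" using T(2) assms(2) that by blast
  qed (rule assms(1))
  then show "p \<in> monomials_span V Q" unfolding T(1) by (rule monomials_span_sum)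
qed

lemma ideal_gen_mult:
  fixes S :: "('v, 'k::field) mpoly set"
  assumes "f \<in> S" "p \<in> poly_ring V" shows "p * f \<in> ideal_gen V S"
  unfolding ideal_gen_def using assms by (intro CollectI exI[of _ "{f}"] exI[of _ "\<lambda>_. p"]) simp

lemma one_poly_ring: "1 \<in> poly_ring V"
  by (simp add: poly_ring_def)

lemma ideal_gen_base: "f \<in> S \<Longrightarrow> f \<in> ideal_gen V S"
  using ideal_gen_mult[OF _ one_poly_ring, of f S V] by simp

lemma ideal_gen_add:
  fixes S :: "('v, 'k::field) mpoly set"
  assumes p: "p \<in> ideal_gen V S" and p': "p' \<in> ideal_gen V S"
  shows "p + p' \<in> ideal_gen V S"
proof -
  obtain T q where T: "p = (\<Sum>f\<in>T. q f * f)" "finite T" "T \<subseteq> S" "q ` T \<subseteq> poly_ring V"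
    using p unfolding ideal_gen_def by blast
  obtain T' q' where T': "p' = (\<Sum>f\<in>T'. q' f * f)" "finite T'" "T' \<subseteq> S" "q' ` T' \<subseteq> poly_ring V"
    using p' unfolding ideal_gen_def by blast
  \<comment> \<open>\<open>ideal_gen\<close> allows one coefficient per generator, so coefficients
    of common generators are added.\<close>
  define r where "r f = (if f \<in> T then q f else 0) + (if f \<in> T' then q' f else 0)" for f
  have add: "a + b \<in> poly_ring V" if "a \<in> poly_ring V" "b \<in> poly_ring V" for a b :: "('v, 'k) mpoly"
    using that keys_add[of a b] unfolding poly_ring_def by blast
  have zero: "(0 :: ('v, 'k) mpoly) \<in> poly_ring V" by (simp add: poly_ring_def)
  have "p = (\<Sum>f\<in>T \<union> T'. (if f \<in> T then q f else 0) * f)"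
    unfolding T(1) by (rule sum.mono_neutral_cong_left) (use T(2) T'(2) in auto)
  moreover have "p' = (\<Sum>f\<in>T \<union> T'. (if f \<in> T' then q' f else 0) * f)"
    unfolding T'(1) by (rule sum.mono_neutral_cong_left) (use T(2) T'(2) in auto)
  ultimately have "p + p' = (\<Sum>f\<in>T \<union> T'. r f * f)"
    by (simp add: r_def distrib_right sum.distrib)
  moreover have "r f \<in> poly_ring V" for f
    unfolding r_def by (intro add) (use T(4) T'(4) zero in auto)
  ultimately show ?thesis
    unfolding ideal_gen_def using T(2,3) T'(2,3)
    by (intro CollectI exI[of _ "T \<union> T'"] exI[of _ r]) auto
qed

lemma subset_ideal_gen:
  fixes S :: "('v, 'k::field) mpoly set"
  assumes "\<And>m. Q m \<Longrightarrow> Poly_Mapping.keys m \<subseteq> V \<Longrightarrow>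
    \<exists>m' m''. m = m' + m'' \<and> Poly_Mapping.single m'' 1 \<in> S"
  shows "monomials_span V Q \<subseteq> ideal_gen V S"
proof
  fix p :: "('v, 'k) mpoly" assume p: "p \<in> monomials_span V Q"
  have p_eq: "p = (\<Sum>m\<in>Poly_Mapping.keys p. Poly_Mapping.single m (Poly_Mapping.lookup p m))"
  proof (rule poly_mapping_eqI)
    fix m
    have "(\<Sum>x\<in>Poly_Mapping.keys p. Poly_Mapping.lookup (Poly_Mapping.single x (Poly_Mapping.lookup p x)) m)
        = (\<Sum>x\<in>Poly_Mapping.keys p. if x = m then Poly_Mapping.lookup p m else 0)"
      by (intro sum.cong refl) (auto simp: lookup_single when_def)
    then show "Poly_Mapping.lookup p m
        = Poly_Mapping.lookup (\<Sum>m\<in>Poly_Mapping.keys p. Poly_Mapping.single m (Poly_Mapping.lookup p m)) m"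
      by (simp add: lookup_sum in_keys_iff)
  qed
  have mem: "Poly_Mapping.single m (Poly_Mapping.lookup p m) \<in> ideal_gen V S" if m: "m \<in> Poly_Mapping.keys p" for m
  proof -
    have mV: "Q m" "Poly_Mapping.keys m \<subseteq> V" using p m unfolding monomials_span_def poly_ring_def by blast+
    then obtain m' m'' where eq: "m = m' + m''" "Poly_Mapping.single m'' 1 \<in> S" using assms by blast
    have "Poly_Mapping.single m' (Poly_Mapping.lookup p m) * Poly_Mapping.single m'' 1 \<in> ideal_gen V S"
      by (rule ideal_gen_mult[OF eq(2)]) (use mV(2) in \<open>auto simp: poly_ring_def eq(1) keys_add_nat\<close>)
    then show ?thesis by (simp add: mult_single eq(1))
  qed
  have zero: "0 \<in> ideal_gen V S" unfolding ideal_gen_def by (auto intro!: exI[of _ "{}"])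
  have sum_mem: "(\<Sum>m\<in>A. f m) \<in> ideal_gen V S" if "\<And>m. m \<in> A \<Longrightarrow> f m \<in> ideal_gen V S"
    for A and f :: "('v \<Rightarrow>\<^sub>0 nat) \<Rightarrow> ('v, 'k) mpoly"
    using that
  proof (induction A rule: infinite_finite_induct)
    case (insert x A)
    then show ?case unfolding sum.insert[OF insert.hyps] by (intro ideal_gen_add) auto
  qed (simp_all add: zero)
  have "(\<Sum>m\<in>Poly_Mapping.keys p. Poly_Mapping.single m (Poly_Mapping.lookup p m)) \<in> ideal_gen V S"
    by (rule sum_mem) (rule mem)
  then show "p \<in> ideal_gen V S" using p_eq by metis
qed

definition has_two_matching :: "'v set set \<Rightarrow> 'v set \<Rightarrow> bool" where
  "has_two_matching E A \<longleftrightarrow> (\<exists>e\<in>E. \<exists>f\<in>E. e \<inter> f = {} \<and> e \<subseteq> A \<and> f \<subseteq> A)"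

lemma has_two_matching_mono: "A \<subseteq> B \<Longrightarrow> has_two_matching E A \<Longrightarrow> has_two_matching E B"
  unfolding has_two_matching_def by blast

lemma var_mult_var:
  assumes "a \<noteq> b" shows "var a * var b = (Poly_Mapping.single (ind {a, b}) 1 :: ('v, 'k::field) mpoly)"
  using assms by (simp add: var_def mult_single ind_def)

lemma edge_ideal_subset:
  assumes E: "\<And>e. e \<in> E \<Longrightarrow> e \<subseteq> V \<and> card e = 2"
  shows "(edge_ideal V E :: ('v, 'k::field) mpoly set) \<subseteq> monomials_span V (\<lambda>m. \<exists>e\<in>E. e \<subseteq> Poly_Mapping.keys m)"
  unfolding edge_ideal_def
proof (rule ideal_gen_subset)
  show "\<exists>e\<in>E. e \<subseteq> Poly_Mapping.keys (m + m')" if "\<exists>e\<in>E. e \<subseteq> Poly_Mapping.keys m'" for m m' :: "'v \<Rightarrow>\<^sub>0 nat"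
    using that unfolding keys_add_nat by blast
  show "{var x * var y |x y. {x, y} \<in> E} \<subseteq> (monomials_span V (\<lambda>m. \<exists>e\<in>E. e \<subseteq> Poly_Mapping.keys m) :: ('v, 'k) mpoly set)"
  proof (clarify)
    fix x y assume xy: "{x, y} \<in> E"
    then have "x \<noteq> y" "{x, y} \<subseteq> V" using E[OF xy] by auto
    then show "var x * var y \<in> (monomials_span V (\<lambda>m. \<exists>e\<in>E. e \<subseteq> Poly_Mapping.keys m) :: ('v, 'k) mpoly set)"
      using xy by (auto simp: var_mult_var monomials_span_def poly_ring_def keys_ind)
  qed
qed

lemma squarefree_square_edge_ideal:
  assumes E: "\<And>e. e \<in> E \<Longrightarrow> e \<subseteq> V \<and> card e = 2"
  shows "squarefree_square V (edge_ideal V E :: ('v, 'k::field) mpoly set) = monomial_span V (has_two_matching E)"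
proof
  let ?I = "edge_ideal V E :: ('v, 'k) mpoly set"
  let ?Q = "\<lambda>m. \<exists>m1 m2. m = m1 + m2 \<and> (\<exists>e\<in>E. e \<subseteq> Poly_Mapping.keys m1) \<and> (\<exists>e\<in>E. e \<subseteq> Poly_Mapping.keys m2)"
  have prod: "ideal_mult V ?I ?I \<subseteq> monomials_span V ?Q"
    unfolding ideal_mult_def
  proof (rule ideal_gen_subset)
    show "?Q (m + m')" if Qm: "?Q m'" for m m' :: "'v \<Rightarrow>\<^sub>0 nat"
    proof -
      obtain m1 m2 where m: "m' = m1 + m2" "\<exists>e\<in>E. e \<subseteq> Poly_Mapping.keys m1" "\<exists>e\<in>E. e \<subseteq> Poly_Mapping.keys m2"
        using Qm by blast
      have "m + m' = (m + m1) + m2" by (simp add: m(1) add.assoc)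
      moreover have "\<exists>e\<in>E. e \<subseteq> Poly_Mapping.keys (m + m1)" using m(2) unfolding keys_add_nat by blast
      ultimately show ?thesis using m(3) by blast
    qed
    show "{f * g |f g. f \<in> ?I \<and> g \<in> ?I} \<subseteq> monomials_span V ?Q"
    proof clarify
      fix f g assume "f \<in> ?I" "g \<in> ?I"
      show "f * g \<in> monomials_span V ?Q"
      proof -
        let ?e = "\<lambda>m. \<exists>e\<in>E. e \<subseteq> Poly_Mapping.keys m"
        have sub: "?I \<subseteq> monomials_span V ?e" using E by (rule edge_ideal_subset)
        show ?thesis
        proof (rule monomials_span_mult[where Q = ?e and Q' = ?e])
          show "f \<in> monomials_span V ?e" by (rule subsetD[OF sub \<open>f \<in> ?I\<close>])
          show "g \<in> monomials_span V ?e" by (rule subsetD[OF sub \<open>g \<in> ?I\<close>])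
          show "?Q (m + m')" if "?e m" "?e m'" for m m' using that by (intro exI[of _ m] exI[of _ m'] conjI refl)
        qed
      qed
    qed
  qed
  show "squarefree_square V ?I \<subseteq> monomial_span V (has_two_matching E)"
    unfolding squarefree_square_def monomials_span_keys[symmetric]
  proof (rule ideal_gen_subset)
    show "has_two_matching E (Poly_Mapping.keys (m + m'))" if "has_two_matching E (Poly_Mapping.keys m')" for m m' :: "'v \<Rightarrow>\<^sub>0 nat"
      by (rule has_two_matching_mono[OF _ that]) (simp add: keys_add_nat)
    show "{f \<in> ideal_mult V ?I ?I. squarefree_monomial f} \<subseteq> monomials_span V (\<lambda>m. has_two_matching E (Poly_Mapping.keys m))"
    proof clarify
      fix f assume f: "f \<in> ideal_mult V ?I ?I" "squarefree_monomial f"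
      then obtain m where m: "f = Poly_Mapping.single m 1" "\<And>v. Poly_Mapping.lookup m v \<le> 1"
        unfolding squarefree_monomial_def by blast
      have fQ: "f \<in> monomials_span V ?Q" using prod f(1) by blast
      then have "?Q m" by (simp add: m(1) monomials_span_def)
      then obtain m1 m2 e e' where e: "m = m1 + m2" "e \<in> E" "e \<subseteq> Poly_Mapping.keys m1" "e' \<in> E" "e' \<subseteq> Poly_Mapping.keys m2"
        by blast
      \<comment> \<open>A common vertex would have exponent at least 2 in a squarefree
        monomial.\<close>
      have "e \<inter> e' = {}"
      proof (rule ccontr)
        assume "e \<inter> e' \<noteq> {}"
        then obtain v where "v \<in> Poly_Mapping.keys m1" "v \<in> Poly_Mapping.keys m2" using e by blast
        then have "Poly_Mapping.lookup m v \<ge> 2" by (auto simp: e(1) lookup_add in_keys_iff)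
        then show False using m(2)[of v] by simp
      qed
      then have "has_two_matching E (Poly_Mapping.keys m)"
        using e unfolding has_two_matching_def e(1) keys_add_nat by blast
      then show "f \<in> monomials_span V (\<lambda>m. has_two_matching E (Poly_Mapping.keys m))"
        using fQ by (simp add: monomials_span_def m(1))
    qed
  qed
  show "monomial_span V (has_two_matching E) \<subseteq> squarefree_square V ?I"
    unfolding squarefree_square_def monomials_span_keys[symmetric]
  proof (rule subset_ideal_gen)
    fix m :: "'v \<Rightarrow>\<^sub>0 nat" assume "has_two_matching E (Poly_Mapping.keys m)"
    then obtain e f where ef: "e \<in> E" "f \<in> E" "e \<inter> f = {}" "e \<subseteq> Poly_Mapping.keys m" "f \<subseteq> Poly_Mapping.keys m"
      unfolding has_two_matching_def by blast
    obtain a b where e: "e = {a, b}" "a \<noteq> b" using E[OF ef(1)] by (auto simp: card_2_iff)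
    obtain a' b' where f: "f = {a', b'}" "a' \<noteq> b'" using E[OF ef(2)] by (auto simp: card_2_iff)
    have fin: "finite e" "finite f" using e f by auto
    have "ind (e \<union> f) = ind e + ind f"
      using fin ef(3) by (intro poly_mapping_eqI) (auto simp: lookup_ind lookup_add)
    then have eq: "Poly_Mapping.single (ind (e \<union> f)) 1 = (var a * var b) * (var a' * var b' :: ('v, 'k) mpoly)"
      using e f by (simp add: var_mult_var mult_single)
    have "var a * var b \<in> ?I" "var a' * var b' \<in> ?I"
      unfolding edge_ideal_def by (rule ideal_gen_base, use ef(1,2) e(1) f(1) in blast)+
    then have "Poly_Mapping.single (ind (e \<union> f)) 1 \<in> ideal_mult V ?I ?I"
      unfolding eq ideal_mult_def by (intro ideal_gen_base) blast
    moreover have "squarefree_monomial (Poly_Mapping.single (ind (e \<union> f)) 1 :: ('v, 'k) mpoly)"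
      unfolding squarefree_monomial_def using fin by (auto simp: lookup_ind)
    moreover have "m = (m - ind (e \<union> f)) + ind (e \<union> f)"
      using minus_ind_add[of "e \<union> f" m] fin ef(4,5) by simp
    ultimately show "\<exists>m' m''. m = m' + m'' \<and> (Poly_Mapping.single m'' 1 :: ('v, 'k) mpoly) \<in> {f \<in> ideal_mult V ?I ?I. squarefree_monomial f}"
      by (intro exI[of _ "m - ind (e \<union> f)"] exI[of _ "ind (e \<union> f)"]) simp
  qed
qed

section \<open>Admissible matchings\<close>


text \<open>The parts are nonempty and their number is at least \<open>card M - 1\<close>, so at
  most one part has two edges and all others are singletons. This makes all edges except
  \<open>e\<close> and \<open>f\<close> separate components of the induced subgraph.\<close>

lemma two_admissibleE:
  assumes fin: "finite M" and M: "two_admissible E M" and two: "card M \<ge> 2" and E: "\<And>e. e \<in> E \<Longrightarrow> card e = 2"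
  obtains e f where "e \<in> M" "f \<in> M" "e \<noteq> f"
    "\<And>g. g \<in> E \<Longrightarrow> g \<subseteq> \<Union>M \<Longrightarrow> g \<subseteq> e \<union> f \<or> g \<in> M - {e, f}"
proof -
  obtain P where P: "partition_on M P" "card M \<le> card P + 1"
    and edges: "\<And>g. g \<in> E \<Longrightarrow> g \<subseteq> \<Union>M \<Longrightarrow> \<exists>N\<in>P. g \<subseteq> \<Union>N"
    using M unfolding two_admissible_def induced_edges_def by auto
  have ME: "M \<subseteq> E" using M by (simp add: two_admissible_def matching_def)
  have PM: "N \<subseteq> M" "finite N" "card N \<ge> 1" if "N \<in> P" for N
  proof -
    show "N \<subseteq> M" using partition_onD1[OF P(1)] that by blast
    then show "finite N" using fin finite_subset by blast
    then show "card N \<ge> 1" using partition_onD3[OF P(1)] that by (metis One_nat_def Suc_leI card_gt_0_iff)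
  qed
  have finP: "finite P" using fin P(1) by (metis finite_UnionD partition_onD1)
  have cardM: "card M = (\<Sum>N\<in>P. card N)"
  proof -
    have "disjoint P" by (rule partition_onD2[OF P(1)])
    then show ?thesis
      unfolding partition_onD1[OF P(1)] by (rule card_Union_disjoint) (rule PM(2))
  qed
  have "\<exists>e\<in>M. \<exists>f\<in>M. e \<noteq> f \<and> (\<forall>N\<in>P. N \<subseteq> {e, f} \<or> (\<exists>g\<in>M - {e, f}. N = {g}))"
  proof (cases "\<exists>N\<in>P. card N \<ge> 2")
    case False
    then have "card N = 1" if "N \<in> P" for N using PM(3)[OF that] that by force
    then have single: "\<exists>g. N = {g}" if "N \<in> P" for N using that by (meson card_1_singletonE)
    \<comment> \<open>If all parts are singletons, any two edges can play the special role.\<close>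
    obtain e where e: "e \<in> M" using two by fastforce
    have "card (M - {e}) \<ge> 1" using two e fin by (simp add: card_Diff_singleton)
    then have "M - {e} \<noteq> {}" by (metis card.empty not_one_le_zero)
    then obtain f where f: "f \<in> M" "f \<noteq> e" by blast
    have "N \<subseteq> {e, f} \<or> (\<exists>g\<in>M - {e, f}. N = {g})" if N: "N \<in> P" for N
    proof -
      obtain g where "N = {g}" using single[OF N] by blast
      then show ?thesis using PM(1)[OF N] by blast
    qed
    then show ?thesis using e f by blast
  next
    case True
    then obtain N0 where N0: "N0 \<in> P" "card N0 \<ge> 2" by blast
    have sum0: "card M = card N0 + (\<Sum>N\<in>P - {N0}. card N)"
      unfolding cardM by (rule sum.remove[OF finP N0(1)])
    have "card P = Suc (card (P - {N0}))" using card_Suc_Diff1[OF finP N0(1)] by simp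
    then have le: "card N0 + (\<Sum>N\<in>P - {N0}. card N) \<le> card (P - {N0}) + 2" using P(2) sum0 by simp
    have ge: "card (P - {N0}) \<le> (\<Sum>N\<in>P - {N0}. card N)"
      using sum_mono[of "P - {N0}" "\<lambda>_. 1" card] PM(3) by simp
    then have "card N0 = 2" and eq: "(\<Sum>N\<in>P - {N0}. card N) = card (P - {N0})" using le N0(2) by linarith+
    then obtain e f where ef: "N0 = {e, f}" "e \<noteq> f" by (auto simp: card_2_iff)
    have one: "card N = 1" if N: "N \<in> P - {N0}" for N
    proof (rule ccontr)
      assume "card N \<noteq> 1"
      then have "1 < card N" using PM(3)[of N] N by simp
      then have "(\<Sum>N\<in>P - {N0}. 1) < (\<Sum>N\<in>P - {N0}. card N)"
        by (intro sum_strict_mono_ex1) (use finP PM(3) N in auto)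
      then show False using eq by simp
    qed
    have "N \<subseteq> {e, f} \<or> (\<exists>g\<in>M - {e, f}. N = {g})" if N: "N \<in> P" for N
    proof (cases "N = N0")
      case False
      then obtain g where g: "N = {g}" using one[of N] N by (metis DiffI card_1_singletonE singletonD)
      have "N \<inter> N0 = {}" using partition_onD2[OF P(1)] N N0(1) False by (rule disjointD)
      then have "g \<notin> {e, f}" "g \<in> M" using g ef PM(1)[OF N] by auto
      then show ?thesis using g by blast
    qed (simp add: ef)
    moreover have "e \<in> M" "f \<in> M" using PM(1)[OF N0(1)] ef by auto
    ultimately show ?thesis using ef(2) by (intro bexI[of _ e] bexI[of _ f]) simp_all
  qed
  then obtain e f where ef: "e \<in> M" "f \<in> M" "e \<noteq> f"
    and N': "\<forall>N\<in>P. N \<subseteq> {e, f} \<or> (\<exists>g\<in>M - {e, f}. N = {g})" by (elim bexE conjE)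
  note N = bspec[OF N']
  show thesis
  proof (rule that[OF ef])
    fix g assume g: "g \<in> E" "g \<subseteq> \<Union>M"
    then obtain N' where N': "N' \<in> P" "g \<subseteq> \<Union>N'" using edges by blast
    from N[OF N'(1)] show "g \<subseteq> e \<union> f \<or> g \<in> M - {e, f}"
    proof
      assume "N' \<subseteq> {e, f}"
      then show ?thesis using N'(2) by blast
    next
      assume "\<exists>g\<in>M - {e, f}. N' = {g}"
      then obtain h where h: "h \<in> M - {e, f}" "N' = {h}" by blast
      have "card h = 2" "card g = 2" using h(1) ME g(1) E by auto
      have "g = h"
      proof (rule card_subset_eq)
        show "finite h" using \<open>card h = 2\<close> by (metis card.infinite zero_neq_numeral)
        show "g \<subseteq> h" using N'(2) h(2) by simp
      qed (simp add: \<open>card h = 2\<close> \<open>card g = 2\<close>)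
      then show ?thesis using h(1) by blast
    qed
  qed
qed

lemma finite_matchings:
  assumes "simple_graph V E" shows "finite E" "finite {card M |M. two_admissible E M}" "finite {card M |M. matching E M}"
proof -
  show fin: "finite E"
    by (rule finite_subset[of _ "Pow V"]) (use assms in \<open>auto simp: simple_graph_def\<close>)
  have "{card M |M. matching E M} \<subseteq> card ` Pow E" by (auto simp: matching_def)
  then show "finite {card M |M. matching E M}" by (rule finite_subset) (simp add: fin)
  have "{card M |M. two_admissible E M} \<subseteq> card ` Pow E" by (auto simp: matching_def two_admissible_def)
  then show "finite {card M |M. two_admissible E M}" by (rule finite_subset) (simp add: fin)
qed

text \<open>Two disjoint edges in a single part satisfy the size condition
  \<open>2 \<le> 1 + 1\<close>.\<close>

lemma aim2_ge_2:
  assumes G: "simple_graph V E" and "matching_number E \<ge> 2"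
  shows "aim2 E \<ge> 2"
proof -
  have "{card M |M. matching E M} \<noteq> {}" by (auto simp: matching_def intro: exI[of _ "{}"])
  from Max_in[OF finite_matchings(3)[OF G] this] obtain M where M: "matching E M" "card M = matching_number E"
    unfolding matching_number_def by auto
  then obtain M' where M': "M' \<subseteq> M" "card M' = 2" "finite M'" using assms(2) by (metis obtain_subset_with_card_n)
  have ne: "M' \<noteq> {}" using M'(2) by auto
  have "disjoint M'" using M(1) M'(1) unfolding matching_def by (meson pairwise_subset)
  then have "matching E M'" using M(1) M'(1) by (auto simp: matching_def)
  moreover have "partition_on M' {M'}" using ne by (auto simp: partition_on_def)
  ultimately have "two_admissible E M'"
    unfolding two_admissible_def using M'(2) by (auto intro!: exI[of _ "{M'}"] simp: induced_edges_def)
  then show ?thesis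
    unfolding aim2_def using Max_ge[OF finite_matchings(2)[OF G], of 2] M'(2) by auto
qed

text \<open>The two vertices of a pair receive consecutive numbers, so every other vertex compares
  in the same way with both. Pairs use the numbers below \<open>2 * card L\<close>, the remaining
  vertices those from there on.\<close>

lemma pair_order:
  fixes p q :: "'l \<Rightarrow> 'v"
  assumes V: "finite V" and L: "finite L" and inj: "inj_on p L" "inj_on q L" "p ` L \<inter> q ` L = {}"
  obtains ord :: "'v \<Rightarrow> nat" where "inj_on ord V" "\<And>l. l \<in> L \<Longrightarrow> ord (q l) = Suc (ord (p l))"
proof -
  obtain h :: "'l \<Rightarrow> nat" where h: "inj_on h L" "h ` L \<subseteq> {..<card L}"
    using ex_bij_betw_finite_nat[OF L] unfolding bij_betw_def by (metis atLeast0LessThan order_refl)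
  obtain k :: "'v \<Rightarrow> nat" where k: "inj_on k V"
    using finite_imp_inj_to_nat_seg[OF V] by blast
  define ord where "ord v = (if v \<in> p ` L then 2 * h (the_inv_into L p v)
      else if v \<in> q ` L then 2 * h (the_inv_into L q v) + 1 else 2 * card L + k v)" for v
  have op: "ord (p l) = 2 * h l" if "l \<in> L" for l
    using that by (simp add: ord_def the_inv_into_f_f[OF inj(1)])
  have oq: "ord (q l) = 2 * h l + 1" if "l \<in> L" for l
    using that inj(3) by (auto simp: ord_def the_inv_into_f_f[OF inj(2)])
  have hL: "h l < card L" if "l \<in> L" for l using h(2) that by auto
  have orest: "ord v = 2 * card L + k v" if "v \<notin> p ` L" "v \<notin> q ` L" for v using that by (simp add: ord_def)
  have "inj_on ord V"
  proof (rule inj_onI)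
    fix u v assume uv: "u \<in> V" "v \<in> V" "ord u = ord v"
    have cases: "(\<exists>l\<in>L. x = p l \<and> ord x = 2 * h l) \<or> (\<exists>l\<in>L. x = q l \<and> ord x = 2 * h l + 1) \<or>
        ord x = 2 * card L + k x" for x
    proof -
      consider "x \<in> p ` L" | "x \<in> q ` L" | "x \<notin> p ` L" "x \<notin> q ` L" by blast
      then show ?thesis by cases (use op oq orest in auto)
    qed
    have hinj: "h l = h l' \<Longrightarrow> l = l'" if "l \<in> L" "l' \<in> L" for l l' using h(1) that by (auto dest: inj_onD)
    have big: "2 * h l \<noteq> 2 * card L + x" "2 * h l + 1 \<noteq> 2 * card L + x" if "l \<in> L" for l x
      using hL[OF that] by auto
    have par: "2 * a \<noteq> 2 * b + (1::nat)" for a b by presburger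
    have up: "ord u = 2 * h l \<Longrightarrow> l \<in> L \<Longrightarrow> \<not> (\<exists>l\<in>L. v = q l \<and> ord v = 2 * h l + 1) \<and> ord v \<noteq> 2 * card L + k v"
      "ord u = 2 * h l + 1 \<Longrightarrow> l \<in> L \<Longrightarrow> \<not> (\<exists>l\<in>L. v = p l \<and> ord v = 2 * h l) \<and> ord v \<noteq> 2 * card L + k v" for l
      using uv(3) par big by metis+
    have ur: "ord u = 2 * card L + k u \<Longrightarrow> \<not> (\<exists>l\<in>L. v = q l \<and> ord v = 2 * h l + 1) \<and> \<not> (\<exists>l\<in>L. v = p l \<and> ord v = 2 * h l)"
      using uv(3) big by metis
    from cases[of u] show "u = v"
    proof (elim disjE bexE conjE)
      fix l assume l: "l \<in> L" "u = p l" "ord u = 2 * h l"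
      then obtain l' where "l' \<in> L" "v = p l'" "ord v = 2 * h l'" using cases[of v] up(1)[of l] by blast
      then show ?thesis using l hinj[of l l'] uv(3) by simp
    next
      fix l assume l: "l \<in> L" "u = q l" "ord u = 2 * h l + 1"
      then obtain l' where "l' \<in> L" "v = q l'" "ord v = 2 * h l' + 1" using cases[of v] up(2)[of l] by blast
      then show ?thesis using l hinj[of l l'] uv(3) by simp
    next
      assume r: "ord u = 2 * card L + k u"
      then have "ord v = 2 * card L + k v" using cases[of v] ur by blast
      then show ?thesis using r uv k by (auto dest: inj_onD)
    qed
  qed
  then show thesis by (rule that) (simp add: op oq)
qed

section \<open>Cohen--Macaulay chordal graphs\<close>


text \<open>A free vertex chosen in each block has exactly its block as closed neighbourhood.
  Disjointness of the blocks then gives independence of the chosen vertices and uniqueness of the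
  adjacent one.\<close>

lemma simplicial_cover_exists:
  assumes G: "simple_graph V E" and cm: "cm_chordal V E" and s: "koszul_signs V s"
  obtains D z where "simplicial_cover V s (\<lambda>x y. {x, y} \<in> E) D z" "D \<subseteq> V"
proof -
  have E: "e \<subseteq> V \<and> card e = 2" if "e \<in> E" for e using G that by (simp add: simple_graph_def)
  obtain P where P: "partition_on V P" "\<And>W. W \<in> P \<Longrightarrow> maximal_clique V E W \<and> (\<exists>x\<in>W. free_vertex V E x)"
    using cm unfolding cm_chordal_def by blast
  have "\<forall>W\<in>P. \<exists>x. x \<in> W \<and> free_vertex V E x" using P(2) by blast
  then obtain fr where fr: "\<forall>W\<in>P. fr W \<in> W \<and> free_vertex V E (fr W)" by (rule bchoice[THEN exE])
  have "\<forall>v\<in>V. \<exists>W. W \<in> P \<and> v \<in> W" using partition_onD1[OF P(1)] by blast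
  then obtain bl where bl: "\<forall>v\<in>V. bl v \<in> P \<and> v \<in> bl v" by (rule bchoice[THEN exE])
  have irr: "{v} \<notin> E" for v using E[of "{v}"] by auto
  have PV: "W \<subseteq> V" if "W \<in> P" for W using that partition_onD1[OF P(1)] by blast
  have uniq: "W = W'" if "W \<in> P" "W' \<in> P" "v \<in> W" "v \<in> W'" for W W' v
    using disjointD[OF partition_onD2[OF P(1)] that(1,2)] that(3,4) by blast
  \<comment> \<open>The closed neighbourhood of a free vertex is a clique containing the block, so
    maximality makes them equal.\<close>
  have nb: "u \<in> W" if W: "W \<in> P" and u: "{fr W, u} \<in> E" for W u
  proof -
    have f: "fr W \<in> W" "free_vertex V E (fr W)" using fr W by auto
    have cW: "clique V E W" and mx: "\<And>W'. clique V E W' \<Longrightarrow> W \<subseteq> W' \<Longrightarrow> W' = W"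
      using P(2)[OF W] unfolding maximal_clique_def by blast+
    let ?N = "neighborhood V E (fr W)"
    have cN: "clique V E ?N" "fr W \<in> V" using f(2) by (simp_all add: free_vertex_def)
    have "clique V E (insert (fr W) ?N)"
      unfolding clique_def
    proof (intro conjI ballI impI)
      show "insert (fr W) ?N \<subseteq> V" using cN(2) by (auto simp: neighborhood_def)
      fix x y assume "x \<in> insert (fr W) ?N" "y \<in> insert (fr W) ?N" "x \<noteq> y"
      then consider "x = fr W" "y \<in> ?N" | "y = fr W" "x \<in> ?N" | "x \<in> ?N" "y \<in> ?N" by blast
      then show "{x, y} \<in> E"
      proof cases
        case 3
        then show ?thesis using cN(1) \<open>x \<noteq> y\<close> unfolding clique_def by blast
      qed (simp_all add: neighborhood_def insert_commute)
    qed
    moreover have "W \<subseteq> insert (fr W) ?N"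
    proof
      fix w assume "w \<in> W"
      then have "w \<noteq> fr W \<longrightarrow> {fr W, w} \<in> E" using cW f(1) unfolding clique_def by metis
      moreover have "w \<in> V" using \<open>w \<in> W\<close> PV[OF W] by (rule subsetD[rotated])
      ultimately show "w \<in> insert (fr W) ?N" by (cases "w = fr W") (simp_all add: neighborhood_def)
    qed
    ultimately have "insert (fr W) ?N = W" by (rule mx)
    moreover have "u \<in> ?N" using u E[OF u] by (simp add: neighborhood_def)
    ultimately show ?thesis by blast
  qed
  define D where "D = fr ` P"
  define z where "z v = fr (bl v)" for v
  interpret koszul_signs V s by (rule s)
  have "simplicial_cover V s (\<lambda>x y. {x, y} \<in> E) D z"
  proof
    show "{u, v} \<in> E \<Longrightarrow> {v, u} \<in> E" for u v by (simp add: insert_commute)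
    show "{v, v} \<notin> E" for v using irr by simp
    show "{u, v} \<in> E" if d: "d \<in> D" "{d, u} \<in> E" "{d, v} \<in> E" "u \<noteq> v" for d u v
    proof -
      obtain W where W: "W \<in> P" "d = fr W" using d(1) by (auto simp: D_def)
      have "u \<in> W" "v \<in> W" using nb[OF W(1)] d W(2) by auto
      moreover have "clique V E W" using P(2)[OF W(1)] by (simp add: maximal_clique_def)
      ultimately show ?thesis using d(4) by (simp add: clique_def)
    qed
    show "{d, d'} \<notin> E" if d: "d \<in> D" "d' \<in> D" for d d'
    proof
      assume e: "{d, d'} \<in> E"
      obtain W W' where W: "W \<in> P" "d = fr W" "W' \<in> P" "d' = fr W'" using d by (auto simp: D_def)
      have "d' \<in> W" using nb[OF W(1)] e W(2) by simp
      moreover have "d' \<in> W'" using fr W by simp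
      ultimately have "W = W'" using uniq W by blast
      then show False using e W irr by simp
    qed
    fix v assume "v \<in> V - D"
    then have v: "v \<in> V" "v \<notin> D" "bl v \<in> P" "v \<in> bl v" using bl by auto
    show "z v \<in> D" using v(3) by (simp add: z_def D_def)
    have "v \<noteq> z v" using v(2) \<open>z v \<in> D\<close> by metis
    then show "{v, z v} \<in> E"
    proof -
      have "clique V E (bl v)" using P(2)[OF v(3)] by (simp add: maximal_clique_def)
      moreover have "fr (bl v) \<in> bl v" using fr v(3) by simp
      ultimately show ?thesis using v(4) \<open>v \<noteq> z v\<close> unfolding clique_def z_def by metis
    qed
    fix d assume d: "d \<in> D" "{v, d} \<in> E"
    obtain W where W: "W \<in> P" "d = fr W" using d(1) by (auto simp: D_def)
    have "v \<in> W" using nb[OF W(1), of v] d(2) W(2) by (simp add: insert_commute)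
    then show "d = z v" using uniq[OF W(1) v(3) _ v(4)] W(2) by (simp add: z_def)
  qed
  moreover have "D \<subseteq> V" using fr PV by (auto simp: D_def)
  ultimately show thesis by (rule that)
qed

text \<open>Each \<open>t\<close> of \<open>T\<close> is matched with \<open>z t\<close>. By
  domination an edge touching \<open>z t\<close> from outside would force one touching
  \<open>t\<close>, so these pairs are induced and separate from the four given vertices.\<close>

lemma (in simplicial_cover) admissible_bound_aim2:
  assumes G: "simple_graph V E" and adj: "adj = (\<lambda>x y. {x, y} \<in> E)"
  shows "admissible_bound V (aim2 E)"
  unfolding admissible_bound_def
proof (intro ballI allI impI, elim conjE)
  fix a b a' b' T
  assume S: "a \<in> V" "b \<in> V" "a' \<in> V" "b' \<in> V" and T: "T \<subseteq> V - D" "indep T" "T \<inter> closed_nbhd {a, b, a', b'} = {}"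
    and dist: "distinct [a, b, a', b']" and ab: "adj a b" "adj a' b'"
  let ?S = "{a, b, a', b'}" and ?h = "\<lambda>t. {t, z t}"
  have finT: "finite T" using T(1) finite_V finite_subset by blast
  have TV: "t \<in> V" "t \<notin> D" "t \<in> V - D" if "t \<in> T" for t using T(1) that by auto
  have far: "u \<noteq> t" "\<not> adj u t" if "t \<in> T" "u \<in> ?S" for t u
  proof -
    have "t \<notin> closed_nbhd ?S" using T(3) that(1) by blast
    then have "t \<notin> ?S" "\<forall>u\<in>?S. \<not> adj u t" unfolding closed_nbhd_def by blast+
    then show "u \<noteq> t" "\<not> adj u t" using that(2) by metis+
  qed
  have dom: "adj t u" if "t \<in> T" "adj (z t) u" "u \<noteq> t" for t u
    by (rule D_clique[OF z_in_D[OF TV(3)[OF that(1)]] adj_sym[OF adj_z[OF TV(3)[OF that(1)]]] that(2) that(3)[symmetric]])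
  have far_z: "u \<noteq> z t" "\<not> adj u (z t)" if "t \<in> T" "u \<in> ?S" for t u
  proof -
    show "u \<noteq> z t" using far(2)[OF that] adj_sym[OF adj_z[OF TV(3)[OF that(1)]]] by metis
    show "\<not> adj u (z t)"
      using far[OF that] dom[OF that(1), of u] adj_sym[of u "z t"] adj_sym[of t u] by argo
  qed
  have TT: "\<not> adj t t'" if "t \<in> T" "t' \<in> T" for t t' using T(2) that by (simp add: indep_def)
  have Tz: "\<not> adj t (z t')" "t \<noteq> z t'" if "t \<in> T" "t' \<in> T" "t \<noteq> t'" for t t'
  proof -
    show "\<not> adj t (z t')"
      using dom[OF that(2), of t] TT[OF that(2,1)] that(3) adj_sym[of t "z t'"] by argo
    show "t \<noteq> z t'" using TV(2)[OF that(1)] z_in_D[OF TV(3)[OF that(2)]] by metis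
  qed
  have zz: "\<not> adj (z t) (z t')" if "t \<in> T" "t' \<in> T" for t t'
    by (rule D_indep[OF z_in_D[OF TV(3)[OF that(1)]] z_in_D[OF TV(3)[OF that(2)]]])
  define M where "M = {{a, b}, {a', b'}} \<union> ?h ` T"
  \<comment> \<open>The two given edges share a part and every other edge is alone:
    \<open>card T + 1\<close> parts for \<open>card T + 2\<close> edges, exactly what admissibility
    permits.\<close>
  define P where "P = insert {{a, b}, {a', b'}} ((\<lambda>t. {?h t}) ` T)"
  have inj: "inj_on ?h T"
  proof (rule inj_onI)
    fix t t' assume t: "t \<in> T" "t' \<in> T" "?h t = ?h t'"
    then have "t \<in> {t', z t'}" by blast
    then show "t = t'" using Tz(2)[OF t(1,2)] by blast
  qed
  have ne: "{a, b} \<noteq> {a', b'}" using dist by auto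
  have notin: "?h t \<notin> {{a, b}, {a', b'}}" if "t \<in> T" for t
  proof -
    have "t \<notin> ?S" using far(1)[OF that, of t] by metis
    then show ?thesis by blast
  qed
  have disj_h: "?h t \<inter> ?h t' = {}" if t: "t \<in> T" "t' \<in> T" "t \<noteq> t'" for t t'
  proof -
    have "z t \<noteq> z t'"
    proof
      assume "z t = z t'"
      then have "adj t (z t')" using adj_z[OF TV(3)[OF t(1)]] by simp
      then show False using Tz(1)[OF t] by blast
    qed
    then show ?thesis using Tz(2)[OF t] Tz(2)[OF t(2,1)] t(3) by auto
  qed
  have disj_S: "?h t \<inter> ?S = {}" if "t \<in> T" for t using far(1)[OF that] far_z(1)[OF that] by blast
  have "card M = card {{a, b}, {a', b'}} + card (?h ` T)"
    unfolding M_def by (rule card_Un_disjoint) (use finT notin in auto)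
  then have cardM: "card M = 2 + card T" using ne card_image[OF inj] by simp
  have "inj_on (\<lambda>t. {?h t}) T" using inj by (auto simp: inj_on_def)
  then have "card ((\<lambda>t. {?h t}) ` T) = card T" by (rule card_image)
  moreover have "{{a, b}, {a', b'}} \<notin> (\<lambda>t. {?h t}) ` T" using ne by auto
  ultimately have cardP: "card P = Suc (card T)" using finT by (simp add: P_def)
  have "matching E M"
    unfolding matching_def
  proof
    show "M \<subseteq> E" using ab adj_z[OF TV(3)] by (auto simp: M_def adj)
    show "disjoint M"
    proof (rule disjointI)
      fix e f assume ef: "e \<in> M" "f \<in> M" "e \<noteq> f"
      have S0: "{a, b} \<inter> {a', b'} = {}" using dist by auto
      have "x \<in> {{a, b}, {a', b'}} \<and> x \<subseteq> ?S \<or> (\<exists>t\<in>T. x = ?h t)" if "x \<in> M" for x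
        using that by (auto simp: M_def)
      from this[OF ef(1)] this[OF ef(2)] show "e \<inter> f = {}"
      proof (elim disjE conjE bexE)
        assume "e \<in> {{a, b}, {a', b'}}" "f \<in> {{a, b}, {a', b'}}"
        then show ?thesis using S0 ef(3) by blast
      next
        fix t assume "e \<subseteq> ?S" "t \<in> T" "f = ?h t"
        then show ?thesis using disj_S[of t] by blast
      next
        fix t assume "f \<subseteq> ?S" "t \<in> T" "e = ?h t"
        then show ?thesis using disj_S[of t] by blast
      next
        fix t t' assume t: "t \<in> T" "e = ?h t" "t' \<in> T" "f = ?h t'"
        then have "t \<noteq> t'" using ef(3) by metis
        then show ?thesis using disj_h[of t t'] t by simp
      qed
    qed
  qed
  moreover have "partition_on M P"
    unfolding partition_on_def
  proof (intro conjI disjointI)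
    show "\<Union>P = M" by (auto simp: P_def M_def)
    show "{} \<notin> P" by (auto simp: P_def)
    fix X Y assume XY: "X \<in> P" "Y \<in> P" "X \<noteq> Y"
    have shape: "Z = {{a, b}, {a', b'}} \<or> (\<exists>t\<in>T. Z = {?h t})" if "Z \<in> P" for Z
      using that unfolding P_def by (elim insertE imageE) metis+
    from shape[OF XY(1)] shape[OF XY(2)] show "X \<inter> Y = {}"
    proof (elim disjE bexE)
      assume "X = {{a, b}, {a', b'}}" "Y = {{a, b}, {a', b'}}"
      then show ?thesis using XY(3) by simp
    next
      fix t assume "X = {{a, b}, {a', b'}}" "t \<in> T" "Y = {?h t}"
      then show ?thesis using notin[of t] by (metis disjoint_iff singletonD)
    next
      fix t assume "Y = {{a, b}, {a', b'}}" "t \<in> T" "X = {?h t}"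
      then show ?thesis using notin[of t] by (metis disjoint_iff singletonD)
    next
      fix t t' assume "X = {?h t}" "Y = {?h t'}"
      then show ?thesis using XY(3) by (metis disjoint_iff singletonD)
    qed
  qed
  moreover have "\<exists>N\<in>P. g \<subseteq> \<Union>N" if g: "g \<in> E" "g \<subseteq> \<Union>M" for g
  proof -
    have "card g = 2" using G g(1) by (simp add: simple_graph_def)
    then obtain x y where xy: "g = {x, y}" "x \<noteq> y" by (auto simp: card_2_iff)
    have axy: "adj x y" "adj y x" using g(1) xy(1) by (simp_all add: adj insert_commute)
    have mem: "u \<in> ?S \<or> (\<exists>t\<in>T. u \<in> ?h t)" if "u \<in> \<Union>M" for u using that by (auto simp: M_def)
    have no: "\<not> adj u w" if "u \<in> ?S" "t \<in> T" "w \<in> ?h t" for u w t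
      using far(2)[OF that(2,1)] far_z(2)[OF that(2,1)] that(3) by (metis empty_iff insert_iff)
    have no2: "t = t'" if t: "t \<in> T" "t' \<in> T" "u \<in> ?h t" "w \<in> ?h t'" "adj u w" for t t' u w
    proof (rule ccontr)
      assume "t \<noteq> t'"
      then show False
        using t(3-5) TT[OF t(1,2)] Tz(1)[OF t(1,2)] Tz(1)[OF t(2,1)] zz[OF t(1,2)] adj_sym[OF t(5)]
        by (metis empty_iff insert_iff)
    qed
    have "x \<in> \<Union>M" "y \<in> \<Union>M" using g(2) xy(1) by blast+
    note mx = mem[OF this(1)] and my = mem[OF this(2)]
    show ?thesis
    proof (cases "x \<in> ?S")
      case True
      then have "\<not> (\<exists>t\<in>T. y \<in> ?h t)" using no[OF True] axy(1) by metis
      then have "y \<in> ?S" using my by metis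
      then have "g \<subseteq> \<Union>{{a, b}, {a', b'}}" using True \<open>y \<in> ?S\<close> unfolding xy(1) by auto
      then show ?thesis unfolding P_def by (rule bexI) (rule insertI1)
    next
      case False
      then obtain t where t: "t \<in> T" "x \<in> ?h t" using mx by metis
      have "y \<notin> ?S" using no[OF _ t] axy(2) by metis
      then obtain t' where t': "t' \<in> T" "y \<in> ?h t'" using my by metis
      have "t = t'" by (rule no2[OF t(1) t'(1) t(2) t'(2) axy(1)])
      then have "g \<subseteq> \<Union>{?h t}" using t t' unfolding xy(1) by simp
      moreover have "{?h t} \<in> P" unfolding P_def by (rule insertI2) (rule imageI[OF t(1)])
      ultimately show ?thesis by (rule bexI)
    qed
  qed
  ultimately have "two_admissible E M"
    unfolding two_admissible_def induced_edges_def using cardM cardP by (intro conjI exI[of _ P]) auto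
  then have "card M \<le> aim2 E"
    unfolding aim2_def by (intro Max_ge[OF finite_matchings(2)[OF G]]) auto
  then show "2 + card T \<le> aim2 E" by (simp add: cardM)
qed

theorem theorem5p8:
  fixes V :: "'v set" and E :: "'v set set"
  assumes "simple_graph V E"
    and "cm_chordal V E"
    and "matching_number E \<ge> 2"
  shows "regularity V (squarefree_square V (edge_ideal V E :: ('v, 'k::field) mpoly set))
           = int (aim2 E) + 2"
proof -
  note G = assms(1)
  have finV: "finite V" and E: "\<And>e. e \<in> E \<Longrightarrow> e \<subseteq> V \<and> card e = 2" using G by (auto simp: simple_graph_def)
  have "{card M |M. two_admissible E M} \<noteq> {}"
    by (auto simp: two_admissible_def matching_def partition_on_def induced_edges_def intro!: exI[of _ "{}"] dest: E)
  from Max_in[OF finite_matchings(2)[OF G] this]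
  obtain M where M: "two_admissible E M" "card M = aim2 E" unfolding aim2_def by auto
  have ME: "M \<subseteq> E" "disjoint M" using M(1) by (auto simp: two_admissible_def matching_def)
  have finM: "finite M" using ME(1) finite_matchings(1)[OF G] finite_subset by blast
  have two: "card M \<ge> 2" using aim2_ge_2[OF G assms(3)] M(2) by simp
  obtain e f where ef: "e \<in> M" "f \<in> M" "e \<noteq> f"
    and edges: "\<And>g. g \<in> E \<Longrightarrow> g \<subseteq> \<Union>M \<Longrightarrow> g \<subseteq> e \<union> f \<or> g \<in> M - {e, f}"
    using two_admissibleE[OF finM M(1) two conjunct2[OF E]] by blast
  \<comment> \<open>The edges apart from the special pair; each is a component of the induced
    subgraph, and their number is the homological degree.\<close>
  define L where "L = M - {e, f}"
  have L: "finite L" "L \<subseteq> E" "card L = aim2 E - 2"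
    using finM ME(1) ef M(2) by (auto simp: L_def card_Diff_subset)
  have "\<forall>g\<in>L. \<exists>x. g = {fst x, snd x} \<and> fst x \<noteq> snd x"
  proof
    fix g assume "g \<in> L"
    then have "card g = 2" using L(2) E by blast
    then obtain u w where "g = {u, w}" "u \<noteq> w" by (auto simp: card_2_iff)
    then show "\<exists>x. g = {fst x, snd x} \<and> fst x \<noteq> snd x" by (intro exI[of _ "(u, w)"]) simp
  qed
  then obtain pq where pq: "\<forall>g\<in>L. g = {fst (pq g), snd (pq g)} \<and> fst (pq g) \<noteq> snd (pq g)"
    by (rule bchoice[THEN exE])
  define p q where "p g = fst (pq g)" and "q g = snd (pq g)" for g
  have g_eq: "g = {p g, q g}" "p g \<noteq> q g" if "g \<in> L" for g
    using bspec[OF pq that] by (simp_all add: p_def q_def)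
  have pg: "p g \<in> g" "q g \<in> g" if "g \<in> L" for g using g_eq[OF that] by auto
  have dis: "g \<inter> g' = {}" if "g \<in> M" "g' \<in> M" "g \<noteq> g'" for g g' by (rule disjointD[OF ME(2) that])
  have LM: "g \<in> M" "g \<noteq> e" "g \<noteq> f" if "g \<in> L" for g using that by (auto simp: L_def)
  have same: "g = g'" if "g \<in> L" "g' \<in> L" "v \<in> g" "v \<in> g'" for g g' v
    using dis[OF LM(1)[OF that(1)] LM(1)[OF that(2)]] that(3,4) by blast
  have inj: "inj_on p L" "inj_on q L" "p ` L \<inter> q ` L = {}"
  proof -
    show "inj_on p L" by (rule inj_onI) (metis same pg(1))
    show "inj_on q L" by (rule inj_onI) (metis same pg(2))
    show "p ` L \<inter> q ` L = {}"
    proof (rule ccontr)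
      assume "p ` L \<inter> q ` L \<noteq> {}"
      then obtain g g' where g: "g \<in> L" "g' \<in> L" "p g = q g'" by auto
      then have "g = g'" using same[OF g(1,2) pg(1)[OF g(1)]] pg(2)[OF g(2)] by simp
      then show False using g g_eq(2) by blast
    qed
  qed
  define S where "S = e \<union> f"
  have efdis: "e \<inter> f = {}" by (rule dis[OF ef])
  have ef2: "card e = 2" "card f = 2" "finite e" "finite f" "e \<in> E" "f \<in> E"
  proof -
    show eE: "e \<in> E" "f \<in> E" using ef(1,2) ME(1) by auto
    show c: "card e = 2" "card f = 2" using eE E by auto
    show "finite e" "finite f" by (rule card_ge_0_finite, simp add: c)+
  qed
  have Sg: "S \<inter> g = {}" if "g \<in> L" for g
    using dis[OF ef(1) LM(1)[OF that]] dis[OF ef(2) LM(1)[OF that]] LM(2,3)[OF that] unfolding S_def by blast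
  have Spq: "S \<inter> p ` L = {}" "S \<inter> q ` L = {}" using Sg pg by blast+
  define W where "W = S \<union> p ` L \<union> q ` L"
  have W: "W = \<Union>M"
  proof -
    have "\<Union>L = p ` L \<union> q ` L" using g_eq(1) by blast
    moreover have "\<Union>M = S \<union> \<Union>L" using ef by (auto simp: S_def L_def)
    ultimately show ?thesis by (simp add: W_def Un_assoc)
  qed
  have WV: "W \<subseteq> V" unfolding W using ME(1) E by blast
  \<comment> \<open>Four vertices from \<open>e\<close> and \<open>f\<close> and two from each edge
    of \<open>L\<close>, where \<open>card L = aim2 E - 2\<close>.\<close>
  have cardW: "card W = card L + (aim2 E + 2)"
  proof -
    have "card S = 4" unfolding S_def using card_Un_disjoint[OF ef2(3,4) efdis] ef2(1,2) by simp
    moreover have "card W = card S + card (p ` L) + card (q ` L)"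
    proof -
      have "finite S" using ef2(3,4) by (simp add: S_def)
      moreover have "(S \<union> p ` L) \<inter> q ` L = {}" using Spq(2) inj(3) by blast
      ultimately show ?thesis
        unfolding W_def using L(1) Spq(1) by (simp add: card_Un_disjoint)
    qed
    ultimately show ?thesis
      using card_image[OF inj(1)] card_image[OF inj(2)] L(3) two M(2) by simp
  qed
  obtain ord :: "'v \<Rightarrow> nat" where ord: "inj_on ord V" "\<And>l. l \<in> L \<Longrightarrow> ord (q l) = Suc (ord (p l))"
    by (rule pair_order[OF finV L(1) inj]) metis
  define s where "s v \<tau> \<longleftrightarrow> even (card {u \<in> \<tau>. ord u < ord v})" for v \<tau>
  have signs: "koszul_signs V s"
    using koszul_signs_of_order[OF finV ord(1)] unfolding s_def[abs_def] .
  interpret koszul_signs V s by (rule signs)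
  obtain D z where cover: "simplicial_cover V s (\<lambda>x y. {x, y} \<in> E) D z" and DV: "D \<subseteq> V"
    by (rule simplicial_cover_exists[OF G assms(2) signs])
  interpret simplicial_cover V s "\<lambda>x y. {x, y} \<in> E" D z by (rule cover)
  have "admissible_bound V (aim2 E)" by (rule admissible_bound_aim2[OF G refl])
  then have "reg_le TYPE('k) two_edges V (Suc (Suc (aim2 E)))"
    by (intro reg_le_two_edges subset_refl) (use z_in_D DV in blast)+
  moreover have "two_edges = has_two_matching E"
  proof
    fix A
    show "two_edges A = has_two_matching E A"
    proof
      assume "two_edges A"
      then obtain a b a' b' where "a \<in> A" "b \<in> A" "a' \<in> A" "b' \<in> A" "distinct [a, b, a', b']" "{a, b} \<in> E" "{a', b'} \<in> E"
        unfolding two_edges_def by blast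
      then show "has_two_matching E A"
        unfolding has_two_matching_def by (intro bexI[of _ "{a, b}"] bexI[of _ "{a', b'}"]) auto
    next
      assume "has_two_matching E A"
      then obtain g h where gh: "g \<in> E" "h \<in> E" "g \<inter> h = {}" "g \<subseteq> A" "h \<subseteq> A" unfolding has_two_matching_def by blast
      obtain a b where g: "g = {a, b}" "a \<noteq> b" using E[OF gh(1)] by (auto simp: card_2_iff)
      obtain a' b' where h: "h = {a', b'}" "a' \<noteq> b'" using E[OF gh(2)] by (auto simp: card_2_iff)
      have m: "a \<in> A" "b \<in> A" "a' \<in> A" "b' \<in> A" using gh(4,5) g(1) h(1) by simp_all
      have e: "{a, b} \<in> E" "{a', b'} \<in> E" using gh(1,2) g(1) h(1) by simp_all
      have d: "distinct [a, b, a', b']" using gh(3) g h by auto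
      show "two_edges A"
        unfolding two_edges_def
        by (intro bexI[of _ a] bexI[of _ b] bexI[of _ a'] bexI[of _ b'] conjI d e m)
    qed
  qed
  ultimately have upper: "reg_le TYPE('k) (has_two_matching E) V (aim2 E + 2)" by simp
  \<comment> \<open>Taking \<open>s0\<close> in \<open>e\<close> leaves \<open>f\<close> untouched
    by every face of the simplex.\<close>
  obtain s0 where s0: "s0 \<in> e" using ef2(1) by fastforce
  have lower: "\<not> exact_sets TYPE('k) (has_two_matching E) W (card L)"
  proof (rule not_exact_transversals[OF L(1) WV W_def inj Spq])
    show "s0 \<in> S" using s0 by (simp add: S_def)
    fix l \<rho> assume l: "l \<in> L" and \<rho>: "\<rho> \<subseteq> W - {p l, q l}"
    have fin: "finite {u \<in> \<rho>. ord u < a}" for a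
      by (rule finite_subset[OF _ finV]) (use \<rho> WV in blast)
    have lV: "p l \<in> V" "q l \<in> V" using pg[OF l] L(2) l E by blast+
    \<comment> \<open>Consecutive numbers leave no vertex between \<open>p l\<close> and
      \<open>q l\<close>, so the two counts differ only by \<open>p l\<close> itself.\<close>
    have lt: "ord u < ord (q l) \<longleftrightarrow> ord u < ord (p l)" if "u \<in> \<rho>" for u
    proof -
      have "u \<in> V" "u \<noteq> p l" using that \<rho> WV by blast+
      then have "ord u \<noteq> ord (p l)" using ord(1) lV(1) by (meson inj_onD)
      then show ?thesis using ord(2)[OF l] by linarith
    qed
    have 1: "{u \<in> insert (q l) \<rho>. ord u < ord (p l)} = {u \<in> \<rho>. ord u < ord (p l)}"
      using ord(2)[OF l] by auto
    have 2: "{u \<in> insert (p l) \<rho>. ord u < ord (q l)} = insert (p l) {u \<in> \<rho>. ord u < ord (p l)}"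
      using ord(2)[OF l] lt by auto
    have "p l \<notin> {u \<in> \<rho>. ord u < ord (p l)}" by simp
    then show "s (p l) (insert (q l) \<rho>) \<noteq> s (q l) (insert (p l) \<rho>)"
      unfolding s_def 1 2 card_insert_disjoint[OF fin \<open>p l \<notin> _\<close>] by simp
  next
    fix v assume "v \<in> insert s0 (p ` L)"
    then consider "v = s0" | l where "l \<in> L" "v = p l" by blast
    then show "has_two_matching E (W - (insert s0 (p ` L) - {v}))"
    proof cases
      case 1
      \<comment> \<open>With \<open>s0\<close> put back, both \<open>e\<close> and \<open>f\<close>
        survive in the complement.\<close>
      have "S \<subseteq> W - (insert s0 (p ` L) - {v})" using 1 Spq(1) unfolding W_def by blast
      then show ?thesis unfolding has_two_matching_def using ef2(5,6) efdis by (intro bexI[of _ e] bexI[of _ f]) (auto simp: S_def)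
    next
      case (2 l)
      \<comment> \<open>With \<open>p l\<close> put back, the disjoint edges \<open>l\<close> and
        \<open>f\<close> survive.\<close>
      have sub: "f \<subseteq> S" "f \<subseteq> W" unfolding S_def W_def by blast+
      then have f: "f \<subseteq> W - (insert s0 (p ` L) - {v})" using s0 efdis Spq(1) by blast
      have "q l \<notin> p ` L" "q l \<noteq> s0" "v \<noteq> s0" using inj(3) 2 Spq s0 unfolding S_def by blast+
      moreover have "p l \<in> W" "q l \<in> W" using 2(1) by (simp_all add: W_def)
      ultimately have "{p l, q l} \<subseteq> W - (insert s0 (p ` L) - {v})" using 2(2) by simp
      then have "l \<subseteq> W - (insert s0 (p ` L) - {v})" using g_eq(1)[OF 2(1)] by simp
      moreover have "l \<inter> f = {}" using Sg[OF 2(1)] sub(1) by blast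
      ultimately show ?thesis
        unfolding has_two_matching_def
        by (intro bexI[of _ l] bexI[of _ f] conjI f ef2(6) subsetD[OF L(2) 2(1)])
    qed
  next
    fix \<tau> u assume \<tau>: "\<tau> \<subseteq> p ` L \<union> q ` L" "\<And>l. l \<in> L \<Longrightarrow> p l \<in> \<tau> \<longleftrightarrow> q l \<notin> \<tau>" and u: "u \<in> S"
    show "\<not> has_two_matching E (W - insert u \<tau>)"
    proof
      assume "has_two_matching E (W - insert u \<tau>)"
      then obtain g h where gh: "g \<in> E" "h \<in> E" "g \<inter> h = {}" "g \<subseteq> W - insert u \<tau>" "h \<subseteq> W - insert u \<tau>"
        unfolding has_two_matching_def by blast
      \<comment> \<open>A transversal meets every edge of \<open>L\<close>, so the complement has
        edges only within \<open>S - {u}\<close>. Its three vertices cannot carry two disjoint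
        edges.\<close>
      have inS: "x \<subseteq> S - {u}" if x: "x \<in> E" "x \<subseteq> W - insert u \<tau>" for x
      proof -
        have "x \<notin> L"
        proof
          assume "x \<in> L"
          then show False using g_eq(1)[of x] \<tau>(2)[of x] x(2) by blast
        qed
        moreover have "x \<subseteq> \<Union>M" using x(2) W by blast
        ultimately have "x \<subseteq> S" using edges[OF x(1)] unfolding S_def L_def by blast
        then show ?thesis using x(2) by blast
      qed
      have fin: "finite (S - {u})" using ef2(3,4) by (simp add: S_def)
      have "card (g \<union> h) = 4"
      proof -
        have c: "card g = 2" "card h = 2" using E gh(1,2) by simp_all
        then have "finite g" "finite h" by (metis card.infinite zero_neq_numeral)+
        then show ?thesis using card_Un_disjoint[OF _ _ gh(3)] c by simp
      qed
      moreover have "card (g \<union> h) \<le> card (S - {u})"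
        by (rule card_mono[OF fin]) (use inS gh in blast)
      moreover have "card (S - {u}) = 3"
        using u card_Un_disjoint[OF ef2(3,4) efdis] ef2(1,2) by (simp add: S_def card_Diff_singleton)
      ultimately show False by simp
    qed
  qed
  have "regularity V (monomial_span V (has_two_matching E) :: ('v, 'k) mpoly set) = int (aim2 E + 2)"
    by (rule regularity_monomial_span[OF has_two_matching_mono upper WV cardW lower])
  moreover have "squarefree_square V (edge_ideal V E :: ('v, 'k) mpoly set) = monomial_span V (has_two_matching E)"
    by (rule squarefree_square_edge_ideal) (rule E)
  ultimately show ?thesis by simp
qed

end
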